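(* Let $\boldsymbol{B}(t)$, $t\ge0$, be the classical (binary) branching Brownian motion started from one particle at $0$ whose particles have independent lifetimes distributed as $\tau\sim\operatorname{Exp}(1)$; write $B_\gamma(t)$, $\gamma\in\Gamma$, for the positions of the particles (branches) alive at time $t$. Then for every $T>0$ and every $c\in\mathbb{R}$, as $u\to\infty$, $$\mathbb{P}\{\exists\, t\in[0,T]\ \forall\,\gamma\in\Gamma:\ B_\gamma(t)-ct>u\}\sim e^{-T}\sqrt{\frac{2T}{\pi}}\,u^{-1}\exp\left(-\frac{(u+cT)^2}{2T}\right).$$
   Context: Classical branching Brownian motion: a single particle starts at $0$ at time $0$ and moves as a standard one-dimensional Brownian motion. After an independent exponential time with mean $1$ it splits into two particles, which move from the splitting position as independent standard Brownian motions and have their own independent $\operatorname{Exp}(1)$ branching clocks, independent of everything else; the construction is repeated for each particle. At each time $t$ the quantifier "for all $\gamma\in\Gamma$" ranges over all particles alive at time $t$. The notation $f(u)\sim g(u)$ means $f(u)/g(u)\to1$. *)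

theory Defs
  imports "HOL-Probability.Probability"
begin

definition standard_brownian_motion :: "'a measure \<Rightarrow> (real \<Rightarrow> 'a \<Rightarrow> real) \<Rightarrow> bool" where
  "standard_brownian_motion M X \<longleftrightarrow>
     prob_space M \<and>
     (\<forall>t\<ge>0. X t \<in> borel_measurable M) \<and>
     (AE \<omega> in M. X 0 \<omega> = 0) \<and>
     (\<forall>s t. 0 \<le> s \<longrightarrow> s < t \<longrightarrow>
        distributed M lborel (\<lambda>\<omega>. X t \<omega> - X s \<omega>) (normal_density 0 (sqrt (t - s)))) \<and>
     (\<forall>n (t :: nat \<Rightarrow> real). 0 \<le> t 0 \<longrightarrow> (\<forall>i<n. t i \<le> t (Suc i)) \<longrightarrow>
        prob_space.indep_vars M (\<lambda>_. borel) (\<lambda>i \<omega>. X (t (Suc i)) \<omega> - X (t i) \<omega>) {..<n}) \<and>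
     (AE \<omega> in M. continuous_on {0..} (\<lambda>t. X t \<omega>))"

text \<open>
  Particles carry Ulam--Harris labels: the root is the empty list, and the two children of
  \<open>\<gamma>\<close> are \<open>False # \<gamma>\<close> and \<open>True # \<gamma>\<close>.
  The particle \<open>\<gamma>\<close> has lifetime \<open>\<tau> \<gamma>\<close>, and \<open>W \<gamma> s\<close> is its displacement from its place of birth at
  age \<open>s\<close>; only the part of \<open>W \<gamma>\<close> up to age \<open>\<tau> \<gamma>\<close> is ever used.  All the lifetimes and all the
  displacement processes are jointly independent, that is, the \<open>\<sigma>\<close>-algebras they generate form one
  independent family, indexed by a disjoint sum of two copies of the labels because lifetimes and
  paths have different types.
\<close>

locale branching_brownian_motion = prob_space M
  for M :: "'a measure" +
  fixes \<tau> :: "bool list \<Rightarrow> 'a \<Rightarrow> real"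
    and W :: "bool list \<Rightarrow> real \<Rightarrow> 'a \<Rightarrow> real"
  assumes lifetime: "\<And>\<gamma>. distributed M lborel (\<tau> \<gamma>) (exponential_density 1)"
    and motion: "\<And>\<gamma>. standard_brownian_motion M (W \<gamma>)"
    and independence:
      "indep_sets (case_sum
         (\<lambda>\<gamma>. {\<tau> \<gamma> -` A \<inter> space M |A. A \<in> sets borel})
         (\<lambda>\<gamma>. {(\<lambda>\<omega>. \<lambda>s\<in>{0..}. W \<gamma> s \<omega>) -` A \<inter> space M |A. A \<in> sets (Pi\<^sub>M {0..} (\<lambda>_. borel))}))
         UNIV"

primrec birth_time :: "(bool list \<Rightarrow> 'a \<Rightarrow> real) \<Rightarrow> bool list \<Rightarrow> 'a \<Rightarrow> real" where
  "birth_time \<tau> [] \<omega> = 0"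
| "birth_time \<tau> (b # \<gamma>) \<omega> = birth_time \<tau> \<gamma> \<omega> + \<tau> \<gamma> \<omega>"

primrec birth_place ::
  "(bool list \<Rightarrow> 'a \<Rightarrow> real) \<Rightarrow> (bool list \<Rightarrow> real \<Rightarrow> 'a \<Rightarrow> real) \<Rightarrow> bool list \<Rightarrow> 'a \<Rightarrow> real" where
  "birth_place \<tau> W [] \<omega> = 0"
| "birth_place \<tau> W (b # \<gamma>) \<omega> = birth_place \<tau> W \<gamma> \<omega> + W \<gamma> (\<tau> \<gamma> \<omega>) \<omega>"

definition alive :: "(bool list \<Rightarrow> 'a \<Rightarrow> real) \<Rightarrow> real \<Rightarrow> 'a \<Rightarrow> bool list set" where
  "alive \<tau> t \<omega> = {\<gamma>. birth_time \<tau> \<gamma> \<omega> \<le> t \<and> t < birth_time \<tau> \<gamma> \<omega> + \<tau> \<gamma> \<omega>}"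

definition position ::
  "(bool list \<Rightarrow> 'a \<Rightarrow> real) \<Rightarrow> (bool list \<Rightarrow> real \<Rightarrow> 'a \<Rightarrow> real) \<Rightarrow> bool list \<Rightarrow> real \<Rightarrow> 'a \<Rightarrow> real" where
  "position \<tau> W \<gamma> t \<omega> = birth_place \<tau> W \<gamma> \<omega> + W \<gamma> (t - birth_time \<tau> \<gamma> \<omega>) \<omega>"

text \<open>
  The existential quantifier over the uncountably many times makes this event measurable only up
  to a null set (on which paths are discontinuous or the branching explodes), so its probability
  has to be taken in the completion of the underlying probability space.
\<close>

definition all_above_event ::
  "'a measure \<Rightarrow> (bool list \<Rightarrow> 'a \<Rightarrow> real) \<Rightarrow> (bool list \<Rightarrow> real \<Rightarrow> 'a \<Rightarrow> real) \<Rightarrow>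
   real \<Rightarrow> real \<Rightarrow> real \<Rightarrow> 'a set" where
  "all_above_event M \<tau> W T c u =
     {\<omega> \<in> space M. \<exists>t\<in>{0..T}. \<forall>\<gamma>\<in>alive \<tau> t \<omega>. position \<tau> W \<gamma> t \<omega> - c * t > u}"

end

theory Submission
  imports Defs "HOL-Real_Asymp.Real_Asymp"
begin

text \<open>
  Write \<open>\<Psi>\<close> for the upper tail of the standard normal distribution (\<open>gauss_tail\<close>). To leading
  order the event comes from a root that has not split by time \<open>T\<close>. This has probability
  \<open>exp (- T)\<close> and is independent of the motion of the root, and then the event says that a single
  Brownian motion crosses the line \<open>u + c * t\<close> during \<open>[0, T]\<close>.

  The probability of such a crossing is asymptotic to \<open>2 * \<Psi> ((u + c * T) / sqrt T)\<close>
  (\<open>sbm_crossing_asymp\<close>). A crossing before \<open>T - d\<close> is of smaller exponential order, because the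
  variance of the path is then at most \<open>T - d\<close>; and a path that crosses within the last \<open>d\<close> time
  units ends above the line with conditional probability between \<open>\<Psi> (\<bar>c\<bar> * sqrt d)\<close> and
  \<open>1 - \<Psi> (\<bar>c\<bar> * sqrt d)\<close>. Both bounds tend to \<open>1 / 2\<close> as \<open>d\<close> tends to \<open>0\<close>, so the reflection
  principle holds asymptotically although there is a drift. In place of the strong Markov
  property, the argument decomposes a random walk at its first passage over the level, where the
  walk samples the path on a finite dyadic grid, and then refines the grid.

  If the root splits at a time \<open>s \<le> T\<close>, follow one line of descent through each of its two
  children. When all particles are above the line, so are the two particles on these lines, and
  therefore their average. Given the lifetimes, this average is a Gaussian process with
  independent increments whose variance at time \<open>T\<close> is only \<open>(T + s) / 2\<close>, since after the split
  two independent motions are averaged. For \<open>s \<le> T - d\<close> this gives a smaller exponential order.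
  For \<open>s\<close> in \<open>(T - d, T]\<close> the bound has the order of the main term, but it is multiplied by the
  probability that the root splits in that short interval (\<open>prob_all_above_split_le\<close>).
  Conditioning on the lifetimes is elementary because they are first rounded up to multiples of
  \<open>1 / 2 ^ m\<close>: the finitely many lifetimes of interest then take countably many values, and each
  value can be treated separately by independence (\<open>prob_frozen_le\<close>).

  It remains to see that the event has a probability at all. Almost surely only finitely many
  particles are born before \<open>T\<close>, by a first moment bound, and all paths are continuous; the event
  may then be tested at dyadic times only (\<open>AE_dyadic_all_above_event\<close>).
\<close>

section \<open>The tail of the normal distribution\<close>

definition gauss_tail :: "real \<Rightarrow> real" where
  "gauss_tail x = measure std_normal_distribution {x<..}"

lemma gauss_tail_cdf: "gauss_tail x = 1 - cdf std_normal_distribution x"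
proof -
  interpret N: real_distribution std_normal_distribution by (rule real_dist_normal_dist)
  have "gauss_tail x = N.prob (space std_normal_distribution - {..x})"
    unfolding gauss_tail_def by (rule arg_cong[where f=N.prob]) auto
  also have "\<dots> = 1 - N.prob {..x}" by (rule N.prob_compl) auto
  finally show ?thesis by (simp add: cdf_def)
qed

lemma std_normal_measure_singleton: "measure std_normal_distribution {x} = 0"
proof -
  have "emeasure std_normal_distribution {x} = 0"
    by (subst emeasure_density) (auto intro!: nn_integral_null_set null_setsI)
  thus ?thesis by (simp add: measure_def)
qed

lemma isCont_gauss_tail: "isCont gauss_tail x"
proof -
  interpret N: real_distribution std_normal_distribution by (rule real_dist_normal_dist)
  have "isCont (cdf std_normal_distribution) x"
    by (simp add: N.isCont_cdf std_normal_measure_singleton)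
  thus ?thesis unfolding gauss_tail_cdf[abs_def] by (intro continuous_intros) 
qed

lemma gauss_tail_antimono: "x \<le> y \<Longrightarrow> gauss_tail y \<le> gauss_tail x"
proof -
  interpret N: real_distribution std_normal_distribution by (rule real_dist_normal_dist)
  show "x \<le> y \<Longrightarrow> gauss_tail y \<le> gauss_tail x"
    unfolding gauss_tail_def by (rule N.finite_measure_mono) auto
qed

lemma (in prob_space) prob_normal_greater:
  assumes X: "distributed M lborel X (normal_density 0 \<sigma>)" and \<sigma>: "0 < \<sigma>"
  shows "\<P>(\<omega> in M. X \<omega> > x) = gauss_tail (x / \<sigma>)"
proof -
  have D: "distributed M lborel (\<lambda>\<omega>. (X \<omega> - 0) / \<sigma>) std_normal_density"
    using normal_standard_normal_convert[OF \<sigma>, of X 0] X by simp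
  have rv: "(\<lambda>\<omega>. (X \<omega> - 0) / \<sigma>) \<in> measurable M lborel"
    using D by (rule distributed_measurable)
  have "gauss_tail (x / \<sigma>) = measure (distr M lborel (\<lambda>\<omega>. (X \<omega> - 0) / \<sigma>)) {x / \<sigma> <..}"
    unfolding gauss_tail_def using distributed_distr_eq_density[OF D] by simp
  also have "\<dots> = \<P>(\<omega> in M. X \<omega> > x)"
    by (subst measure_distr[OF rv])
        (use \<sigma> in \<open>auto intro!: arg_cong[where f=prob] simp: pos_divide_le_eq
        divide_strict_right_mono divide_less_cancel\<close>)
  finally show ?thesis ..
qed

lemma gauss_tail_minus: "gauss_tail (- x) = 1 - gauss_tail x"
proof -
  interpret N: real_distribution std_normal_distribution by (rule real_dist_normal_dist)
  have D: "distributed std_normal_distribution lborel (\<lambda>x. x) (normal_density 0 1)"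
    unfolding distributed_def
    by (auto intro!: measure_eqI simp: distr_id2[of lborel std_normal_distribution, simplified]
        emeasure_density)
  have D': "distributed std_normal_distribution lborel (\<lambda>x. 0 + -1
      * x) (normal_density (0 + -1 * 0) (\<bar>-1\<bar> * 1))"
    by (rule N.normal_density_affine[OF D]) auto
  have "gauss_tail x = N.prob {y. - y > x}"
    using N.prob_normal_greater[of "\<lambda>x. -x" 1 x] D' by simp
  also have "{y. - y > x} = {..< -x}" by auto
  also have "N.prob {..< -x} = N.prob ({.. -x} - {-x})" by (rule arg_cong[where f=N.prob]) auto
  also have "\<dots> = N.prob {.. -x}" by (subst N.finite_measure_Diff)
      (auto simp: std_normal_measure_singleton)
  also have "\<dots> = 1 - gauss_tail (-x)" by (simp add: gauss_tail_cdf cdf_def)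
  finally show ?thesis by simp
qed

lemma gauss_tail_0: "gauss_tail 0 = 1/2"
  using gauss_tail_minus[of 0] by simp

lemma gauss_tail_nonneg: "gauss_tail x \<ge> 0"
  by (simp add: gauss_tail_def)

lemma gauss_tail_le_1: "gauss_tail x \<le> 1"
  using gauss_tail_minus[of x] gauss_tail_nonneg[of "- x"] by simp

lemma (in prob_space) prob_normal_ge:
  assumes X: "distributed M lborel X (normal_density 0 \<sigma>)" and \<sigma>: "0 < \<sigma>"
  shows "\<P>(\<omega> in M. X \<omega> \<ge> x) \<ge> gauss_tail (x / \<sigma>)"
proof -
  have [measurable]: "X \<in> borel_measurable M" using distributed_measurable[OF X] by simp
  show ?thesis unfolding prob_normal_greater[OF assms, of x, symmetric]
    by (rule finite_measure_mono) auto
qed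

lemma std_normal_density_pos: "std_normal_density x > 0"
  by (rule normal_density_pos) simp

lemma std_normal_density_deriv:
  "(std_normal_density has_real_derivative (- x * std_normal_density x)) (at x)"
  unfolding std_normal_density_def by
      (auto intro!: derivative_eq_intros simp: power2_eq_square field_simps)

lemma gauss_tail_eq_nn_integral:
  "ennreal (gauss_tail x) = (\<integral>\<^sup>+y. ennreal (std_normal_density y) * indicator {x..} y \<partial>lborel)"
proof -
  interpret N: real_distribution std_normal_distribution by (rule real_dist_normal_dist)
  have "ennreal (gauss_tail x) = emeasure std_normal_distribution {x<..}"
    unfolding gauss_tail_def by (simp add: N.emeasure_eq_measure)
  also have "\<dots> = emeasure std_normal_distribution {x..}"
  proof -
    have "{x..} = {x<..} \<union> {x}" by auto
    also have "N.prob \<dots> = N.prob {x<..}"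
      by (subst N.finite_measure_Union) (auto simp: std_normal_measure_singleton)
    finally show ?thesis by (simp add: N.emeasure_eq_measure)
  qed
  also have "\<dots> = (\<integral>\<^sup>+y. ennreal (std_normal_density y) * indicator {x..} y \<partial>lborel)"
    by (subst emeasure_density) auto
  finally show ?thesis .
qed

text \<open>
  Both bounds come from \<open>\<phi> y * (1 + 1 / y\<^sup>2)\<close>, with \<open>\<phi>\<close> the standard normal density: it has the
  antiderivative \<open>- \<phi> y / y\<close>, and for \<open>y \<ge> x\<close> it lies between \<open>\<phi> y\<close> and \<open>(1 + 1 / x\<^sup>2) * \<phi> y\<close>.
\<close>
lemma mills_ratio_bounds:
  assumes x: "x > 0"
  shows "gauss_tail x \<le> std_normal_density x / x"
    and "std_normal_density x / x \<le> (1 + 1 / x\<^sup>2) * gauss_tail x"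
proof -
  let ?f = "\<lambda>y. std_normal_density y * (1 + 1 / y\<^sup>2)"
  have I: "(\<integral>\<^sup>+y. ennreal (?f y) * indicator {x..} y \<partial>lborel)
      = ennreal (0 - (- (std_normal_density x / x)))"
  proof (rule nn_integral_FTC_atLeast)
    show "((\<lambda>y. - (std_normal_density y / y)) \<longlongrightarrow> 0) at_top"
      unfolding std_normal_density_def by real_asymp
    fix y assume "x \<le> y"
    thus "((\<lambda>y. - (std_normal_density y / y)) has_real_derivative ?f y) (at y)"
      using x by (auto intro!: derivative_eq_intros std_normal_density_deriv simp: field_simps
          power2_eq_square)
  qed (auto simp: )
  have "ennreal (gauss_tail x) \<le> ennreal (std_normal_density x / x)"
    unfolding gauss_tail_eq_nn_integral
    by (subst I[simplified, symmetric], intro nn_integral_mono)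
       (auto simp: indicator_def algebra_simps intro!: ennreal_leI)
  thus "gauss_tail x \<le> std_normal_density x / x"
    using x by (subst (asm) ennreal_le_iff) (auto intro!: divide_nonneg_pos)
  have "ennreal (std_normal_density x / x)
      \<le> (\<integral>\<^sup>+y. ennreal (1 + 1/x\<^sup>2) * (ennreal (std_normal_density y) * indicator {x..} y) \<partial>lborel)"
    by (subst I[simplified, symmetric], intro nn_integral_mono)
       (use x in \<open>auto simp: indicator_def ennreal_mult[symmetric] mult.commute simp del:
           ennreal_plus intro!: ennreal_leI mult_left_mono power_mono divide_left_mono\<close>)
  also have "\<dots> = ennreal (1 + 1/x\<^sup>2) * ennreal (gauss_tail x)"
    unfolding gauss_tail_eq_nn_integral by (rule nn_integral_cmult) auto
  also have "\<dots> = ennreal ((1 + 1/x\<^sup>2) * gauss_tail x)"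
    by (rule ennreal_mult[symmetric]) (auto simp: gauss_tail_nonneg)
  finally show "std_normal_density x / x \<le> (1 + 1 / x\<^sup>2) * gauss_tail x"
    by (subst (asm) ennreal_le_iff) (auto simp: gauss_tail_nonneg)
qed

lemma gauss_tail_asymp: "gauss_tail \<sim>[at_top] (\<lambda>x. std_normal_density x / x)"
proof (rule asymp_equivI')
  have *: "eventually (\<lambda>x. gauss_tail x / (std_normal_density x / x) \<le> 1) at_top"
    using eventually_gt_at_top[of 0]
  proof eventually_elim
    case (elim x)
    have "std_normal_density x / x > 0" using elim by
        (auto intro!: divide_pos_pos std_normal_density_pos)
    thus ?case using mills_ratio_bounds(1)[OF elim] by (simp only: divide_le_eq_1_pos)
  qed
  have "eventually (\<lambda>x. gauss_tail x / (std_normal_density x / x) \<ge> 1 / (1 + 1 / x\<^sup>2)) at_top"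
    using eventually_gt_at_top[of 0]
  proof eventually_elim
    case (elim x)
    have "std_normal_density x / x > 0" using elim by
        (auto intro!: divide_pos_pos std_normal_density_pos)
    moreover have "1 + 1 / x\<^sup>2 > 0" using elim by (auto intro!: add_pos_nonneg)
    moreover have "1 / c \<le> g / r" if "r > 0" "c > 0" "r \<le> c * g" for r c g :: real
      using that by (simp add: field_simps)
    ultimately show ?case using mills_ratio_bounds(2)[OF elim] by blast
  qed
  moreover have "((\<lambda>x::real. 1 / (1 + 1 / x\<^sup>2)) \<longlongrightarrow> 1) at_top" by real_asymp
  ultimately show "((\<lambda>x. gauss_tail x / (std_normal_density x / x)) \<longlongrightarrow> 1) at_top"
    using * by (auto intro: tendsto_sandwich)
qed

lemma gauss_tail_pos: "gauss_tail x > 0"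
proof -
  have "gauss_tail (max x 1) > 0"
  proof -
    have "0 < std_normal_density (max x 1) / (max x 1)" by
        (auto intro!: divide_pos_pos std_normal_density_pos)
    also have "\<dots> \<le> (1 + 1 / (max x 1)\<^sup>2) * gauss_tail (max x 1)" by
        (rule mills_ratio_bounds(2)) auto
    finally show ?thesis using gauss_tail_nonneg[of "max x 1"] by
        (cases "gauss_tail (max x 1) = 0") auto
  qed
  thus ?thesis using gauss_tail_antimono[of x "max x 1"] by simp
qed

lemma gauss_tail_affine_asymp:
  assumes "v > 0"
  shows "(\<lambda>u. gauss_tail ((u + a) / sqrt v)) \<sim>[at_top]
    (\<lambda>u. sqrt (v / (2 * pi)) * inverse u * exp (- ((u + a)\<^sup>2 / (2 * v))))"
proof -
  have lim: "filterlim (\<lambda>u. (u + a) / sqrt v) at_top at_top" using assms by real_asymp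
  have "(\<lambda>u. gauss_tail ((u + a) / sqrt v)) \<sim>[at_top]
     (\<lambda>u. std_normal_density ((u + a) / sqrt v) / ((u + a) / sqrt v))"
    by (rule asymp_equiv_compose'[OF gauss_tail_asymp lim])
  also have "(\<lambda>u. std_normal_density ((u + a) / sqrt v) / ((u + a) / sqrt v)) =
     (\<lambda>u. sqrt (v / (2 * pi)) * exp (- ((u + a)\<^sup>2 / (2 * v))) * inverse (u + a))"
    using assms by (auto simp: fun_eq_iff std_normal_density_def power_divide real_sqrt_divide
        field_simps real_sqrt_mult)
  also have "\<dots> \<sim>[at_top] (\<lambda>u. sqrt (v / (2 * pi)) * exp (- ((u + a)\<^sup>2 / (2 * v))) * inverse u)"
    by (intro asymp_equiv_intros) real_asymp
  finally show ?thesis by (simp add: mult_ac)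
qed

text \<open>
  Reducing the variance changes the exponential order, whatever the shift of the level: the
  quotient behaves like \<open>exp (- \<delta> * u\<^sup>2)\<close> with \<open>\<delta> = 1 / (2 * w) - 1 / (2 * v) > 0\<close>, up to lower
  order terms in the exponent.
\<close>
lemma gauss_tail_negligible:
  assumes "0 < w" "w < v"
  shows "((\<lambda>u. gauss_tail ((u + b) / sqrt w) / gauss_tail ((u + a) / sqrt v)) \<longlongrightarrow> 0) at_top"
proof -
  let ?g = "\<lambda>w b u::real. sqrt (w / (2 * pi)) * inverse u * exp (- ((u + b)\<^sup>2 / (2 * w)))"
  have "(\<lambda>u. gauss_tail ((u + b) / sqrt w) / gauss_tail ((u + a) / sqrt v)) \<sim>[at_top]
     (\<lambda>u. ?g w b u / ?g v a u)"
    by (intro asymp_equiv_intros gauss_tail_affine_asymp) (use assms in auto)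
  moreover have "((\<lambda>u. ?g w b u / ?g v a u) \<longlongrightarrow> 0) at_top"
  proof -
    have "((\<lambda>u. sqrt (w / (2 * pi)) / sqrt (v / (2 * pi))
        * exp (- ((u + b)\<^sup>2 / (2 * w)) + ((u + a)\<^sup>2 / (2 * v)))) \<longlongrightarrow> sqrt (w / (2 * pi))
        / sqrt (v / (2 * pi)) * 0) at_top"
    proof (intro tendsto_mult tendsto_const)
      define d where "d = 1 / (2 * w) - 1 / (2 * v)"
      have d: "d > 0" using assms by (simp add: d_def field_simps)
      have "filterlim (\<lambda>u. - d * u\<^sup>2 + (a / v - b / w) * u
          + (a\<^sup>2 / (2 * v) - b\<^sup>2 / (2 * w))) at_bot at_top"
        using d by real_asymp
      also have "(\<lambda>u. - d * u\<^sup>2 + (a / v - b / w) * u + (a\<^sup>2 / (2 * v) - b\<^sup>2 / (2 * w))) =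
          (\<lambda>u. - ((u + b)\<^sup>2 / (2 * w)) + ((u + a)\<^sup>2 / (2 * v)))"
        using assms by (auto simp: fun_eq_iff d_def power2_eq_square field_simps)
      finally show "((\<lambda>u. exp (- ((u + b)\<^sup>2 / (2 * w)) + ((u + a)\<^sup>2 / (2 * v)))) \<longlongrightarrow> 0) at_top"
        by (rule filterlim_compose[OF exp_at_bot])
    qed
    moreover have "eventually (\<lambda>u. sqrt (w / (2 * pi)) / sqrt (v / (2 * pi))
        * exp (- ((u + b)\<^sup>2 / (2 * w)) + ((u + a)\<^sup>2 / (2 * v))) = ?g w b u / ?g v a u) at_top"
      using eventually_gt_at_top[of 0] by eventually_elim
          (auto simp: exp_add exp_minus exp_diff field_simps)
    ultimately show ?thesis by (simp add: tendsto_cong)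
  qed
  ultimately show ?thesis using tendsto_asymp_equiv_cong by blast
qed

section \<open>First passage of a random walk over a level\<close>

context prob_space begin

text \<open>
  The event of first passage at step \<open>k\<close> is determined by the steps before \<open>k\<close>, hence independent
  of all that the walk does afterwards. The set \<open>K\<close> holds the times at which the walk is
  inspected.
\<close>
lemma prob_first_passage_split:
  fixes X :: "nat \<Rightarrow> 'a \<Rightarrow> real"
  assumes ind: "indep_vars (\<lambda>_. borel) X {..<n}" and k: "k \<le> n" and C: "C \<in> sets borel"
  shows "prob ({\<omega>\<in>space M. (\<Sum>i<k. X i \<omega>) > u \<and> (\<forall>j\<in>K. j < k \<longrightarrow> (\<Sum>i<j. X i \<omega>) \<le> u)} \<inter>
               {\<omega>\<in>space M. (\<Sum>i=k..<n. X i \<omega>) \<in> C}) =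
         prob {\<omega>\<in>space M. (\<Sum>i<k. X i \<omega>) > u \<and> (\<forall>j\<in>K. j < k \<longrightarrow> (\<Sum>i<j. X i \<omega>) \<le> u)} *
         prob {\<omega>\<in>space M. (\<Sum>i=k..<n. X i \<omega>) \<in> C}"
    (is "prob (?A \<inter> ?D) = _")
proof -
  let ?P = "Pi\<^sub>M {..<k} (\<lambda>_. borel :: real measure)" and ?Q =
      "Pi\<^sub>M {k..<n} (\<lambda>_. borel :: real measure)"
  have iv: "indep_var ?P (\<lambda>\<omega>. \<lambda>i\<in>{..<k}. X i \<omega>) ?Q (\<lambda>\<omega>. \<lambda>i\<in>{k..<n}. X i \<omega>)"
    by (rule indep_var_restrict[OF ind]) (use k in auto)
  define B where "B = {x\<in>space ?P. (\<Sum>i<k. x i) > u \<and> (\<forall>j\<in>K \<inter> {..<k}. (\<Sum>i<j. x i) \<le> u)}"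
  define D where "D = {x\<in>space ?Q. (\<Sum>i=k..<n. x i) \<in> C}"
  have [measurable]: "(\<lambda>x. \<Sum>i<j. x i) \<in> borel_measurable ?P" if "j \<le> k" for j
    using that by (intro borel_measurable_sum measurable_component_singleton) auto
  have B: "B \<in> sets ?P"
    unfolding B_def by (intro sets.sets_Collect_conj sets.sets_Collect_finite_All
        borel_measurable_less borel_measurable_le) auto
  have [measurable]: "C \<in> sets borel" by (rule C)
  have D: "D \<in> sets ?Q"
    unfolding D_def by measurable
  have s: "(\<lambda>i\<in>{..<k}. X i \<omega>) \<in> space ?P" "(\<lambda>i\<in>{k..<n}. X i \<omega>) \<in> space ?Q" for \<omega>
    by (auto simp: space_PiM)
  have sm: "(\<Sum>i<j. (\<lambda>i\<in>{..<k}. X i \<omega>) i) = (\<Sum>i<j. X i \<omega>)" if "j \<le> k" for j \<omega>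
    using that by (intro sum.cong) auto
  have sm2: "(\<Sum>i=k..<n. (\<lambda>i\<in>{k..<n}. X i \<omega>) i) = (\<Sum>i=k..<n. X i \<omega>)" for \<omega>
    by (intro sum.cong) auto
  have memB: "(\<lambda>i\<in>{..<k}. X i \<omega>) \<in> B \<longleftrightarrow> (\<Sum>i<k. X i \<omega>) > u \<and> (\<forall>j\<in>K. j < k \<longrightarrow> (\<Sum>i<j. X i \<omega>) \<le> u)" for \<omega>
    unfolding B_def using s(1)[of \<omega>] by (auto simp: sm simp del: restrict_apply)
  have memD: "(\<lambda>i\<in>{k..<n}. X i \<omega>) \<in> D \<longleftrightarrow> (\<Sum>i=k..<n. X i \<omega>) \<in> C" for \<omega>
    unfolding D_def using s(2)[of \<omega>] by (auto simp: sm2 simp del: restrict_apply)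
  have eqA: "(\<lambda>\<omega>. \<lambda>i\<in>{..<k}. X i \<omega>) -` B \<inter> space M = ?A" using memB by auto
  have eqD: "(\<lambda>\<omega>. \<lambda>i\<in>{k..<n}. X i \<omega>) -` D \<inter> space M = ?D" using memD by auto
  have "prob ((\<lambda>\<omega>. (\<lambda>i\<in>{..<k}. X i \<omega>, \<lambda>i\<in>{k..<n}. X i \<omega>)) -` (B \<times> D) \<inter> space M) = prob ?A * prob ?D"
    using indep_varD[OF iv B D] unfolding eqA eqD .
  also have "(\<lambda>\<omega>. (\<lambda>i\<in>{..<k}. X i \<omega>, \<lambda>i\<in>{k..<n}. X i \<omega>)) -` (B \<times> D) \<inter> space M = ?A \<inter> ?D"
    using memB memD by auto
  finally show ?thesis .
qed

lemma prob_sum_first_passage: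
  fixes X :: "nat \<Rightarrow> 'a \<Rightarrow> real"
  assumes rv: "\<And>i. i < n \<Longrightarrow> X i \<in> borel_measurable M" and K: "K \<subseteq> {..n}"
  shows "prob {\<omega>\<in>space M. \<exists>k\<in>K. (\<Sum>i<k. X i \<omega>) > u} =
     (\<Sum>k\<in>K. prob {\<omega>\<in>space M. (\<Sum>i<k. X i \<omega>) > u \<and> (\<forall>j\<in>K. j < k \<longrightarrow> (\<Sum>i<j. X i \<omega>) \<le> u)})"
    (is "prob ?U = (\<Sum>k\<in>K. prob (?A k))")
proof -
  have fin: "finite K" using K finite_subset by blast
  have [measurable]: "(\<lambda>\<omega>. \<Sum>i<j. X i \<omega>) \<in> borel_measurable M" if "j \<in> K" for j
    using that K rv by (intro borel_measurable_sum) force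
  have "?U = (\<Union>k\<in>K. ?A k)"
  proof safe
    fix \<omega> k assume *: "\<omega> \<in> space M" "k \<in> K" "(\<Sum>i<k. X i \<omega>) > u"
    define l where "l = (LEAST l. l \<in> K \<and> (\<Sum>i<l. X i \<omega>) > u)"
    have "l \<in> K \<and> (\<Sum>i<l. X i \<omega>) > u" unfolding l_def by (rule LeastI[of _ k]) (use * in auto)
    moreover have "(\<Sum>i<j. X i \<omega>) \<le> u" if "j \<in> K" "j < l" for j
      using not_less_Least[of j "\<lambda>l. l \<in> K \<and> (\<Sum>i<l. X i \<omega>) > u"] that unfolding l_def by auto
    ultimately show "\<omega> \<in> (\<Union>k\<in>K. ?A k)" using * by auto
  qed auto
  also have "prob \<dots> = (\<Sum>k\<in>K. prob (?A k))"
  proof (rule finite_measure_finite_Union[OF fin])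
    show "?A ` K \<subseteq> events" using fin
      by (auto intro!: sets.sets_Collect_conj sets.sets_Collect_finite_All borel_measurable_less
          borel_measurable_le)
    show "disjoint_family_on ?A K"
      unfolding disjoint_family_on_def
    proof (intro ballI impI)
      fix k l assume "k \<in> K" "l \<in> K" "k \<noteq> l"
      thus "?A k \<inter> ?A l = {}" by (cases "k < l") force+
    qed
  qed
  finally show ?thesis .
qed

text \<open>
  Ottaviani's inequality: if the walk, wherever its first passage occurs, afterwards does not fall
  back with probability at least \<open>a\<close>, then it ends above the level with at least \<open>a\<close> times the
  probability of reaching the level. The overshoot at the passage only helps.
\<close>
lemma prob_exists_partial_sum_greater_le:
  fixes X :: "nat \<Rightarrow> 'a \<Rightarrow> real"
  assumes ind: "indep_vars (\<lambda>_. borel) X {..<n}" and K: "K \<subseteq> {..n}"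
    and a: "\<And>k. k \<in> K \<Longrightarrow> a \<le> \<P>(\<omega> in M. (\<Sum>i=k..<n. X i \<omega>) \<ge> 0)"
  shows "a * \<P>(\<omega> in M. \<exists>k\<in>K. (\<Sum>i<k. X i \<omega>) > u) \<le> \<P>(\<omega> in M. (\<Sum>i<n. X i \<omega>) > u)"
proof -
  let ?A = "\<lambda>k. {\<omega>\<in>space M. (\<Sum>i<k. X i \<omega>) > u \<and> (\<forall>j\<in>K. j < k \<longrightarrow> (\<Sum>i<j. X i \<omega>) \<le> u)}"
  let ?D = "\<lambda>k. {\<omega>\<in>space M. (\<Sum>i=k..<n. X i \<omega>) \<in> {0..}}"
  have rv: "X i \<in> borel_measurable M" if "i < n" for i using ind that by (auto simp: indep_vars_def)
  have fin: "finite K" using K finite_subset by blast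
  have [measurable]: "(\<lambda>\<omega>. \<Sum>i<n. X i \<omega>) \<in> borel_measurable M"
    using rv by (intro borel_measurable_sum) force
  have [measurable]: "(\<lambda>\<omega>. \<Sum>i<j. X i \<omega>) \<in> borel_measurable M" if "j \<in> K" for j
    using that K rv by (intro borel_measurable_sum) force
  have [measurable]: "(\<lambda>\<omega>. \<Sum>i=j..<n. X i \<omega>) \<in> borel_measurable M" if "j \<in> K" for j
    using that K rv by (intro borel_measurable_sum) force
  have Am: "?A k \<in> events" if "k \<in> K" for k using fin that
      by (auto intro!: sets.sets_Collect_conj sets.sets_Collect_finite_All borel_measurable_less
          borel_measurable_le)
  have Dm: "?D k \<in> events" if "k \<in> K" for k
    using that by measurable
  have "a * \<P>(\<omega> in M. \<exists>k\<in>K. (\<Sum>i<k. X i \<omega>) > u) = (\<Sum>k\<in>K. prob (?A k) * a)"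
    by (subst prob_sum_first_passage[where X=X and n=n, OF rv K])
        (auto simp: sum_distrib_left mult.commute)
  also have "\<dots> \<le> (\<Sum>k\<in>K. prob (?A k) * prob (?D k))"
    using a by (intro sum_mono mult_left_mono) auto
  also have "\<dots> = (\<Sum>k\<in>K. prob (?A k \<inter> ?D k))"
    using K by (intro sum.cong refl prob_first_passage_split[OF ind, symmetric]) auto
  also have "\<dots> = prob (\<Union>k\<in>K. ?A k \<inter> ?D k)"
  proof (rule finite_measure_finite_Union[OF fin, symmetric])
    show "(\<lambda>k. ?A k \<inter> ?D k) ` K \<subseteq> events" using Am Dm by blast
    show "disjoint_family_on (\<lambda>k. ?A k \<inter> ?D k) K"
      unfolding disjoint_family_on_def
    proof (intro ballI impI)
      fix k l assume "k \<in> K" "l \<in> K" "k \<noteq> l"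
      thus "?A k \<inter> ?D k \<inter> (?A l \<inter> ?D l) = {}" by (cases "k < l") force+
    qed
  qed
  also have "\<dots> \<le> prob {\<omega>\<in>space M. (\<Sum>i<n. X i \<omega>) > u}"
  proof (rule finite_measure_mono)
    show "(\<Union>k\<in>K. ?A k \<inter> ?D k) \<subseteq> {\<omega>\<in>space M. (\<Sum>i<n. X i \<omega>) > u}"
    proof
      fix \<omega> assume "\<omega> \<in> (\<Union>k\<in>K. ?A k \<inter> ?D k)"
      then obtain k where "\<omega> \<in> space M" "k \<in> K" "(\<Sum>i<k. X i \<omega>) > u" "(\<Sum>i=k..<n. X i \<omega>) \<ge> 0"
        by auto
      moreover have "(\<Sum>i<n. X i \<omega>) = (\<Sum>i<k. X i \<omega>) + (\<Sum>i=k..<n. X i \<omega>)"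
        using K \<open>k \<in> K\<close> sum.atLeastLessThan_concat[of 0 k n "\<lambda>i. X i \<omega>"] by
            (auto simp: atLeast0LessThan)
      ultimately show "\<omega> \<in> {\<omega>\<in>space M. (\<Sum>i<n. X i \<omega>) > u}" by auto
    qed
  qed measurable
  finally show ?thesis .
qed

text \<open>
  The reverse estimate, for which the overshoot matters. Excluding steps larger than \<open>e\<close> keeps the
  walk at or below \<open>u + e\<close> at its first passage, so that it must still rise afterwards in order to
  end above \<open>u + e\<close>. The first step is treated apart, since it will be the long one from time \<open>0\<close>
  to the beginning of a short final interval.
\<close>
lemma prob_sum_greater_no_jump_le:
  fixes X :: "nat \<Rightarrow> 'a \<Rightarrow> real"
  assumes ind: "indep_vars (\<lambda>_. borel) X {..<n}"
    and b: "\<And>k. 2 \<le> k \<Longrightarrow> k < n \<Longrightarrow> \<P>(\<omega> in M. (\<Sum>i=k..<n. X i \<omega>) > 0) \<le> b" and b0: "b \<ge> 0"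
    and n: "n \<ge> 1" and e: "e > 0"
  shows "\<P>(\<omega> in M. (\<Sum>i<n. X i \<omega>) > u + e \<and> X 0 \<omega> \<le> u \<and> (\<forall>i\<in>{1..<n}. X i \<omega> \<le> e))
         \<le> b * \<P>(\<omega> in M. \<exists>k\<in>{1..n}. (\<Sum>i<k. X i \<omega>) > u)"
proof -
  let ?K = "{1..n}"
  let ?A = "\<lambda>k. {\<omega>\<in>space M. (\<Sum>i<k. X i \<omega>) > u \<and> (\<forall>j\<in>?K. j < k \<longrightarrow> (\<Sum>i<j. X i \<omega>) \<le> u)}"
  let ?D = "\<lambda>k. {\<omega>\<in>space M. (\<Sum>i=k..<n. X i \<omega>) \<in> {0<..}}"
  let ?L = "{2..<n}"
  have rv: "X i \<in> borel_measurable M" if "i < n" for i using ind that by (auto simp: indep_vars_def)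
  have [measurable]: "(\<lambda>\<omega>. \<Sum>i<j. X i \<omega>) \<in> borel_measurable M" if "j \<le> n" for j
    using that rv by (intro borel_measurable_sum) force
  have [measurable]: "(\<lambda>\<omega>. \<Sum>i=j..<n. X i \<omega>) \<in> borel_measurable M" if "j \<le> n" for j
    using that rv by (intro borel_measurable_sum) force
  have Am: "?A k \<in> events" if "k \<in> ?K" for k using that
      by (auto intro!: sets.sets_Collect_conj sets.sets_Collect_finite_All borel_measurable_less
          borel_measurable_le)
  have Dm: "?D k \<in> events" if "k \<in> ?K" for k
  proof -
    have "k \<le> n" using that by auto
    thus ?thesis by measurable
  qed
  have "\<P>(\<omega> in M. (\<Sum>i<n. X i \<omega>) > u + e \<and> X 0 \<omega> \<le> u \<and> (\<forall>i\<in>{1..<n}. X i \<omega> \<le> e))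
      \<le> prob (\<Union>k\<in>?L. ?A k \<inter> ?D k)"
  proof (rule finite_measure_mono)
    show "{\<omega>\<in>space M. (\<Sum>i<n. X i \<omega>) > u + e \<and> X 0 \<omega> \<le> u \<and> (\<forall>i\<in>{1..<n}. X i \<omega> \<le> e)}
        \<subseteq> (\<Union>k\<in>?L. ?A k \<inter> ?D k)"
    proof safe
      fix \<omega> assume *: "\<omega> \<in> space M" "(\<Sum>i<n. X i \<omega>) > u + e" "X 0 \<omega> \<le> u" "\<forall>i\<in>{1..<n}. X i \<omega> \<le> e"
      define k where "k = (LEAST l. 1 \<le> l \<and> (\<Sum>i<l. X i \<omega>) > u)"
      have k: "1 \<le> k \<and> (\<Sum>i<k. X i \<omega>) > u" unfolding k_def by (rule LeastI[of _ n])
          (use * n e in auto)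
      have kle: "k \<le> n" unfolding k_def by (rule Least_le) (use * n e in auto)
      have less: "(\<Sum>i<j. X i \<omega>) \<le> u" if "1 \<le> j" "j < k" for j
        using not_less_Least[of j "\<lambda>l. 1 \<le> l \<and> (\<Sum>i<l. X i \<omega>) > u"] that unfolding k_def by auto
      have k1: "k \<noteq> 1" using k * by auto
      have "(\<Sum>i<k. X i \<omega>) = (\<Sum>i<k-1. X i \<omega>) + X (k-1) \<omega>"
        using k by (cases k) auto
      moreover have "(\<Sum>i<k-1. X i \<omega>) \<le> u" using k k1 by (intro less) auto
      moreover have "k - 1 \<in> {1..<n}" using k k1 kle by auto
      hence "X (k-1) \<omega> \<le> e" using *(4) by blast
      ultimately have le: "(\<Sum>i<k. X i \<omega>) \<le> u + e" by simp
      moreover have "(\<Sum>i<n. X i \<omega>) = (\<Sum>i<k. X i \<omega>) + (\<Sum>i=k..<n. X i \<omega>)"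
        using kle sum.atLeastLessThan_concat[of 0 k n "\<lambda>i. X i \<omega>"] by (auto simp: atLeast0LessThan)
      ultimately have "(\<Sum>i=k..<n. X i \<omega>) > 0" using * by simp
      moreover have "k \<noteq> n" using le * by auto
      ultimately show "\<omega> \<in> (\<Union>k\<in>?L. ?A k \<inter> ?D k)" using * k kle k1 less by auto
    qed
    have "?A k \<inter> ?D k \<in> events" if "k \<in> ?L" for k using that Am Dm by auto
    thus "(\<Union>k\<in>?L. ?A k \<inter> ?D k) \<in> events" by blast
  qed
  also have "\<dots> \<le> (\<Sum>k\<in>?L. prob (?A k \<inter> ?D k))"
    by (rule finite_measure_subadditive_finite) (use Am Dm in auto)
  also have "\<dots> = (\<Sum>k\<in>?L. prob (?A k) * prob (?D k))"
    by (intro sum.cong refl prob_first_passage_split[OF ind]) auto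
  also have "\<dots> \<le> (\<Sum>k\<in>?L. prob (?A k) * b)"
    using b by (intro sum_mono mult_left_mono) auto
  also have "\<dots> \<le> (\<Sum>k\<in>?K. prob (?A k) * b)"
    by (rule sum_mono2) (use b0 in auto)
  also have "\<dots> = b * \<P>(\<omega> in M. \<exists>k\<in>?K. (\<Sum>i<k. X i \<omega>) > u)"
    by (subst prob_sum_first_passage[where X=X and n=n, OF rv])
        (auto simp: sum_distrib_left mult.commute)
  finally show ?thesis .
qed

end

text \<open>
  Fatou's lemma for events, the form in which bounds along grids pass to continuous time.
\<close>
lemma (in finite_measure) measure_le_of_AE_eventually:
  assumes A: "A \<in> sets M" and F: "\<And>m. F m \<in> sets M"
    and ev: "AE \<omega> in M. \<omega> \<in> A \<longrightarrow> eventually (\<lambda>m. \<omega> \<in> F m) sequentially"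
    and C: "eventually (\<lambda>m. measure M (F m) \<le> C) sequentially"
  shows "measure M A \<le> C"
proof -
  let ?G = "\<lambda>n. \<Inter>m\<in>{n..}. F m"
  have G: "?G n \<in> sets M" for n using F by (intro sets.countable_INT') auto
  have "incseq ?G" by (auto simp: incseq_def)
  have "measure M A \<le> measure M (\<Union>n. ?G n)"
    by (rule finite_measure_mono_AE)
        (use ev G in \<open>auto simp: eventually_sequentially Bex_def atLeast_def\<close>)
  also have "\<dots> \<le> C"
  proof (rule LIMSEQ_le_const2)
    show "(\<lambda>n. measure M (?G n)) \<longlonglongrightarrow> measure M (\<Union>n. ?G n)"
      by (rule finite_Lim_measure_incseq) (use G \<open>incseq ?G\<close> in auto)
    obtain N where N: "\<And>n. n \<ge> N \<Longrightarrow> measure M (F n) \<le> C"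
      using C unfolding eventually_sequentially by auto
    show "\<exists>N. \<forall>n\<ge>N. measure M (?G n) \<le> C"
      by (rule exI[of _ N]) (auto intro!: order_trans[OF finite_measure_mono N] F)
  qed
  finally show ?thesis .
qed

section \<open>Dyadic grids\<close>

lemma dyadic_point_exceeds:
  fixes f :: "real \<Rightarrow> real"
  assumes cont: "continuous_on {A..B} f" and t: "t \<in> {A..B}" "f t > u" and AB: "A < B"
  shows "\<exists>j. \<exists>i\<le>2 ^ j. f (A + (B - A) * (real i / 2 ^ j)) > u"
proof -
  obtain d where d: "d > 0" "\<And>s. s \<in> {A..B} \<Longrightarrow> dist s t < d \<Longrightarrow> dist (f s) (f t) < f t - u"
    using cont t unfolding continuous_on_iff by (metis diff_gt_0_iff_gt)
  obtain j where j: "(B - A) / 2 ^ j < d"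
  proof -
    have "(\<lambda>j. (B - A) / 2 ^ j) \<longlonglongrightarrow> 0" by real_asymp
    hence "eventually (\<lambda>j. (B - A) / 2 ^ j < d) sequentially" using d(1) by (rule order_tendstoD)
    thus ?thesis using that by (metis eventually_sequentially order_refl)
  qed
  define x where "x = (t - A) / (B - A)"
  have x: "0 \<le> x" "x \<le> 1" using t AB by (auto simp: x_def)
  have tx: "t = A + (B - A) * x" using AB by (simp add: x_def)
  define i where "i = nat \<lfloor>2 ^ j * x\<rfloor>"
  have i: "real i \<le> 2 ^ j * x" "2 ^ j * x < real i + 1"
    using x by (auto simp: i_def)
  have "2 ^ j * x \<le> 2 ^ j" using x by (simp add: mult_left_le)
  with i(1) have "real i \<le> 2 ^ j" by (rule order_trans)
  hence ile: "i \<le> 2 ^ j" by (metis of_nat_le_iff of_nat_numeral of_nat_power)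
  let ?s = "A + (B - A) * (real i / 2 ^ j)"
  have s: "?s \<in> {A..B}"
    using AB \<open>real i \<le> 2 ^ j\<close> mult_left_mono[of "real i / 2 ^ j" 1 "B - A"] by auto
  have "?s - t = (B - A) * (real i / 2 ^ j - x)" by (simp add: tx right_diff_distrib)
  hence "\<bar>?s - t\<bar> = (B - A) * \<bar>real i / 2 ^ j - x\<bar>" using AB by (simp add: abs_mult)
  also have "\<bar>real i / 2 ^ j - x\<bar> \<le> 1 / 2 ^ j"
  proof -
    have "real i / 2 ^ j \<le> x" "x \<le> (real i + 1) / 2 ^ j"
      using i by (simp_all add: pos_divide_le_eq pos_le_divide_eq mult.commute)
    thus ?thesis by (simp add: add_divide_distrib)
  qed
  finally have "\<bar>?s - t\<bar> \<le> (B - A) / 2 ^ j" using AB by (simp add: mult_left_mono)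
  hence "dist (f ?s) (f t) < f t - u" using d(2)[OF s] j by (auto simp: dist_real_def)
  hence "f ?s > u" by (auto simp: dist_real_def)
  thus ?thesis using ile by blast
qed

text \<open>
  The times are \<open>0\<close> followed by the \<open>2 ^ m + 1\<close> equally spaced points of \<open>[A, B]\<close>. The leading \<open>0\<close>
  makes the walk sampled along the grid start at \<open>0\<close>, also when only crossings during \<open>[A, B]\<close> are
  of interest.
\<close>
definition grid :: "real \<Rightarrow> real \<Rightarrow> nat \<Rightarrow> nat \<Rightarrow> real" where
  "grid A B m k = (if k = 0 then 0 else A + (B - A) * (real (k - 1) / 2 ^ m))"

lemma grid_0 [simp]: "grid A B m 0 = 0" by (simp add: grid_def)
lemma grid_1 [simp]: "grid A B m (Suc 0) = A" by (simp add: grid_def)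
lemma grid_last [simp]: "grid A B m (Suc (2 ^ m)) = B" by (simp add: grid_def)

lemma grid_mono:
  assumes "0 \<le> A" "A \<le> B" "i \<le> k" shows "grid A B m i \<le> grid A B m k"
proof -
  have "real (i - 1) / 2 ^ m \<le> real (k - 1) / 2 ^ m" using assms by (intro divide_right_mono) auto
  hence "(B - A) * (real (i - 1) / 2 ^ m) \<le> (B - A) * (real (k - 1) / 2 ^ m)"
    using assms by (intro mult_left_mono) auto
  thus ?thesis using assms by (auto simp: grid_def)
qed

lemma grid_ge: "0 \<le> A \<Longrightarrow> A \<le> B \<Longrightarrow> 1 \<le> k \<Longrightarrow> A \<le> grid A B m k"
  using grid_mono[of A B "Suc 0" k m] by simp

lemma grid_nonneg: "0 \<le> A \<Longrightarrow> A \<le> B \<Longrightarrow> 0 \<le> grid A B m k"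
  using grid_mono[of A B 0 k m] by simp

lemma grid_le: "0 \<le> A \<Longrightarrow> A \<le> B \<Longrightarrow> k \<le> Suc (2 ^ m) \<Longrightarrow> grid A B m k \<le> B"
  using grid_mono[of A B k "Suc (2 ^ m)" m] by simp

lemma grid_less:
  assumes "0 \<le> A" "A < B" "k \<le> 2 ^ m" shows "grid A B m k < B"
proof (cases "k = 0")
  case False
  have "real (k - 1) / 2 ^ m < 1"
  proof -
    have "k - 1 < 2 ^ m" using assms False by linarith
    hence "real (k - 1) < real (2 ^ m)" by (simp only: of_nat_less_iff)
    thus ?thesis by simp
  qed
  hence "(B - A) * (real (k - 1) / 2 ^ m) < (B - A) * 1"
    using assms by (intro mult_strict_left_mono) auto
  thus ?thesis using False by (simp add: grid_def)
qed (use assms in auto)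

text \<open>
  The witness \<open>s\<close> is one fixed dyadic point that belongs to all sufficiently fine grids. A point
  depending on \<open>m\<close> would not suffice later, where the path itself is replaced by approximations
  that converge only pointwise in time.
\<close>
lemma eventually_grid_point_exceeds:
  fixes f :: "real \<Rightarrow> real"
  assumes cont: "continuous_on {A..B} f" and t: "t \<in> {A..B}" "f t > u" and AB: "A < B"
  shows "\<exists>s\<in>{A..B}. f s > u \<and> eventually (\<lambda>m. \<exists>k\<in>{1..Suc (2 ^ m)}. grid A B m k = s) sequentially"
proof -
  obtain j i where ij: "i \<le> 2 ^ j" "f (A + (B - A) * (real i / 2 ^ j)) > u"
    using dyadic_point_exceeds[OF assms] by blast
  have "eventually (\<lambda>m. \<exists>k\<in>{1..Suc (2 ^ m)}. grid A B m k = A + (B - A)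
      * (real i / 2 ^ j)) sequentially"
    using eventually_ge_at_top[of j]
  proof eventually_elim
    case (elim m)
    have p: "(2::nat) ^ m = 2 ^ j * 2 ^ (m - j)" using elim by (simp flip: power_add)
    hence pr: "(2::real) ^ m = 2 ^ j * 2 ^ (m - j)" using elim by (simp flip: power_add)
    show ?case
      by (rule bexI[of _ "Suc (i * 2 ^ (m - j))"])
         (use ij p in \<open>auto simp: grid_def pr intro!: mult_right_mono\<close>)
  qed
  moreover have "A + (B - A) * (real i / 2 ^ j) \<in> {A..B}"
  proof -
    have "real i / 2 ^ j \<le> 1" using ij(1) by (simp add: of_nat_le_iff flip: of_nat_power)
    thus ?thesis using AB mult_left_mono[of "real i / 2 ^ j" 1 "B - A"] by auto
  qed
  ultimately show ?thesis using ij(2) by blast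
qed

context prob_space begin

text \<open>
  Ottaviani's inequality for a process with independent increments along the grid, after
  subtraction of the linear drift.
\<close>
lemma prob_grid_exceeds_le:
  fixes Z :: "real \<Rightarrow> 'a \<Rightarrow> real" and t :: "nat \<Rightarrow> real"
  assumes ind: "indep_vars (\<lambda>_. borel) (\<lambda>i \<omega>. Z (t (Suc i)) \<omega> - Z (t i) \<omega>) {..<n}"
    and rv: "\<And>i. i \<le> n \<Longrightarrow> Z (t i) \<in> borel_measurable M"
    and t0: "t 0 = 0" and Z0: "AE \<omega> in M. Z 0 \<omega> = 0"
    and K: "K \<subseteq> {..n}"
    and a: "\<And>k. k \<in> K \<Longrightarrow> a \<le> \<P>(\<omega> in M. Z (t n) \<omega> - Z (t k) \<omega> \<ge> c * (t n - t k))"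
  shows "a * \<P>(\<omega> in M. \<exists>k\<in>K. Z (t k) \<omega> - c * t k > u) \<le> \<P>(\<omega> in M. Z (t n) \<omega> - c * t n > u)"
proof -
  define X where "X i \<omega> = (Z (t (Suc i)) \<omega> - Z (t i) \<omega>) - c * (t (Suc i) - t i)" for i \<omega>
  have indX: "indep_vars (\<lambda>_. borel) X {..<n}"
    unfolding X_def by (rule indep_vars_compose2[OF ind, where Y="\<lambda>i x. x - c
        * (t (Suc i) - t i)"]) auto
  have [measurable]: "Z (t i) \<in> borel_measurable M" if "i \<le> n" for i using rv that .
  have fin: "finite K" using K finite_subset by blast
  have S: "(\<Sum>i=k..<l. X i \<omega>) = (Z (t l) \<omega> - Z (t k) \<omega>) - c * (t l - t k)" if "k \<le> l" for k l \<omega>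
    using sum_Suc_diff'[OF that, of "\<lambda>i. Z (t i) \<omega> - c * t i"] by (simp add: X_def algebra_simps)
  have S0: "(\<Sum>i<l. X i \<omega>) = (Z (t l) \<omega> - Z 0 \<omega>) - c * t l" for l \<omega>
    using S[of 0 l \<omega>] by (simp add: atLeast0LessThan t0)
  have [measurable]: "Z 0 \<in> borel_measurable M" using rv[of 0] by (simp add: t0)
  have m[measurable]: "Z (t k) \<in> borel_measurable M" if "k \<in> K" for k using K that by
      (intro rv) auto
  have "a * \<P>(\<omega> in M. \<exists>k\<in>K. (\<Sum>i<k. X i \<omega>) > u) \<le> \<P>(\<omega> in M. (\<Sum>i<n. X i \<omega>) > u)"
  proof (rule prob_exists_partial_sum_greater_le[OF indX K])
    fix k assume "k \<in> K"
    moreover hence "k \<le> n" using K by auto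
    ultimately show "a \<le> \<P>(\<omega> in M. (\<Sum>i=k..<n. X i \<omega>) \<ge> 0)" using a[of k] by (simp add: S)
  qed
  also have "\<P>(\<omega> in M. \<exists>k\<in>K. (\<Sum>i<k. X i \<omega>) > u) = \<P>(\<omega> in M. \<exists>k\<in>K. Z (t k) \<omega> - c * t k > u)"
    unfolding S0 using Z0 fin by (intro measure_eq_AE) (auto intro!: sets.sets_Collect_finite_Ex)
  also have "\<P>(\<omega> in M. (\<Sum>i<n. X i \<omega>) > u) = \<P>(\<omega> in M. Z (t n) \<omega> - c * t n > u)"
    unfolding S0 using Z0 by (intro measure_eq_AE) auto
  finally show ?thesis .
qed

end

section \<open>Brownian motion crossing a line\<close>

lemma sbm_prob_space: "standard_brownian_motion M X \<Longrightarrow> prob_space M"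
  by (simp add: standard_brownian_motion_def)

lemma sbm_measurable: "standard_brownian_motion M X \<Longrightarrow> 0 \<le> t \<Longrightarrow> X t \<in> borel_measurable M"
  by (simp add: standard_brownian_motion_def)

lemma sbm_start: "standard_brownian_motion M X \<Longrightarrow> AE \<omega> in M. X 0 \<omega> = 0"
  by (simp add: standard_brownian_motion_def)

lemma sbm_normal: "standard_brownian_motion M X \<Longrightarrow> 0 \<le> s \<Longrightarrow> s < t \<Longrightarrow>
   distributed M lborel (\<lambda>\<omega>. X t \<omega> - X s \<omega>) (normal_density 0 (sqrt (t - s)))"
  by (simp add: standard_brownian_motion_def)

lemma sbm_indep: "standard_brownian_motion M X \<Longrightarrow> 0 \<le> t 0 \<Longrightarrow> (\<And>i. i < n \<Longrightarrow> t i \<le> t (Suc i)) \<Longrightarrow>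
   prob_space.indep_vars M (\<lambda>_. borel) (\<lambda>i \<omega>. X (t (Suc i)) \<omega> - X (t i) \<omega>) {..<n}"
  unfolding standard_brownian_motion_def by blast

lemma sbm_continuous: "standard_brownian_motion M X \<Longrightarrow> AE \<omega> in M. continuous_on {0..} (\<lambda>t. X t \<omega>)"
  by (simp add: standard_brownian_motion_def)

lemma sbm_prob_increment_greater:
  assumes W: "standard_brownian_motion M W" and st: "0 \<le> s" "s < t"
  shows "\<P>(\<omega> in M. W t \<omega> - W s \<omega> > x) = gauss_tail (x / sqrt (t - s))"
proof -
  interpret prob_space M by (rule sbm_prob_space[OF W])
  show ?thesis using st by (intro prob_normal_greater sbm_normal[OF W]) auto
qed

lemma sbm_prob_greater:
  assumes W: "standard_brownian_motion M W" and t: "0 < t"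
  shows "\<P>(\<omega> in M. W t \<omega> - c * t > u) = gauss_tail ((u + c * t) / sqrt t)"
proof -
  have [measurable]: "W t \<in> borel_measurable M" "W 0 \<in> borel_measurable M"
    using t by (auto intro!: sbm_measurable[OF W])
  have "\<P>(\<omega> in M. W t \<omega> - c * t > u) = \<P>(\<omega> in M. W t \<omega> - W 0 \<omega> > u + c * t)"
    using sbm_start[OF W] by (intro measure_eq_AE) auto
  thus ?thesis using sbm_prob_increment_greater[OF W, of 0 t] t by simp
qed

lemma drift_div_sqrt: "0 < x \<Longrightarrow> c * x / sqrt x = c * sqrt x"
  by (metis real_div_sqrt less_imp_le times_divide_eq_right)

text \<open>
  The drift over a stretch of length at most \<open>B - A\<close> is at most \<open>\<bar>c\<bar> * sqrt (B - A)\<close> standard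
  deviations of the increment, because \<open>x / sqrt x = sqrt x\<close>.
\<close>
lemma sbm_drift_increment_ge:
  assumes W: "standard_brownian_motion M W" and st: "0 \<le> A" "A \<le> s" "s \<le> B"
  shows "gauss_tail (\<bar>c\<bar> * sqrt (B - A)) \<le> \<P>(\<omega> in M. W B \<omega> - W s \<omega> \<ge> c * (B - s))"
proof (cases "s = B")
  case True
  interpret prob_space M by (rule sbm_prob_space[OF W])
  show ?thesis using True by (simp add: prob_space gauss_tail_le_1)
next
  case False
  interpret prob_space M by (rule sbm_prob_space[OF W])
  have "c * sqrt (B - s) \<le> \<bar>c\<bar> * sqrt (B - A)"
    using st by (intro mult_mono) auto
  hence "gauss_tail (\<bar>c\<bar> * sqrt (B - A)) \<le> gauss_tail (c * (B - s) / sqrt (B - s))"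
    using st False by (subst drift_div_sqrt) (auto intro!: gauss_tail_antimono)
  also have "\<dots> \<le> \<P>(\<omega> in M. W B \<omega> - W s \<omega> \<ge> c * (B - s))"
    using st False by (intro prob_normal_ge sbm_normal[OF W]) auto
  finally show ?thesis .
qed

lemma sbm_drift_increment_gt_le:
  assumes W: "standard_brownian_motion M W" and st: "0 \<le> A" "A \<le> s" "s < B"
  shows "\<P>(\<omega> in M. W B \<omega> - W s \<omega> > c * (B - s)) \<le> 1 - gauss_tail (\<bar>c\<bar> * sqrt (B - A))"
proof -
  have "- (\<bar>c\<bar> * sqrt (B - A)) \<le> - (\<bar>c\<bar> * sqrt (B - s))" "- (\<bar>c\<bar> * sqrt (B - s)) \<le> c * sqrt (B - s)"
    using st abs_ge_minus_self[of c] mult_right_mono[of "-c" "\<bar>c\<bar>" "sqrt (B - s)"] by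
        (auto intro!: mult_left_mono)
  hence "gauss_tail (c * sqrt (B - s)) \<le> gauss_tail (- (\<bar>c\<bar> * sqrt (B - A)))"
    by (intro gauss_tail_antimono) auto
  thus ?thesis using st
    by (subst sbm_prob_increment_greater[OF W]) (auto simp: drift_div_sqrt gauss_tail_minus)
qed

text \<open>
  Ottaviani's inequality on finer and finer grids. The event \<open>F\<close> is arbitrary, because the
  crossing event itself quantifies over uncountably many times and is measurable only up to a null
  set.
\<close>
lemma sbm_prob_crossing_le:
  assumes W: "standard_brownian_motion M W" and AB: "0 \<le> A" "A < B"
    and F: "F \<in> sets M" and FW: "AE \<omega> in M. \<omega> \<in> F \<longrightarrow> (\<exists>t\<in>{A..B}. W t \<omega> - c * t > u)"
  shows "gauss_tail (\<bar>c\<bar> * sqrt (B - A)) * measure M F \<le> gauss_tail ((u + c * B) / sqrt B)"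
proof -
  interpret prob_space M by (rule sbm_prob_space[OF W])
  let ?a = "gauss_tail (\<bar>c\<bar> * sqrt (B - A))"
  let ?G = "\<lambda>m. {\<omega>\<in>space M. \<exists>k\<in>{1..Suc (2 ^ m)}. W (grid A B m k) \<omega> - c * grid A B m k > u}"
  have g0: "0 \<le> grid A B m k" for m k using AB by (intro grid_nonneg) auto
  have [measurable]: "W (grid A B m k) \<in> borel_measurable M" for m k
    by (rule sbm_measurable[OF W g0])
  have "measure M F \<le> gauss_tail ((u + c * B) / sqrt B) / ?a"
  proof (rule measure_le_of_AE_eventually[where F="?G"])
    show "AE \<omega> in M. \<omega> \<in> F \<longrightarrow> eventually (\<lambda>m. \<omega> \<in> ?G m) sequentially"
      using FW sbm_continuous[OF W] AE_space
    proof eventually_elim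
      case (elim \<omega>)
      show ?case
      proof
        assume "\<omega> \<in> F"
        with elim obtain t where t: "t \<in> {A..B}" "W t \<omega> - c * t > u" by blast
        have "continuous_on {A..B} (\<lambda>t. W t \<omega> - c * t)"
          by (intro continuous_intros continuous_on_subset[OF elim(2)]) (use AB in auto)
        from eventually_grid_point_exceeds[OF this t AB(2)] obtain s where
          "W s \<omega> - c * s > u" "eventually (\<lambda>m. \<exists>k\<in>{1..Suc (2 ^ m)}. grid A B m k
              = s) sequentially" by blast
        from this(2,1) show "eventually (\<lambda>m. \<omega> \<in> ?G m) sequentially"
          by (auto elim!: eventually_mono simp: elim(3))
      qed
    qed
    show "eventually (\<lambda>m. measure M (?G m) \<le> gauss_tail ((u + c * B) / sqrt B) / ?a) sequentially"
    proof (intro always_eventually allI)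
      fix m
      have "?a * measure M (?G m) \<le> \<P>(\<omega> in M. W (grid A B m (Suc (2 ^ m))) \<omega> - c
          * grid A B m (Suc (2 ^ m)) > u)"
      proof (rule prob_grid_exceeds_le)
        show "indep_vars (\<lambda>_. borel) (\<lambda>i \<omega>. W (grid A B m (Suc i)) \<omega>
            - W (grid A B m i) \<omega>) {..<Suc (2 ^ m)}"
          by (rule sbm_indep[OF W]) (use AB in \<open>auto intro!: grid_mono\<close>)
        show "?a \<le> \<P>(\<omega> in M. W (grid A B m (Suc (2 ^ m))) \<omega> - W (grid A B m k) \<omega>
                  \<ge> c * (grid A B m (Suc (2 ^ m)) - grid A B m k))" if "k \<in> {1..Suc (2 ^ m)}" for k
          using that AB unfolding grid_last
          by (intro sbm_drift_increment_ge[OF W]) (auto intro!: grid_ge grid_le)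
      qed (use sbm_start[OF W] in auto)
      also have "\<dots> = gauss_tail ((u + c * B) / sqrt B)"
        using sbm_prob_greater[OF W, of B] AB by simp
      finally show "measure M (?G m) \<le> gauss_tail ((u + c * B) / sqrt B) / ?a"
        by (simp add: field_simps gauss_tail_pos)
    qed
  qed (use F in auto)
  thus ?thesis by (simp add: field_simps gauss_tail_pos)
qed

lemma eventually_grid_steps_small:
  fixes f :: "real \<Rightarrow> real"
  assumes cont: "continuous_on {A..B} f" and AB: "0 \<le> A" "A < B" and e: "e > 0"
  shows "eventually (\<lambda>m. \<forall>i\<in>{1..<Suc (2 ^ m)}. f (grid A B m (Suc i)) - f (grid A B m i)
      \<le> e) sequentially"
proof -
  have "uniformly_continuous_on {A..B} f" using cont by (intro compact_uniformly_continuous) auto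
  then obtain d where d: "d > 0" "\<And>x y. x \<in> {A..B} \<Longrightarrow> y \<in> {A..B} \<Longrightarrow> dist x y < d \<Longrightarrow> dist (f x) (f y)
      < e"
    using e unfolding uniformly_continuous_on_def by metis
  have "(\<lambda>j. (B - A) / 2 ^ j) \<longlonglongrightarrow> 0" by real_asymp
  hence "eventually (\<lambda>j. (B - A) / 2 ^ j < d) sequentially" using d(1) by (rule order_tendstoD)
  thus ?thesis
  proof eventually_elim
    case (elim m)
    show ?case
    proof
      fix i assume i: "i \<in> {1..<Suc (2 ^ m)}"
      then obtain j where j: "i = Suc j" by (cases i) auto
      have "grid A B m (Suc i) - grid A B m i = (B - A) / 2 ^ m"
        by (simp add: j grid_def add_divide_distrib distrib_left)
      moreover have "grid A B m i \<le> grid A B m (Suc i)" using AB by (intro grid_mono) auto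
      ultimately have "dist (grid A B m (Suc i)) (grid A B m i) < d"
        using elim by (simp add: dist_real_def)
      moreover have "grid A B m (Suc i) \<in> {A..B}" "grid A B m i \<in> {A..B}"
        using i AB by (auto intro!: grid_ge grid_le)
      ultimately have "dist (f (grid A B m (Suc i))) (f (grid A B m i)) < e"
        by (intro d(2))
      thus "f (grid A B m (Suc i)) - f (grid A B m i) \<le> e" by (auto simp: dist_real_def)
    qed
  qed
qed

text \<open>
  A path that is at most \<open>u\<close> above the moving origin \<open>c * A\<close> at time \<open>A\<close> and more than \<open>u\<close> above
  \<open>c * B\<close> at time \<open>B\<close> crosses in between, and after crossing it ends above the line with
  probability at most \<open>1 - \<Psi> (\<bar>c\<bar> * sqrt (B - A))\<close>. Uniform continuity makes the overshoot on a
  fine grid smaller than any \<open>e > 0\<close>, and \<open>e\<close> tends to \<open>0\<close> at the end.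
\<close>
lemma sbm_prob_crossing_ge:
  assumes W: "standard_brownian_motion M W" and AB: "0 < A" "A < B"
    and F: "F \<in> sets M" and FW: "AE \<omega> in M. (\<exists>t\<in>{A..B}. W t \<omega> - c * t > u) \<longrightarrow> \<omega> \<in> F"
  shows "gauss_tail ((u + c * B) / sqrt B) - gauss_tail ((u + c * A) / sqrt A)
     \<le> (1 - gauss_tail (\<bar>c\<bar> * sqrt (B - A))) * measure M F"
proof -
  interpret prob_space M by (rule sbm_prob_space[OF W])
  let ?b = "1 - gauss_tail (\<bar>c\<bar> * sqrt (B - A))"
  have b0: "?b \<ge> 0" by (simp add: gauss_tail_le_1)
  have g0: "0 \<le> grid A B m k" for m k using AB by (intro grid_nonneg) auto
  have Wm[measurable]: "W (grid A B m k) \<in> borel_measurable M" for m k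
    by (rule sbm_measurable[OF W g0])
  have [measurable]: "W A \<in> borel_measurable M" "W B \<in> borel_measurable M"
      "W 0 \<in> borel_measurable M"
    using AB by (auto intro!: sbm_measurable[OF W])
  \<comment> \<open>The level at the end of the interval is raised by \<open>e\<close> to make room for the overshoot.\<close>
  have step: "gauss_tail ((u + e + c * B) / sqrt B) - gauss_tail ((u + c * A) / sqrt A) \<le> ?b
      * measure M F"
    if e: "e > 0" for e
  proof -
    define X where "X m i \<omega> = (W (grid A B m (Suc i)) \<omega> - W (grid A B m i) \<omega>) - c
        * (grid A B m (Suc i) - grid A B m i)" for m i \<omega>
    have S: "(\<Sum>i=k..<l. X m i \<omega>) = (W (grid A B m l) \<omega> - W (grid A B m k) \<omega>) - c
        * (grid A B m l - grid A B m k)"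
      if "k \<le> l" for k l m \<omega>
      using sum_Suc_diff'[OF that, of "\<lambda>i. W (grid A B m i) \<omega> - c * grid A B m i"] by
          (simp add: X_def algebra_simps)
    have S0: "(\<Sum>i<l. X m i \<omega>) = (W (grid A B m l) \<omega> - W 0 \<omega>) - c * grid A B m l" for l m \<omega>
      using S[of 0 l m \<omega>] by (simp add: atLeast0LessThan)
    have Xm[measurable]: "X m i \<in> borel_measurable M" for m i unfolding X_def by measurable
    let ?N = "\<lambda>m. Suc (2 ^ m) :: nat"
    let ?G = "\<lambda>m. {\<omega>\<in>space M. (\<Sum>i<?N m. X m i \<omega>) > u + e \<and> X m 0 \<omega> \<le> u
        \<and> (\<forall>i\<in>{1..<?N m}. X m i \<omega> \<le> e)}"
    let ?E = "{\<omega>\<in>space M. W B \<omega> - c * B > u + e \<and> \<not> W A \<omega> - c * A > u}"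
    have "measure M ?E \<le> ?b * measure M F"
    proof (rule measure_le_of_AE_eventually[where F="?G"])
      show "AE \<omega> in M. \<omega> \<in> ?E \<longrightarrow> eventually (\<lambda>m. \<omega> \<in> ?G m) sequentially"
        using sbm_start[OF W] sbm_continuous[OF W] AE_space
      proof eventually_elim
        case (elim \<omega>)
        show ?case
        proof
          assume E: "\<omega> \<in> ?E"
          have "continuous_on {A..B} (\<lambda>t. W t \<omega> - c * t)"
            by (intro continuous_intros continuous_on_subset[OF elim(2)]) (use AB in auto)
          from eventually_grid_steps_small[OF this _ AB(2) e] AB
          have "eventually (\<lambda>m. \<forall>i\<in>{1..<Suc (2 ^ m)}. X m i \<omega> \<le> e) sequentially"
            by (auto simp: X_def algebra_simps)
          thus "eventually (\<lambda>m. \<omega> \<in> ?G m) sequentially"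
          proof eventually_elim
            case (elim m)
            have "X m 0 \<omega> = W A \<omega> - c * A" using \<open>W 0 \<omega> = 0\<close> by (simp add: X_def)
            moreover have "(\<Sum>i<?N m. X m i \<omega>) = W B \<omega> - c * B"
                using S0[of m \<omega> "?N m"] \<open>W 0 \<omega> = 0\<close> by simp
            ultimately show ?case using elim E by (simp del: sum.lessThan_Suc)
          qed
        qed
      qed
      show "eventually (\<lambda>m. measure M (?G m) \<le> ?b * measure M F) sequentially"
      proof (intro always_eventually allI)
        fix m
        have "measure M (?G m) \<le> ?b * \<P>(\<omega> in M. \<exists>k\<in>{1..?N m}. (\<Sum>i<k. X m i \<omega>) > u)"
        proof (rule prob_sum_greater_no_jump_le)
          have "indep_vars (\<lambda>_. borel) (\<lambda>i \<omega>. W (grid A B m (Suc i)) \<omega>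
              - W (grid A B m i) \<omega>) {..<?N m}"
            by (rule sbm_indep[OF W]) (use AB in \<open>auto intro!: grid_mono\<close>)
          from indep_vars_compose2[OF this, where Y="\<lambda>i x. x - c
              * (grid A B m (Suc i) - grid A B m i)"]
          show "indep_vars (\<lambda>_. borel) (X m) {..<?N m}" by (auto simp: X_def[abs_def])
          fix k assume k: "2 \<le> k" "k < ?N m"
          have "\<P>(\<omega> in M. (\<Sum>i=k..<?N m. X m i \<omega>) > 0) =
             \<P>(\<omega> in M. W B \<omega> - W (grid A B m k) \<omega> > c * (B - grid A B m k))"
            using k by (subst S) auto
          also have "\<dots> \<le> ?b"
            using k AB by (intro sbm_drift_increment_gt_le[OF W] grid_ge grid_less) auto
          finally show "\<P>(\<omega> in M. (\<Sum>i=k..<?N m. X m i \<omega>) > 0) \<le> ?b" .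
        qed (use b0 e in auto)
        also have "\<P>(\<omega> in M. \<exists>k\<in>{1..?N m}. (\<Sum>i<k. X m i \<omega>) > u) \<le> measure M F"
        proof (rule finite_measure_mono_AE[OF _ F])
          show "AE \<omega> in M. \<omega> \<in> {\<omega>\<in>space M. \<exists>k\<in>{1..?N m}. (\<Sum>i<k. X m i \<omega>) > u} \<longrightarrow> \<omega> \<in> F"
            using FW sbm_start[OF W]
          proof eventually_elim
            case (elim \<omega>)
            show ?case
            proof
              assume "\<omega> \<in> {\<omega>\<in>space M. \<exists>k\<in>{1..?N m}. (\<Sum>i<k. X m i \<omega>) > u}"
              then obtain k where k: "k \<in> {1..?N m}" "W (grid A B m k) \<omega> - c * grid A B m k > u"
                using elim(2) by (auto simp: S0)
              moreover have "grid A B m k \<in> {A..B}" using k AB by (auto intro!: grid_ge grid_le)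
              ultimately show "\<omega> \<in> F" using elim(1) by blast
            qed
          qed
        qed
        finally show "measure M (?G m) \<le> ?b * measure M F" using b0 by (simp add: mult_left_mono)
      qed
    qed auto
    moreover have "gauss_tail ((u + e + c * B) / sqrt B) - gauss_tail ((u + c * A) / sqrt A)
        \<le> measure M ?E"
    proof -
      have "gauss_tail ((u + e + c * B) / sqrt B) = \<P>(\<omega> in M. W B \<omega> - c * B > u + e)"
        using sbm_prob_greater[OF W, of B] AB by simp
      also have "\<dots> \<le> measure M (?E \<union> {\<omega>\<in>space M. W A \<omega> - c * A > u})"
        by (rule finite_measure_mono) auto
      also have "\<dots> \<le> measure M ?E + \<P>(\<omega> in M. W A \<omega> - c * A > u)"
        by (rule measure_Un_le) auto
      also have "\<P>(\<omega> in M. W A \<omega> - c * A > u) = gauss_tail ((u + c * A) / sqrt A)"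
        using sbm_prob_greater[OF W, of A] AB by simp
      finally show ?thesis by simp
    qed
    ultimately show ?thesis by simp
  qed
  show ?thesis
  proof (rule tendsto_upperbound)
    have "((\<lambda>e. gauss_tail ((u + e + c * B) / sqrt B))
        \<longlongrightarrow> gauss_tail ((u + 0 + c * B) / sqrt B)) (at_right 0)"
      by (intro isCont_tendsto_compose[OF isCont_gauss_tail] tendsto_intros) (use AB in auto)
    thus "((\<lambda>e. gauss_tail ((u + e + c * B) / sqrt B) - gauss_tail ((u + c * A) / sqrt A)) \<longlongrightarrow>
       gauss_tail ((u + c * B) / sqrt B) - gauss_tail ((u + c * A) / sqrt A)) (at_right 0)"
      by (auto intro!: tendsto_intros)
    show "eventually (\<lambda>e. gauss_tail ((u + e + c * B) / sqrt B)
        - gauss_tail ((u + c * A) / sqrt A) \<le> ?b * measure M F) (at_right 0)"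
      using step by (auto simp: eventually_at_filter)
  qed auto
qed

definition dyadic_crossing :: "'a measure \<Rightarrow> (real \<Rightarrow> 'a \<Rightarrow> real) \<Rightarrow> real \<Rightarrow> real \<Rightarrow> real \<Rightarrow> real
    \<Rightarrow> 'a set" where
  "dyadic_crossing M X A B c u =
     {\<omega>\<in>space M. \<exists>m. \<exists>k\<in>{1..Suc (2 ^ m)}. X (grid A B m k) \<omega> - c * grid A B m k > u}"

text \<open>
  Stated for an arbitrary measure space, because the crossing must later also be measurable with
  respect to the paths alone.
\<close>
lemma sets_dyadic_crossing:
  assumes X: "\<And>s. 0 \<le> s \<Longrightarrow> X s \<in> borel_measurable M" and AB: "0 \<le> A" "A < B"
  shows "dyadic_crossing M X A B c u \<in> sets M"
proof -
  have [measurable]: "X (grid A B m k) \<in> borel_measurable M" for m k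
    using AB by (intro X grid_nonneg) auto
  show ?thesis unfolding dyadic_crossing_def by measurable
qed

lemma AE_dyadic_crossing_iff:
  assumes W: "standard_brownian_motion M W" and AB: "0 \<le> A" "A < B"
  shows "AE \<omega> in M. \<omega> \<in> dyadic_crossing M W A B c u \<longleftrightarrow> (\<exists>t\<in>{A..B}. W t \<omega> - c * t > u)"
  using sbm_continuous[OF W] AE_space
proof eventually_elim
  case (elim \<omega>)
  show ?case
  proof
    assume "\<omega> \<in> dyadic_crossing M W A B c u"
    then obtain m k where "k \<in> {1..Suc (2 ^ m)}" "W (grid A B m k) \<omega> - c * grid A B m k > u"
      unfolding dyadic_crossing_def by blast
    moreover from this(1) have "grid A B m k \<in> {A..B}" using AB by (auto intro!: grid_ge grid_le)
    ultimately show "\<exists>t\<in>{A..B}. W t \<omega> - c * t > u" by blast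
  next
    assume "\<exists>t\<in>{A..B}. W t \<omega> - c * t > u"
    then obtain t where t: "t \<in> {A..B}" "W t \<omega> - c * t > u" by blast
    have "continuous_on {A..B} (\<lambda>t. W t \<omega> - c * t)"
      by (intro continuous_intros continuous_on_subset[OF elim(1)]) (use AB in auto)
    from eventually_grid_point_exceeds[OF this t AB(2)] obtain s where
      s: "W s \<omega> - c * s > u" "eventually (\<lambda>m. \<exists>k\<in>{1..Suc (2 ^ m)}. grid A B m k
          = s) sequentially" by blast
    from eventually_happens'[OF _ s(2)] show "\<omega> \<in> dyadic_crossing M W A B c u"
      using s(1) elim(2) by (auto simp: dyadic_crossing_def)
  qed
qed

lemma gauss_tail_sqrt_tendsto: "((\<lambda>d. gauss_tail (\<bar>c\<bar> * sqrt d)) \<longlongrightarrow> 1 / 2) (at_right 0)"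
proof -
  have "((\<lambda>d. gauss_tail (\<bar>c\<bar> * sqrt d)) \<longlongrightarrow> gauss_tail (\<bar>c\<bar> * sqrt 0)) (at_right 0)"
    by (intro isCont_tendsto_compose[OF isCont_gauss_tail] tendsto_intros)
  thus ?thesis by (simp add: gauss_tail_0)
qed

text \<open>
  Split \<open>[0, T]\<close> at \<open>T - d\<close>. The part before \<open>T - d\<close> is negligible for each fixed \<open>d\<close>, and the
  estimates for the part after it enclose the limiting ratio between \<open>1 / (1 - \<Psi> (\<bar>c\<bar> * sqrt d))\<close>
  and \<open>1 / \<Psi> (\<bar>c\<bar> * sqrt d)\<close>, both of which tend to \<open>2\<close> as \<open>d\<close> tends to \<open>0\<close>.
\<close>
lemma sbm_crossing_asymp:
  assumes W: "standard_brownian_motion M W" and T: "0 < T"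
  shows "((\<lambda>u. measure M (dyadic_crossing M W 0 T c u) / gauss_tail ((u + c * T) / sqrt T))
      \<longlongrightarrow> 2) at_top"
proof -
  define H where "H = dyadic_crossing M W 0 T c"
  have H: "H u \<in> sets M" for u
    unfolding H_def by (intro sets_dyadic_crossing sbm_measurable[OF W] T order_refl)
  have HW: "AE \<omega> in M. \<omega> \<in> H u \<longleftrightarrow> (\<exists>t\<in>{0..T}. W t \<omega> - c * t > u)" for u
    unfolding H_def by (intro AE_dyadic_crossing_iff W T order_refl)
  interpret prob_space M by (rule sbm_prob_space[OF W])
  let ?Q = "\<lambda>u. gauss_tail ((u + c * T) / sqrt T)"
  let ?q = "\<lambda>d u. gauss_tail ((u + c * (T - d)) / sqrt (T - d))"
  let ?p = "\<lambda>x. gauss_tail (\<bar>c\<bar> * sqrt x)"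
  have negl: "((\<lambda>u. ?q d u / ?Q u) \<longlongrightarrow> 0) at_top" if "0 < d" "d < T" for d
    using that by (intro gauss_tail_negligible) auto
  have p_lt1: "?p d < 1" for d
    using gauss_tail_pos[of "- (\<bar>c\<bar> * sqrt d)"] by (simp add: gauss_tail_minus)
  have upper: "measure M (H u) / ?Q u \<le> 1 / ?p d + (?q d u / ?Q u) / ?p (T - d)" if d: "0 < d"
      "d < T" for d u
  proof -
    define F1 where "F1 = dyadic_crossing M W (T - d) T c u"
    define F2 where "F2 = dyadic_crossing M W 0 (T - d) c u"
    have F1: "F1 \<in> sets M" "AE \<omega> in M. \<omega> \<in> F1 \<longleftrightarrow> (\<exists>t\<in>{T - d..T}. W t \<omega> - c * t > u)"
      unfolding F1_def using d by (auto intro!: sets_dyadic_crossing sbm_measurable[OF W]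
          AE_dyadic_crossing_iff W)
    have F2: "F2 \<in> sets M" "AE \<omega> in M. \<omega> \<in> F2 \<longleftrightarrow> (\<exists>t\<in>{0..T - d}. W t \<omega> - c * t > u)"
      unfolding F2_def using d by (auto intro!: sets_dyadic_crossing sbm_measurable[OF W]
          AE_dyadic_crossing_iff W)
    have "measure M (H u) \<le> measure M (F1 \<union> F2)"
    proof (rule finite_measure_mono_AE)
      show "AE \<omega> in M. \<omega> \<in> H u \<longrightarrow> \<omega> \<in> F1 \<union> F2"
        using HW[of u] F1(2) F2(2) by eventually_elim force
    qed (use F1 F2 in auto)
    also have "\<dots> \<le> measure M F1 + measure M F2"
      using F1 F2 by (intro measure_Un_le) auto
    also have "measure M F1 \<le> ?Q u / ?p d"
    proof -
      have "AE \<omega> in M. \<omega> \<in> F1 \<longrightarrow> (\<exists>t\<in>{T - d..T}. W t \<omega> - c * t > u)"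
        using F1(2) by eventually_elim blast
      from sbm_prob_crossing_le[OF W _ _ F1(1) this] d show ?thesis
        by (simp add: pos_le_divide_eq gauss_tail_pos mult.commute)
    qed
    also have "measure M F2 \<le> ?q d u / ?p (T - d)"
    proof -
      have "AE \<omega> in M. \<omega> \<in> F2 \<longrightarrow> (\<exists>t\<in>{0..T - d}. W t \<omega> - c * t > u)"
        using F2(2) by eventually_elim blast
      from sbm_prob_crossing_le[OF W _ _ F2(1) this] d show ?thesis
        by (simp add: pos_le_divide_eq gauss_tail_pos mult.commute)
    qed
    finally have "measure M (H u) / ?Q u \<le> (?Q u / ?p d + ?q d u / ?p (T - d)) / ?Q u"
      by (intro divide_right_mono gauss_tail_nonneg) auto
    also have "\<dots> = 1 / ?p d + (?q d u / ?Q u) / ?p (T - d)"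
      using gauss_tail_pos[of "(u + c * T) / sqrt T"] by (simp add: add_divide_distrib)
    finally show ?thesis .
  qed
  have lower: "(1 - ?q d u / ?Q u) / (1 - ?p d) \<le> measure M (H u) / ?Q u" if d: "0 < d" "d < T"
      for d u
  proof -
    have "AE \<omega> in M. (\<exists>t\<in>{T - d..T}. W t \<omega> - c * t > u) \<longrightarrow> \<omega> \<in> H u"
      using HW[of u] by eventually_elim (use d in force)
    from sbm_prob_crossing_ge[OF W _ _ H this] d
    have "?Q u - ?q d u \<le> (1 - ?p d) * measure M (H u)" by simp
    hence "(?Q u - ?q d u) / ?Q u \<le> (1 - ?p d) * measure M (H u) / ?Q u"
      by (intro divide_right_mono gauss_tail_nonneg)
    hence "1 - ?q d u / ?Q u \<le> (1 - ?p d) * (measure M (H u) / ?Q u)"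
      using gauss_tail_pos[of "(u + c * T) / sqrt T"] by (simp add: diff_divide_distrib)
    thus ?thesis using p_lt1[of d] by (simp add: pos_divide_le_eq mult.commute)
  qed
  show ?thesis unfolding H_def[symmetric]
  proof (rule order_tendstoI)
    fix a :: real assume a: "a < 2"
    have "((\<lambda>d. 1 / (1 - ?p d)) \<longlongrightarrow> 1 / (1 - 1 / 2)) (at_right 0)"
      by (intro tendsto_intros gauss_tail_sqrt_tendsto) auto
    hence "eventually (\<lambda>d. a < 1 / (1 - ?p d)) (at_right 0)"
      using a by (intro order_tendstoD(1)) auto
    moreover have "eventually (\<lambda>d. d \<in> {0<..<T}) (at_right 0)"
      using T by (rule eventually_at_right_real)
    ultimately have "eventually (\<lambda>d. a < 1 / (1 - ?p d) \<and> d \<in> {0<..<T}) (at_right 0)"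
      by (rule eventually_conj)
    then obtain d where d: "a < 1 / (1 - ?p d)" "0 < d" "d < T"
      using eventually_happens'[OF trivial_limit_at_right_real] by fastforce
    have "((\<lambda>u. (1 - ?q d u / ?Q u) / (1 - ?p d)) \<longlongrightarrow> (1 - 0) / (1 - ?p d)) at_top"
      using p_lt1[of d] by (intro tendsto_intros negl d) auto
    hence "eventually (\<lambda>u. a < (1 - ?q d u / ?Q u) / (1 - ?p d)) at_top"
      using d by (intro order_tendstoD(1)) auto
    thus "eventually (\<lambda>u. a < measure M (H u) / ?Q u) at_top"
      by eventually_elim (use lower[OF d(2,3)] in \<open>auto intro: less_le_trans\<close>)
  next
    fix a :: real assume a: "2 < a"
    have "((\<lambda>d. 1 / ?p d) \<longlongrightarrow> 1 / (1 / 2)) (at_right 0)"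
      by (intro tendsto_intros gauss_tail_sqrt_tendsto) auto
    hence "eventually (\<lambda>d. 1 / ?p d < a) (at_right 0)"
      using a by (intro order_tendstoD(2)) auto
    moreover have "eventually (\<lambda>d. d \<in> {0<..<T}) (at_right 0)"
      using T by (rule eventually_at_right_real)
    ultimately have "eventually (\<lambda>d. 1 / ?p d < a \<and> d \<in> {0<..<T}) (at_right 0)"
      by (rule eventually_conj)
    then obtain d where d: "1 / ?p d < a" "0 < d" "d < T"
      using eventually_happens'[OF trivial_limit_at_right_real] by fastforce
    have "((\<lambda>u. 1 / ?p d + (?q d u / ?Q u) / ?p (T - d)) \<longlongrightarrow> 1 / ?p d + 0 / ?p (T - d)) at_top"
      using gauss_tail_pos[of "\<bar>c\<bar> * sqrt (T - d)"] by (intro tendsto_intros negl d) auto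
    hence "eventually (\<lambda>u. 1 / ?p d + (?q d u / ?Q u) / ?p (T - d) < a) at_top"
      using d by (intro order_tendstoD(2)) auto
    thus "eventually (\<lambda>u. measure M (H u) / ?Q u < a) at_top"
      by eventually_elim (use upper[OF d(2,3)] in \<open>auto intro: le_less_trans\<close>)
  qed
qed

section \<open>Independence of lifetimes and motions\<close>

context prob_space begin

lemma indep_sets_reindex:
  assumes inj: "inj_on f I" and ind: "indep_sets F (f ` I)"
  shows "indep_sets (\<lambda>i. F (f i)) I"
proof (rule indep_setsI)
  show "F (f i) \<subseteq> events" if "i \<in> I" for i using ind that by (auto simp: indep_sets_def)
next
  fix A J assume J: "J \<noteq> {}" "J \<subseteq> I" "finite J" and A: "\<forall>j\<in>J. A j \<in> F (f j)"
  define B where "B k = A (the_inv_into I f k)" for k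
  have B: "B (f j) = A j" if "j \<in> J" for j
    using that J inj by (auto simp: B_def the_inv_into_f_f)
  have "prob (\<Inter>k\<in>f ` J. B k) = (\<Prod>k\<in>f ` J. prob (B k))"
    by (rule indep_setsD[OF ind]) (use J A B in auto)
  moreover have "(\<Prod>k\<in>f ` J. prob (B k)) = (\<Prod>j\<in>J. prob (B (f j)))"
    by (subst prod.reindex) (use J inj in \<open>auto intro: inj_on_subset\<close>)
  ultimately show "prob (\<Inter>j\<in>J. A j) = (\<Prod>j\<in>J. prob (A j))"
    using B by (simp cong: INF_cong_simp prod.cong)
qed

text \<open>
  Conditioning on a discrete random element: on \<open>R \<omega> = r\<close> the event \<open>G (R \<omega>)\<close> becomes the fixed
  event \<open>G r\<close>, which is independent of \<open>R\<close>. Countability of \<open>S\<close> replaces the disintegration of the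
  joint law, and with it the question whether \<open>\<omega> \<in> G r\<close> is jointly measurable.
\<close>
lemma prob_frozen_le:
  assumes S: "countable S" and A: "A \<in> events"
    and R: "\<And>r. r \<in> S \<Longrightarrow> A \<inter> {\<omega>\<in>space M. R \<omega> = r} \<in> \<T>" and G: "\<And>r. r \<in> S \<Longrightarrow> G r \<in> \<W>"
    and ind: "indep_set \<T> \<W>" and C: "\<And>r. r \<in> S \<Longrightarrow> prob (G r) \<le> C" "C \<ge> 0"
  shows "{\<omega>\<in>A. R \<omega> \<in> S \<and> \<omega> \<in> G (R \<omega>)} \<in> events"
    and "prob {\<omega>\<in>A. R \<omega> \<in> S \<and> \<omega> \<in> G (R \<omega>)} \<le> C * prob A"
proof -
  let ?X = "\<lambda>r. A \<inter> {\<omega>\<in>space M. R \<omega> = r}"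
  have X: "?X r \<in> events" if "r \<in> S" for r using R[OF that] indep_setD_ev1[OF ind] by auto
  have Ge: "G r \<in> events" if "r \<in> S" for r using G[OF that] indep_setD_ev2[OF ind] by auto
  have eq: "{\<omega>\<in>A. R \<omega> \<in> S \<and> \<omega> \<in> G (R \<omega>)} = (\<Union>r\<in>S. ?X r \<inter> G r)"
    using sets.sets_into_space[OF A] by auto
  show ev: "{\<omega>\<in>A. R \<omega> \<in> S \<and> \<omega> \<in> G (R \<omega>)} \<in> events"
    unfolding eq using S X Ge by (intro sets.countable_UN') auto
  have "emeasure M (\<Union>r\<in>S. ?X r \<inter> G r) = (\<integral>\<^sup>+r. emeasure M (?X r \<inter> G r) \<partial>count_space S)"
    by (rule emeasure_UN_countable) (use S X Ge in \<open>auto simp: disjoint_family_on_def\<close>)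
  also have "\<dots> \<le> (\<integral>\<^sup>+r. ennreal C * emeasure M (?X r) \<partial>count_space S)"
  proof (rule nn_integral_mono)
    fix r assume "r \<in> space (count_space S)"
    hence r: "r \<in> S" by simp
    have "emeasure M (?X r \<inter> G r) = ennreal (prob (?X r) * prob (G r))"
      using indep_setD[OF ind R[OF r] G[OF r]] by (simp add: emeasure_eq_measure)
    also have "\<dots> \<le> ennreal (C * prob (?X r))"
      using C(1)[OF r] by (subst mult.commute) (intro ennreal_leI mult_right_mono, auto)
    also have "\<dots> = ennreal C * emeasure M (?X r)"
      using C(2) by (simp add: emeasure_eq_measure ennreal_mult)
    finally show "emeasure M (?X r \<inter> G r) \<le> ennreal C * emeasure M (?X r)" .
  qed
  also have "\<dots> = ennreal C * (\<integral>\<^sup>+r. emeasure M (?X r) \<partial>count_space S)"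
    by (rule nn_integral_cmult) auto
  also have "(\<integral>\<^sup>+r. emeasure M (?X r) \<partial>count_space S) = emeasure M (\<Union>r\<in>S. ?X r)"
    by (rule emeasure_UN_countable[symmetric]) (use S X in \<open>auto simp: disjoint_family_on_def\<close>)
  also have "\<dots> \<le> emeasure M A"
    by (rule emeasure_mono) (use A in auto)
  finally have "emeasure M (\<Union>r\<in>S. ?X r \<inter> G r) \<le> ennreal C * emeasure M A"
    by (simp add: mult_left_mono)
  hence "ennreal (prob (\<Union>r\<in>S. ?X r \<inter> G r)) \<le> ennreal (C * prob A)"
    using C(2) by (simp add: emeasure_eq_measure ennreal_mult)
  thus "prob {\<omega>\<in>A. R \<omega> \<in> S \<and> \<omega> \<in> G (R \<omega>)} \<le> C * prob A"
    unfolding eq using C(2) by (subst (asm) ennreal_le_iff) auto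
qed

end

definition path_sets :: "'a measure \<Rightarrow> (real \<Rightarrow> 'a \<Rightarrow> real) \<Rightarrow> 'a set set" where
  "path_sets M X = {(\<lambda>\<omega>. \<lambda>s\<in>{0..}. X s \<omega>) -` A \<inter> space M |A. A \<in> sets (Pi\<^sub>M {0..} (\<lambda>_. borel))}"

lemma path_setsI:
  assumes "{x\<in>space (Pi\<^sub>M {0..} (\<lambda>_. borel)). P x} \<in> sets (Pi\<^sub>M {0..} (\<lambda>_. borel :: real measure))"
    and "\<And>\<omega>. \<omega> \<in> space M \<Longrightarrow> P (\<lambda>s\<in>{0..}. X s \<omega>) \<longleftrightarrow> Q \<omega>"
  shows "{\<omega>\<in>space M. Q \<omega>} \<in> path_sets M X"
proof -
  have "{\<omega>\<in>space M. Q \<omega>} = (\<lambda>\<omega>. \<lambda>s\<in>{0..}. X s \<omega>) -` {x\<in>space (Pi\<^sub>M {0..} (\<lambda>_. borel)). P x}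
      \<inter> space M"
    using assms(2) by (auto simp: space_PiM)
  thus ?thesis unfolding path_sets_def using assms(1) by blast
qed

context branching_brownian_motion
begin

lemma indep_path_sets: "indep_sets (\<lambda>\<gamma>. path_sets M (W \<gamma>)) UNIV"
proof -
  have "indep_sets (\<lambda>\<gamma>. (case_sum
         (\<lambda>\<gamma>. {\<tau> \<gamma> -` A \<inter> space M |A. A \<in> sets borel})
         (\<lambda>\<gamma>. {(\<lambda>\<omega>. \<lambda>s\<in>{0..}. W \<gamma> s \<omega>) -` A \<inter> space M |A. A
             \<in> sets (Pi\<^sub>M {0..} (\<lambda>_. borel))})) (Inr \<gamma>)) UNIV"
    by (rule indep_sets_reindex[where f=Inr]) (auto intro: indep_sets_mono_index[OF _ independence])
  thus ?thesis by (simp add: path_sets_def)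
qed

lemma tau_measurable [measurable]: "\<tau> \<gamma> \<in> borel_measurable M"
  using distributed_measurable[OF lifetime] by simp

lemma indep_vars_tau: "indep_vars (\<lambda>_. borel) \<tau> UNIV"
proof -
  have "indep_sets (\<lambda>\<gamma>. (case_sum
         (\<lambda>\<gamma>. {\<tau> \<gamma> -` A \<inter> space M |A. A \<in> sets borel})
         (\<lambda>\<gamma>. {(\<lambda>\<omega>. \<lambda>s\<in>{0..}. W \<gamma> s \<omega>) -` A \<inter> space M |A. A
             \<in> sets (Pi\<^sub>M {0..} (\<lambda>_. borel))})) (Inl \<gamma>)) UNIV"
    by (rule indep_sets_reindex[where f=Inl]) (auto intro: indep_sets_mono_index[OF _ independence])
  thus ?thesis by (simp add: indep_vars_def2)
qed

definition lifetime_events :: "'a set set" where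
  "lifetime_events = sigma_sets (space M) (\<Union>\<gamma>. {\<tau> \<gamma> -` A \<inter> space M |A. A \<in> sets borel})"

definition path_events :: "'a set set" where
  "path_events = sigma_sets (space M) (\<Union>\<gamma>. path_sets M (W \<gamma>))"

lemma indep_lifetime_path: "indep_set lifetime_events path_events"
proof -
  let ?F = "case_sum
         (\<lambda>\<gamma>. {\<tau> \<gamma> -` A \<inter> space M |A. A \<in> sets borel})
         (\<lambda>\<gamma>. {(\<lambda>\<omega>. \<lambda>s\<in>{0..}. W \<gamma> s \<omega>) -` A \<inter> space M |A. A \<in> sets (Pi\<^sub>M {0..} (\<lambda>_. borel))})"
  let ?I = "\<lambda>b::bool. if b then range Inl else range Inr"
  have "indep_sets (\<lambda>b. sigma_sets (space M) (\<Union>i\<in>?I b. ?F i)) UNIV"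
  proof (rule indep_sets_collect_sigma)
    show "indep_sets ?F (\<Union>b\<in>UNIV. ?I b)" by (rule indep_sets_mono_index[OF _ independence]) auto
    show "disjoint_family_on ?I UNIV" by (auto simp: disjoint_family_on_def)
    fix i :: "bool list + bool list" and b :: bool
    have *: "Int_stable {f -` A \<inter> space M |A. A \<in> sets N}" for f :: "'a \<Rightarrow> 'c" and N
    proof (rule Int_stableI)
      fix a b assume "a \<in> {f -` A \<inter> space M |A. A \<in> sets N}" "b \<in> {f -` A \<inter> space M |A. A \<in> sets N}"
      then obtain A B where "a = f -` A \<inter> space M" "b = f -` B \<inter> space M" "A \<in> sets N"
          "B \<in> sets N" by blast
      hence "a \<inter> b = f -` (A \<inter> B) \<inter> space M \<and> A \<inter> B \<in> sets N" by auto
      thus "a \<inter> b \<in> {f -` A \<inter> space M |A. A \<in> sets N}" by blast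
    qed
    show "Int_stable (?F i)" by (cases i) (auto intro: *)
  qed
  moreover have "(\<lambda>b. sigma_sets (space M) (\<Union>i\<in>?I b. ?F i)) = case_bool lifetime_events path_events"
    by (auto simp: fun_eq_iff lifetime_events_def path_events_def path_sets_def image_image
        split: bool.split)
  ultimately show ?thesis by (simp add: indep_set_def)
qed

lemma sigma_algebra_lifetime_events: "sigma_algebra (space M) lifetime_events"
  unfolding lifetime_events_def by (rule sigma_algebra_sigma_sets) auto

lemma sigma_algebra_path_events: "sigma_algebra (space M) path_events"
  unfolding path_events_def by (rule sigma_algebra_sigma_sets) (auto simp: path_sets_def)

lemma tau_lifetime_events:
  "A \<in> sets borel \<Longrightarrow> {\<omega>\<in>space M. \<tau> \<gamma> \<omega> \<in> A} \<in> lifetime_events"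
  unfolding lifetime_events_def by (intro sigma_sets.Basic)
      (auto simp: vimage_def Int_def conj_commute)

lemma W_measurable [measurable]: "0 \<le> s \<Longrightarrow> W \<gamma> s \<in> borel_measurable M"
  by (rule sbm_measurable[OF motion])

text \<open>
  The same outcomes with fewer measurable sets. It turns membership in \<open>path_events\<close> into a
  measurability question.
\<close>
definition path_space :: "'a measure" where
  "path_space = sigma (space M) path_events"

lemma sets_path_space: "sets path_space = path_events"
  unfolding path_space_def using sigma_algebra.sigma_sets_eq[OF sigma_algebra_path_events]
  by (subst sets_measure_of) (auto simp: path_events_def path_sets_def dest:
      sigma_sets_into_sp[rotated])

lemma space_path_space [simp]: "space path_space = space M"
  unfolding path_space_def
  by (subst space_measure_of) (auto simp: path_events_def path_sets_def dest:
      sigma_sets_into_sp[rotated])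

lemma W_path_measurable [measurable]: 
  assumes "0 \<le> s" shows "W \<gamma> s \<in> borel_measurable path_space"
proof (rule measurableI)
  fix A :: "real set" assume A: "A \<in> sets borel"
  have [measurable]: "(\<lambda>x. x s) \<in> borel_measurable (Pi\<^sub>M {0..} (\<lambda>_. borel :: real measure))"
    using assms by (intro measurable_component_singleton) auto
  have "{\<omega>\<in>space M. W \<gamma> s \<omega> \<in> A} \<in> path_sets M (W \<gamma>)"
    by (rule path_setsI[where P="\<lambda>x. x s \<in> A"]) (use A assms in \<open>measurable, auto\<close>)
  hence "{\<omega>\<in>space M. W \<gamma> s \<omega> \<in> A} \<in> path_events"
    unfolding path_events_def by (intro sigma_sets.Basic) auto
  moreover have "W \<gamma> s -` A \<inter> space path_space = {\<omega>\<in>space M. W \<gamma> s \<omega> \<in> A}" by auto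
  ultimately show "W \<gamma> s -` A \<inter> space path_space \<in> sets path_space" by (simp add: sets_path_space)
qed auto

text \<open>
  Increments of one path are independent of each other, and different paths are independent; so
  all increments of all paths are independent. Each path has its own sequence of times.
\<close>
lemma indep_increments:
  assumes J: "finite J" and a: "\<And>\<gamma>. \<gamma> \<in> J \<Longrightarrow> 0 \<le> \<phi> \<gamma> 0"
    and mono: "\<And>\<gamma> i. \<gamma> \<in> J \<Longrightarrow> i < n \<Longrightarrow> \<phi> \<gamma> i \<le> \<phi> \<gamma> (Suc i)" and ne: "J \<noteq> {}" "0 < n"
  shows "indep_vars (\<lambda>_. borel) (\<lambda>(\<gamma>, i) \<omega>. W \<gamma> (\<phi> \<gamma> (Suc i)) \<omega> - W \<gamma> (\<phi> \<gamma> i) \<omega>) (J \<times> {..<n})"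
proof -
  define Y where "Y = (\<lambda>(\<gamma>, i) \<omega>. W \<gamma> (\<phi> \<gamma> (Suc i)) \<omega> - W \<gamma> (\<phi> \<gamma> i) \<omega>)"
  have nonneg: "0 \<le> \<phi> \<gamma> i" if "\<gamma> \<in> J" "i \<le> n" for \<gamma> i
    using that(2) by (induction i) (use a[OF that(1)] mono[OF that(1)] in \<open>auto intro: order_trans\<close>)
  have Ym: "Y p \<in> borel_measurable M" if "p \<in> J \<times> {..<n}" for p
    using that unfolding Y_def by (cases p) (auto intro!: borel_measurable_diff W_measurable nonneg)
  have "indep_vars (\<lambda>_. borel) Y (J \<times> {..<n}) \<longleftrightarrow>
    (\<forall>A\<in>(\<Pi> p\<in>J \<times> {..<n}. sets borel). prob (\<Inter>p\<in>J \<times> {..<n}. Y p -` A p \<inter> space M)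
        = (\<Prod>p\<in>J \<times> {..<n}. prob (Y p -` A p \<inter> space M)))"
  proof (rule indep_vars_finite)
    show "sets borel = sigma_sets (space borel) (sets (borel :: real measure))" by
        (simp only: sets.sigma_sets_eq)
    show "sets (borel :: real measure) \<subseteq> Pow (space borel)" by (rule sets.space_closed)
  qed (use J ne Ym in \<open>auto intro: sets.Int_stable\<close>)
  also have \<dots>
  proof (intro ballI)
    fix A assume A: "A \<in> (\<Pi> p\<in>J \<times> {..<n}. sets (borel :: real measure))"
    have 1: "(\<Inter>i<n. Y (\<gamma>, i) -` A (\<gamma>, i) \<inter> space M) \<in> path_sets M (W \<gamma>)" if g: "\<gamma> \<in> J" for \<gamma>
    proof -
      have m: "(\<lambda>x. x (\<phi> \<gamma> i)) \<in> borel_measurable (Pi\<^sub>M {0..} (\<lambda>_. borel :: real measure))" if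
          "i \<le> n" for i
        using nonneg[OF g that] by (intro measurable_component_singleton) auto
      have "{\<omega>\<in>space M. \<forall>i\<in>{..<n}. Y (\<gamma>, i) \<omega> \<in> A (\<gamma>, i)} \<in> path_sets M (W \<gamma>)"
      proof (rule path_setsI[where P="\<lambda>x. \<forall>i\<in>{..<n}. x (\<phi> \<gamma> (Suc i)) - x (\<phi> \<gamma> i) \<in> A (\<gamma>, i)"])
        show "{x \<in> space (Pi\<^sub>M {0..} (\<lambda>_. borel)). \<forall>i\<in>{..<n}. x (\<phi> \<gamma> (Suc i)) - x (\<phi> \<gamma> i)
            \<in> A (\<gamma>, i)}
                 \<in> sets (Pi\<^sub>M {0..} (\<lambda>_. borel))"
        proof (rule sets.sets_Collect_finite_All)
          fix i assume i: "i \<in> {..<n}"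
          hence [measurable]: "(\<lambda>x. x (\<phi> \<gamma> i))
              \<in> borel_measurable (Pi\<^sub>M {0..} (\<lambda>_. borel :: real measure))"
             "(\<lambda>x. x (\<phi> \<gamma> (Suc i))) \<in> borel_measurable (Pi\<^sub>M {0..} (\<lambda>_. borel :: real measure))"
            by (auto intro!: m)
          have [measurable]: "A (\<gamma>, i) \<in> sets borel" using A g i by auto
          show "{x \<in> space (Pi\<^sub>M {0..} (\<lambda>_. borel)). x (\<phi> \<gamma> (Suc i)) - x (\<phi> \<gamma> i) \<in> A (\<gamma>, i)}
                 \<in> sets (Pi\<^sub>M {0..} (\<lambda>_. borel))" by measurable
        qed auto
        show "(\<forall>i\<in>{..<n}. (\<lambda>s\<in>{0..}. W \<gamma> s \<omega>) (\<phi> \<gamma> (Suc i)) - (\<lambda>s\<in>{0..}. W \<gamma> s \<omega>) (\<phi> \<gamma> i)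
            \<in> A (\<gamma>, i)) \<longleftrightarrow>
           (\<forall>i\<in>{..<n}. Y (\<gamma>, i) \<omega> \<in> A (\<gamma>, i))" for \<omega>
          using nonneg[OF g] by (intro ball_cong) (auto simp: Y_def)
      qed
      moreover have "(\<Inter>i<n. Y (\<gamma>, i) -` A (\<gamma>, i) \<inter> space M)
          = {\<omega>\<in>space M. \<forall>i\<in>{..<n}. Y (\<gamma>, i) \<omega> \<in> A (\<gamma>, i)}"
        using ne by auto
      ultimately show ?thesis by simp
    qed
    have 2: "prob (\<Inter>i<n. Y (\<gamma>, i) -` A (\<gamma>, i) \<inter> space M)
        = (\<Prod>i<n. prob (Y (\<gamma>, i) -` A (\<gamma>, i) \<inter> space M))"
      if g: "\<gamma> \<in> J" for \<gamma>
    proof -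
      have "indep_vars (\<lambda>_. borel) (\<lambda>i \<omega>. W \<gamma> (\<phi> \<gamma> (Suc i)) \<omega> - W \<gamma> (\<phi> \<gamma> i) \<omega>) {..<n}"
        by (rule sbm_indep[OF motion]) (use a mono g in auto)
      hence "indep_vars (\<lambda>_. borel) (\<lambda>i. Y (\<gamma>, i)) {..<n}" by (simp add: Y_def)
      thus ?thesis by (rule indep_varsD) (use ne A g in auto)
    qed
    have "(\<Inter>p\<in>J \<times> {..<n}. Y p -` A p \<inter> space M) = (\<Inter>\<gamma>\<in>J. \<Inter>i<n. Y (\<gamma>, i) -` A (\<gamma>, i) \<inter> space M)"
        by auto
    also have "prob \<dots> = (\<Prod>\<gamma>\<in>J. prob (\<Inter>i<n. Y (\<gamma>, i) -` A (\<gamma>, i) \<inter> space M))"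
      by (rule indep_setsD[OF indep_path_sets]) (use J ne 1 in auto)
    also have "\<dots> = (\<Prod>\<gamma>\<in>J. \<Prod>i<n. prob (Y (\<gamma>, i) -` A (\<gamma>, i) \<inter> space M))"
      by (rule prod.cong[OF refl 2])
    also have "\<dots> = (\<Prod>p\<in>J \<times> {..<n}. prob (Y p -` A p \<inter> space M))"
      by (subst prod.cartesian_product) (auto intro!: prod.cong)
    finally show "prob (\<Inter>p\<in>J \<times> {..<n}. Y p -` A p \<inter> space M)
        = (\<Prod>p\<in>J \<times> {..<n}. prob (Y p -` A p \<inter> space M))" .
  qed
  finally show ?thesis unfolding Y_def .
qed

lemma indep_weighted_increments:
  assumes J: "finite J" "J \<noteq> {}" and a: "\<And>\<gamma>. \<gamma> \<in> J \<Longrightarrow> 0 \<le> \<phi> \<gamma> 0"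
    and mono: "\<And>\<gamma> i. \<gamma> \<in> J \<Longrightarrow> i < n \<Longrightarrow> \<phi> \<gamma> i \<le> \<phi> \<gamma> (Suc i)"
  shows "indep_vars (\<lambda>_. borel) (\<lambda>i \<omega>. \<Sum>\<gamma>\<in>J. w \<gamma> * (W \<gamma> (\<phi> \<gamma> (Suc i)) \<omega> - W \<gamma> (\<phi> \<gamma> i) \<omega>)) {..<n}"
proof (cases "n = 0")
  case True
  thus ?thesis by (simp add: indep_vars_def indep_sets_def)
next
  case False
  let ?Y = "\<lambda>(\<gamma>, i) \<omega>. W \<gamma> (\<phi> \<gamma> (Suc i)) \<omega> - W \<gamma> (\<phi> \<gamma> i) \<omega>"
  have "indep_vars (\<lambda>i. PiM (J \<times> {i}) (\<lambda>_. borel)) (\<lambda>i \<omega>. restrict (\<lambda>p. ?Y p \<omega>) (J \<times> {i})) {..<n}"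
    by (rule indep_vars_restrict[OF indep_increments[OF J(1) a mono J(2)]])
       (use False in \<open>auto simp: disjoint_family_on_def\<close>)
  hence "indep_vars (\<lambda>_. borel) (\<lambda>i \<omega>. (\<lambda>x. \<Sum>\<gamma>\<in>J. w \<gamma>
      * x (\<gamma>, i)) (restrict (\<lambda>p. ?Y p \<omega>) (J \<times> {i}))) {..<n}"
    by (rule indep_vars_compose2) (auto intro!: borel_measurable_sum borel_measurable_times
        measurable_component_singleton)
  thus ?thesis by (simp cong: sum.cong)
qed

text \<open>
  Paths whose increment is trivial contribute exactly \<open>0\<close> and are dropped before summing
  independent normal variables, whose variances have to be positive.
\<close>
lemma distributed_weighted_increment:
  assumes J: "finite J" and a: "\<And>\<gamma>. \<gamma> \<in> J \<Longrightarrow> 0 \<le> a \<gamma>" "\<And>\<gamma>. \<gamma> \<in> J \<Longrightarrow> a \<gamma> \<le> b \<gamma>"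
    and w: "\<And>\<gamma>. \<gamma> \<in> J \<Longrightarrow> w \<gamma> \<noteq> 0" and pos: "(\<Sum>\<gamma>\<in>J. (w \<gamma>)\<^sup>2 * (b \<gamma> - a \<gamma>)) > 0"
  shows "distributed M lborel (\<lambda>\<omega>. \<Sum>\<gamma>\<in>J. w \<gamma> * (W \<gamma> (b \<gamma>) \<omega> - W \<gamma> (a \<gamma>) \<omega>))
     (normal_density 0 (sqrt (\<Sum>\<gamma>\<in>J. (w \<gamma>)\<^sup>2 * (b \<gamma> - a \<gamma>))))"
proof -
  define J' where "J' = {\<gamma>\<in>J. a \<gamma> < b \<gamma>}"
  have J': "finite J'" "J' \<subseteq> J" using J by (auto simp: J'_def)
  have out: "a \<gamma> = b \<gamma>" if "\<gamma> \<in> J - J'" for \<gamma> using that a(2)[of \<gamma>] by (force simp: J'_def)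
  have s1: "(\<Sum>\<gamma>\<in>J. (w \<gamma>)\<^sup>2 * (b \<gamma> - a \<gamma>)) = (\<Sum>\<gamma>\<in>J'. (w \<gamma>)\<^sup>2 * (b \<gamma> - a \<gamma>))"
    using J J' out by (intro sum.mono_neutral_right) auto
  have s2: "(\<Sum>\<gamma>\<in>J. w \<gamma> * (W \<gamma> (b \<gamma>) \<omega> - W \<gamma> (a \<gamma>) \<omega>))
      = (\<Sum>\<gamma>\<in>J'. w \<gamma> * (W \<gamma> (b \<gamma>) \<omega> - W \<gamma> (a \<gamma>) \<omega>))" for \<omega>
    using J J' out by (intro sum.mono_neutral_right) auto
  have ne: "J' \<noteq> {}" using pos unfolding s1 by auto
  let ?X = "\<lambda>\<gamma> \<omega>. w \<gamma> * (W \<gamma> (b \<gamma>) \<omega> - W \<gamma> (a \<gamma>) \<omega>)"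
  have ind: "indep_vars (\<lambda>_. borel) ?X J'"
    unfolding indep_vars_def2
  proof (intro conjI ballI)
    show "?X \<gamma> \<in> borel_measurable M" if "\<gamma> \<in> J'" for \<gamma>
      using that J' a[of \<gamma>] by (intro borel_measurable_times borel_measurable_diff W_measurable)
          auto
    show "indep_sets (\<lambda>\<gamma>. {?X \<gamma> -` A \<inter> space M |A. A \<in> sets borel}) J'"
    proof (rule indep_sets_mono_sets[OF indep_sets_mono_index[OF subset_UNIV indep_path_sets]],
        safe)
      fix \<gamma> and A :: "real set" assume g: "\<gamma> \<in> J'" and A: "A \<in> sets borel"
      have nn: "0 \<le> a \<gamma>" "0 \<le> b \<gamma>" using g J' a[of \<gamma>] by auto
      have [measurable]: "(\<lambda>x. x (a \<gamma>)) \<in> borel_measurable (Pi\<^sub>M {0..} (\<lambda>_. borel :: real measure))"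
          "(\<lambda>x. x (b \<gamma>)) \<in> borel_measurable (Pi\<^sub>M {0..} (\<lambda>_. borel :: real measure))"
        using nn by (auto intro!: measurable_component_singleton)
      have "{\<omega>\<in>space M. ?X \<gamma> \<omega> \<in> A} \<in> path_sets M (W \<gamma>)"
        by (rule path_setsI[where P="\<lambda>x. w \<gamma> * (x (b \<gamma>) - x (a \<gamma>)) \<in> A"])
            (use A nn in \<open>measurable, auto\<close>)
      also have "{\<omega>\<in>space M. ?X \<gamma> \<omega> \<in> A} = ?X \<gamma> -` A \<inter> space M" by auto
      finally show "?X \<gamma> -` A \<inter> space M \<in> path_sets M (W \<gamma>)" .
    qed
  qed
  have "distributed M lborel (\<lambda>\<omega>. \<Sum>\<gamma>\<in>J'. ?X \<gamma> \<omega>)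
     (normal_density (\<Sum>\<gamma>\<in>J'. 0) (sqrt (\<Sum>\<gamma>\<in>J'. (\<bar>w \<gamma>\<bar> * sqrt (b \<gamma> - a \<gamma>))\<^sup>2)))"
  proof (rule sum_indep_normal[OF J'(1) ne ind])
    fix \<gamma> assume g: "\<gamma> \<in> J'"
    hence g': "w \<gamma> \<noteq> 0" "0 \<le> a \<gamma>" "a \<gamma> < b \<gamma>" using w a by (auto simp: J'_def)
    thus "0 < \<bar>w \<gamma>\<bar> * sqrt (b \<gamma> - a \<gamma>)" by simp
    show "distributed M lborel (?X \<gamma>) (normal_density 0 (\<bar>w \<gamma>\<bar> * sqrt (b \<gamma> - a \<gamma>)))"
      using normal_density_affine[OF sbm_normal[OF motion g'(2,3)] _ g'(1), of 0] g' by simp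
  qed
  moreover have "(\<Sum>\<gamma>\<in>J'. (\<bar>w \<gamma>\<bar> * sqrt (b \<gamma> - a \<gamma>))\<^sup>2) = (\<Sum>\<gamma>\<in>J'. (w \<gamma>)\<^sup>2 * (b \<gamma> - a \<gamma>))"
    by (rule sum.cong) (auto simp: J'_def power_mult_distrib)
  ultimately show ?thesis unfolding s1 s2 by simp
qed

end

section \<open>Lines of descent\<close>

text \<open>
  The birth time as a function of prescribed lifetimes, so that random lifetimes can be replaced
  by fixed or rounded ones.
\<close>
primrec birth :: "(bool list \<Rightarrow> real) \<Rightarrow> bool list \<Rightarrow> real" where
  "birth l [] = 0"
| "birth l (b # \<gamma>) = birth l \<gamma> + l \<gamma>"

lemma birth_time_eq_birth: "birth_time \<tau> \<gamma> \<omega> = birth (\<lambda>\<delta>. \<tau> \<delta> \<omega>) \<gamma>"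
  by (induction \<gamma>) auto

text \<open>
  The age that a particle has reached by time \<open>t\<close>: \<open>0\<close> before its birth, and its full lifetime
  after its death.
\<close>
definition age :: "(bool list \<Rightarrow> real) \<Rightarrow> bool list \<Rightarrow> real \<Rightarrow> real" where
  "age l \<gamma> t = max 0 (min (l \<gamma>) (t - birth l \<gamma>))"

text \<open>
  The line of descent through the child \<open>b\<close> of the root and first children from then on. Labels
  grow at the front, so \<open>b\<close> stands last.
\<close>
fun lineage :: "bool \<Rightarrow> nat \<Rightarrow> bool list" where
  "lineage b 0 = []"
| "lineage b (Suc i) = replicate i False @ [b]"

lemma length_lineage [simp]: "length (lineage b i) = i"
  by (cases i) auto

lemma lineage_Suc_eq_iff: "lineage b (Suc i) = lineage b' (Suc j) \<longleftrightarrow> b = b' \<and> i = j"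
  by (metis append1_eq_conv length_lineage lineage.simps(2) nat.inject)

lemma birth_lineage_Suc: "birth l (lineage b (Suc i)) = birth l (lineage b i) + l (lineage b i)"
  by (cases i) auto

lemma birth_lineage_mono:
  assumes "\<And>\<gamma>. 0 \<le> l \<gamma>" "i \<le> j"
  shows "birth l (lineage b i) \<le> birth l (lineage b j)"
  using assms(2) by (induction rule: dec_induct)
      (use assms(1) in \<open>auto simp: birth_lineage_Suc simp del: lineage.simps intro: order_trans
      add_increasing2\<close>)

lemma birth_nonneg: "(\<And>\<gamma>. 0 \<le> l \<gamma>) \<Longrightarrow> 0 \<le> birth l \<gamma>"
  by (induction \<gamma>) auto

lemma age_nonneg: "0 \<le> age l \<gamma> t" by (simp add: age_def)

lemma age_mono: "s \<le> t \<Longrightarrow> age l \<gamma> s \<le> age l \<gamma> t" by (auto simp: age_def)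

lemma age_0: "(\<And>\<gamma>. 0 \<le> l \<gamma>) \<Longrightarrow> age l \<gamma> 0 = 0"
  using birth_nonneg[of l \<gamma>] by (auto simp: age_def)

lemma age_before_birth: "t \<le> birth l \<gamma> \<Longrightarrow> age l \<gamma> t = 0"
  by (auto simp: age_def)

lemma continuous_on_age: "continuous_on S (age l \<gamma>)"
  unfolding age_def by (intro continuous_intros)

text \<open>
  The particles of a line partition the time before the death of the last one.
\<close>
lemma sum_age_lineage:
  assumes "0 \<le> t" and l: "\<And>\<gamma>. 0 \<le> l \<gamma>"
  shows "(\<Sum>i<N. age l (lineage b i) t) = min t (birth l (lineage b N))"
proof (induction N)
  case (Suc N)
  thus ?case using l[of "lineage b N"] by (simp add: birth_lineage_Suc age_def del: lineage.simps)
qed (use assms in auto)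

definition two_lines :: "nat \<Rightarrow> bool list set" where
  "two_lines m = (\<Union>b. lineage b ` {..m})"

lemma finite_two_lines [simp]: "finite (two_lines m)"
  by (simp add: two_lines_def)

lemma two_lines_nonempty [simp]: "two_lines m \<noteq> {}"
  by (auto simp: two_lines_def)

lemma lineage_in_two_lines: "i \<le> m \<Longrightarrow> lineage b i \<in> two_lines m"
  by (auto simp: two_lines_def)

text \<open>
  The average of the two lines counts the displacement of the root, which they share, once, and
  the displacement of any other particle with weight \<open>1 / 2\<close>.
\<close>
definition line_weight :: "bool list \<Rightarrow> real" where
  "line_weight \<gamma> = (if \<gamma> = [] then 1 else 1 / 2)"

lemma two_lines_eq: "two_lines m = insert [] ((\<lambda>(b, i). lineage b (Suc i)) ` (UNIV \<times> {..<m}))"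
proof -
  have "lineage b i = [] \<or> lineage b i \<in> (\<lambda>(b, i). lineage b (Suc i)) ` (UNIV \<times> {..<m})" if
      "i \<le> m" for b i
    using that by (cases i) (auto simp del: lineage.simps(2))
  moreover have "[] \<in> two_lines m" using lineage_in_two_lines[of 0 m] by simp
  ultimately show ?thesis by (fastforce simp: two_lines_def simp del: lineage.simps(2))
qed

lemma sum_two_lines:
  fixes f :: "bool list \<Rightarrow> real"
  shows "(\<Sum>\<gamma>\<in>two_lines m. (if \<gamma> = [] then x else y) * f \<gamma>) =
     x * f [] + y * (\<Sum>b\<in>UNIV. \<Sum>i<m. f (lineage b (Suc i)))"
proof -
  have inj: "inj_on (\<lambda>(b, i). lineage b (Suc i)) (UNIV \<times> {..<m})"
    by (auto simp: inj_on_def lineage_Suc_eq_iff simp del: lineage.simps(2))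
  have ne: "lineage b (Suc i) \<noteq> []" for b i by simp
  have "(\<Sum>\<gamma>\<in>two_lines m. (if \<gamma> = [] then x else y) * f \<gamma>) =
     x * f [] + (\<Sum>\<gamma>\<in>(\<lambda>(b, i). lineage b (Suc i)) ` (UNIV \<times> {..<m}). (if \<gamma> = [] then x else y)
         * f \<gamma>)"
    unfolding two_lines_eq by (subst sum.insert) auto
  also have "(\<Sum>\<gamma>\<in>(\<lambda>(b, i). lineage b (Suc i)) ` (UNIV \<times> {..<m}). (if \<gamma> = [] then x else y) * f \<gamma>) =
     (\<Sum>(b, i)\<in>UNIV \<times> {..<m}. y * f (lineage b (Suc i)))"
    by (subst sum.reindex[OF inj]) (auto intro!: sum.cong)
  also have "\<dots> = y * (\<Sum>b\<in>UNIV. \<Sum>i<m. f (lineage b (Suc i)))"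
    by (simp add: sum.cartesian_product[symmetric] sum_distrib_left del: lineage.simps)
  finally show ?thesis .
qed

lemma sum_two_lines_average:
  fixes f :: "bool list \<Rightarrow> real"
  shows "(\<Sum>\<gamma>\<in>two_lines m. line_weight \<gamma> * f \<gamma>) = (\<Sum>b\<in>UNIV. \<Sum>i<Suc m. f (lineage b i)) / 2"
  unfolding line_weight_def sum_two_lines sum.lessThan_Suc_shift
  by (simp add: UNIV_bool field_simps del: lineage.simps(2))

text \<open>
  Up to the split the lines share one motion; after it the weights \<open>1 / 4\<close> of two independent
  motions add up to half the elapsed time. The hypothesis on \<open>T\<close> says that generation \<open>m\<close> of
  either line outlives \<open>T\<close>.
\<close>
lemma sum_two_lines_variance:
  assumes l: "\<And>\<gamma>. 0 \<le> l \<gamma>" and t: "0 \<le> t" "t \<le> T" and T: "\<And>b. T < birth l (lineage b (Suc m))"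
  shows "(\<Sum>\<gamma>\<in>two_lines m. (line_weight \<gamma>)\<^sup>2 * age l \<gamma> t) = (t + min (l []) t) / 2"
proof -
  have "(\<Sum>i<Suc m. age l (lineage b i) t) = t" for b
    unfolding sum_age_lineage[OF t(1) l] using T[of b] t by simp
  hence *: "(\<Sum>i<m. age l (lineage b (Suc i)) t) = t - age l [] t" for b
    unfolding sum.lessThan_Suc_shift lineage.simps(1) by
        (simp add: algebra_simps del: lineage.simps(2))
  have "age l [] t = min (l []) t" using l[of "[]"] t by (simp add: age_def)
  moreover have "(line_weight \<gamma>)\<^sup>2 = (if \<gamma> = [] then 1 else 1 / 4)" for \<gamma>
    by (simp add: line_weight_def power2_eq_square)
  ultimately show ?thesis
    using sum_two_lines[of 1 "1/4" "\<lambda>\<gamma>. age l \<gamma> t" m]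
    by (simp add: * UNIV_bool field_simps del: lineage.simps(2))
qed

text \<open>
  A line that lasts beyond \<open>t\<close> has a particle alive at \<open>t\<close>. Its position is the sum of the
  displacements along the line: the earlier particles have completed their lifetimes, the later
  ones have not moved yet.
\<close>
lemma lineage_position:
  assumes pos: "\<And>\<gamma>. 0 < \<tau> \<gamma> \<omega>" and W0: "\<And>\<gamma>. W \<gamma> 0 \<omega> = 0"
    and t: "0 \<le> t" "t < birth (\<lambda>\<gamma>. \<tau> \<gamma> \<omega>) (lineage b N)"
  shows "\<exists>\<gamma>\<in>alive \<tau> t \<omega>. (\<Sum>i<N. W (lineage b i) (age (\<lambda>\<gamma>. \<tau> \<gamma> \<omega>) (lineage b i) t) \<omega>)
      = position \<tau> W \<gamma> t \<omega>"
proof -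
  define l where "l = (\<lambda>\<gamma>. \<tau> \<gamma> \<omega>)"
  have l0: "0 \<le> l \<gamma>" for \<gamma> using pos[of \<gamma>] by (simp add: l_def)
  \<comment> \<open>The generation that is alive on the line at time \<open>t\<close>.\<close>
  define k where "k = (LEAST k. t < birth l (lineage b (Suc k)))"
  have N: "N \<noteq> 0" using t by (cases N) auto
  hence N1: "t < birth l (lineage b (Suc (N - 1)))" using t by (simp add: l_def del: lineage.simps)
  have k1: "t < birth l (lineage b (Suc k))" unfolding k_def by
      (rule LeastI[where P="\<lambda>k. t < birth l (lineage b (Suc k))", OF N1])
  have "k \<le> N - 1" unfolding k_def by
      (rule Least_le[where P="\<lambda>k. t < birth l (lineage b (Suc k))", OF N1])
  hence kN: "k < N" using N by simp
  have k2: "birth l (lineage b k) \<le> t"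
  proof (cases k)
    case (Suc j)
    thus ?thesis using not_less_Least[of j "\<lambda>k. t < birth l (lineage b (Suc k))"] by
        (auto simp: k_def simp del: lineage.simps)
  qed (use t in auto)
  have alive: "lineage b k \<in> alive \<tau> t \<omega>"
    using k1 k2 by (simp add: alive_def birth_time_eq_birth birth_lineage_Suc l_def[symmetric]
        del: lineage.simps) (simp add: l_def)
  have place: "birth_place \<tau> W (lineage b j) \<omega> = (\<Sum>i<j. W (lineage b i) (l (lineage b i)) \<omega>)" for j
  proof (induction j)
    case (Suc j)
    have "birth_place \<tau> W (lineage b (Suc j)) \<omega> = birth_place \<tau> W (lineage b j) \<omega>
        + W (lineage b j) (\<tau> (lineage b j) \<omega>) \<omega>"
      by (cases j) auto
    thus ?case using Suc by (simp add: l_def)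
  qed auto
  have "(\<Sum>i<N. W (lineage b i) (age l (lineage b i) t) \<omega>)
      = (\<Sum>i<Suc k. W (lineage b i) (age l (lineage b i) t) \<omega>)"
  proof (rule sum.mono_neutral_right)
    show "\<forall>i\<in>{..<N} - {..<Suc k}. W (lineage b i) (age l (lineage b i) t) \<omega> = 0"
    proof
      fix i assume "i \<in> {..<N} - {..<Suc k}"
      hence "birth l (lineage b (Suc k)) \<le> birth l (lineage b i)" by
          (intro birth_lineage_mono l0) auto
      thus "W (lineage b i) (age l (lineage b i) t) \<omega> = 0" using k1 by
          (simp add: age_before_birth W0)
    qed
  qed (use kN in auto)
  also have "\<dots> = (\<Sum>i<k. W (lineage b i) (age l (lineage b i) t) \<omega>)
      + W (lineage b k) (age l (lineage b k) t) \<omega>"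
    by simp
  also have "(\<Sum>i<k. W (lineage b i) (age l (lineage b i) t) \<omega>)
      = (\<Sum>i<k. W (lineage b i) (l (lineage b i)) \<omega>)"
  proof (rule sum.cong[OF refl])
    fix i assume "i \<in> {..<k}"
    hence "birth l (lineage b (Suc i)) \<le> birth l (lineage b k)" by
        (intro birth_lineage_mono l0) auto
    hence "age l (lineage b i) t = l (lineage b i)"
      using k2 l0[of "lineage b i"] unfolding birth_lineage_Suc age_def by linarith
    thus "W (lineage b i) (age l (lineage b i) t) \<omega> = W (lineage b i) (l (lineage b i)) \<omega>" by simp
  qed
  also have "age l (lineage b k) t = t - birth l (lineage b k)"
    using k1 k2 unfolding birth_lineage_Suc age_def by linarith
  finally show ?thesis
    by (intro bexI[OF _ alive]) (simp add: position_def place birth_time_eq_birth l_def)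
qed

context branching_brownian_motion begin

definition line_average :: "nat \<Rightarrow> (bool list \<Rightarrow> real) \<Rightarrow> real \<Rightarrow> 'a \<Rightarrow> real" where
  "line_average m l t \<omega> = (\<Sum>\<gamma>\<in>two_lines m. line_weight \<gamma> * W \<gamma> (age l \<gamma> t) \<omega>)"

lemma line_average_measurable: "line_average m l t \<in> borel_measurable M"
  unfolding line_average_def by (intro borel_measurable_sum borel_measurable_times W_measurable
      age_nonneg) auto

lemma line_average_path_measurable: "line_average m l t \<in> borel_measurable path_space"
  unfolding line_average_def by (intro borel_measurable_sum borel_measurable_times
      W_path_measurable age_nonneg) auto

lemma line_average_start: "(\<And>\<gamma>. 0 \<le> l \<gamma>) \<Longrightarrow> AE \<omega> in M. line_average m l 0 \<omega> = 0"
proof -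
  assume l: "\<And>\<gamma>. 0 \<le> l \<gamma>"
  have "AE \<omega> in M. \<forall>\<gamma>\<in>two_lines m. W \<gamma> 0 \<omega> = 0"
    by (rule AE_finite_allI) (auto intro: sbm_start[OF motion])
  thus ?thesis by eventually_elim (simp add: line_average_def age_0[of l, OF l])
qed

lemma line_average_increment:
  assumes l: "\<And>\<gamma>. 0 \<le> l \<gamma>" and T: "\<And>b. T < birth l (lineage b (Suc m))" and st: "0 \<le> s" "s < t"
      "t \<le> T"
  shows "distributed M lborel (\<lambda>\<omega>. line_average m l t \<omega> - line_average m l s \<omega>)
     (normal_density 0 (sqrt ((t + min (l []) t) / 2 - (s + min (l []) s) / 2)))"
proof -
  have *: "(\<Sum>\<gamma>\<in>two_lines m. (line_weight \<gamma>)\<^sup>2 * (age l \<gamma> t - age l \<gamma> s)) = (t + min (l []) t) / 2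
      - (s + min (l []) s) / 2"
    unfolding right_diff_distrib sum_subtractf
    using st by (subst (1 2) sum_two_lines_variance[OF l _ _ T]) auto
  have "distributed M lborel (\<lambda>\<omega>. \<Sum>\<gamma>\<in>two_lines m. line_weight \<gamma>
      * (W \<gamma> (age l \<gamma> t) \<omega> - W \<gamma> (age l \<gamma> s) \<omega>))
     (normal_density 0 (sqrt (\<Sum>\<gamma>\<in>two_lines m. (line_weight \<gamma>)\<^sup>2 * (age l \<gamma> t - age l \<gamma> s))))"
  proof (rule distributed_weighted_increment)
    show "(\<Sum>\<gamma>\<in>two_lines m. (line_weight \<gamma>)\<^sup>2 * (age l \<gamma> t - age l \<gamma> s)) > 0"
      unfolding * using st by (auto simp: min_def)
  qed (use st in \<open>auto simp: age_nonneg line_weight_def intro: age_mono\<close>)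
  thus ?thesis unfolding * by (simp add: line_average_def sum_subtractf right_diff_distrib)
qed

text \<open>
  The variance of the average grows at least at rate \<open>1 / 2\<close>, so that over a stretch \<open>x\<close> the drift
  is at most \<open>\<bar>c\<bar> * x / sqrt (x / 2) = \<bar>c\<bar> * sqrt (2 * x)\<close> standard deviations of the increment.
\<close>
lemma prob_line_average_exceeds_le:
  assumes l: "\<And>\<gamma>. 0 \<le> l \<gamma>" and T: "\<And>b. T < birth l (lineage b (Suc m))" "0 < T"
  shows "gauss_tail (\<bar>c\<bar> * sqrt (2 * T)) *
      \<P>(\<omega> in M. \<exists>k\<in>{1..Suc (2 ^ n)}. line_average m l (grid 0 T n k) \<omega> - c * grid 0 T n k > u)
    \<le> gauss_tail ((u + c * T) / sqrt ((T + min (l []) T) / 2))"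
proof -
  let ?a = "gauss_tail (\<bar>c\<bar> * sqrt (2 * T))"
  let ?N = "Suc (2 ^ n)"
  let ?g = "grid 0 T n"
  have "?a * \<P>(\<omega> in M. \<exists>k\<in>{1..?N}. line_average m l (?g k) \<omega> - c * ?g k > u)
     \<le> \<P>(\<omega> in M. line_average m l (?g ?N) \<omega> - c * ?g ?N > u)"
  proof (rule prob_grid_exceeds_le)
    show "indep_vars (\<lambda>_. borel) (\<lambda>i \<omega>. line_average m l (?g (Suc i)) \<omega>
        - line_average m l (?g i) \<omega>) {..<?N}"
      using indep_weighted_increments[of "two_lines m" "\<lambda>\<gamma> i. age l \<gamma> (?g i)" ?N line_weight] T(2)
      by (simp add: age_nonneg age_mono grid_mono line_average_def sum_subtractf right_diff_distrib)
    fix k assume k: "k \<in> {1..?N}"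
    show "?a \<le> \<P>(\<omega> in M. line_average m l (?g ?N) \<omega> - line_average m l (?g k) \<omega> \<ge> c
        * (?g ?N - ?g k))"
    proof (cases "?g k = T")
      case True
      thus ?thesis by (simp add: prob_space gauss_tail_le_1)
    next
      case False
      define s where "s = ?g k"
      have s: "0 \<le> s" "s < T" using False k T(2) grid_le[of 0 T k n] grid_nonneg[of 0 T n k] by
          (auto simp: s_def)
      define v where "v = (T + min (l []) T) / 2 - (s + min (l []) s) / 2"
      have "min (l []) s \<le> min (l []) T" using s by auto
      moreover have "(T - s) / 2 \<le> (T + y) / 2 - (s + x) / 2" if "x \<le> y" for x y :: real
        using that by (simp add: field_simps)
      ultimately have v: "(T - s) / 2 \<le> v" unfolding v_def by blast
      have "c * (T - s) / sqrt v \<le> \<bar>c\<bar> * (T - s) / sqrt ((T - s) / 2)"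
        using s v by (intro frac_le mult_right_mono) auto
      also have "\<dots> = \<bar>c\<bar> * sqrt (2 * (T - s))"
      proof -
        have "x / sqrt (x / 2) = sqrt (2 * x)" if "0 < x" for x :: real
        proof -
          have "sqrt (2 * x) = sqrt (4 * (x / 2))" by simp
          also have "\<dots> = 2 * sqrt (x / 2)" by (subst real_sqrt_mult) simp
          also have "\<dots> = 2 * (x / 2 / sqrt (x / 2))" using that by (subst real_div_sqrt) auto
          finally show ?thesis by simp
        qed
        from this[of "T - s"] s show ?thesis by (metis diff_gt_0_iff_gt times_divide_eq_right)
      qed
      also have "\<dots> \<le> \<bar>c\<bar> * sqrt (2 * T)" using s by (intro mult_left_mono) auto
      finally have "?a \<le> gauss_tail (c * (T - s) / sqrt v)" by (rule gauss_tail_antimono)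
      also have "\<dots> \<le> \<P>(\<omega> in M. line_average m l T \<omega> - line_average m l s \<omega> \<ge> c * (T - s))"
        unfolding v_def using s v[unfolded v_def]
        by (intro prob_normal_ge line_average_increment[OF l T(1)]) auto
      finally show ?thesis by (simp add: s_def)
    qed
  qed (use line_average_start[OF l] in \<open>auto intro: line_average_measurable\<close>)
  also have "\<dots> = \<P>(\<omega> in M. line_average m l T \<omega> - line_average m l 0 \<omega> > u + c * T)"
    using line_average_start[of l m, OF l]
    by (intro measure_eq_AE) (auto intro!: borel_measurable_less borel_measurable_diff
        line_average_measurable)
  also have "\<dots> = gauss_tail ((u + c * T) / sqrt ((T + min (l []) T) / 2 - (0 + min (l []) 0) / 2))"
    using T l[of "[]"] by (intro prob_normal_greater line_average_increment l)
        (auto simp: min_def add_pos_nonneg)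
  finally show ?thesis using l[of "[]"] by simp
qed

end

section \<open>Almost sure regularity of the population\<close>

primrec strict_ancestors :: "bool list \<Rightarrow> bool list set" where
  "strict_ancestors [] = {}"
| "strict_ancestors (b # \<gamma>) = insert \<gamma> (strict_ancestors \<gamma>)"

lemma length_strict_ancestors: "\<delta> \<in> strict_ancestors \<gamma> \<Longrightarrow> length \<delta> < length \<gamma>"
  by (induction \<gamma>) auto

lemma finite_strict_ancestors [simp]: "finite (strict_ancestors \<gamma>)"
  by (induction \<gamma>) auto

lemma not_strict_ancestor_self: "\<gamma> \<notin> strict_ancestors \<gamma>"
  using length_strict_ancestors by blast

lemma card_strict_ancestors: "card (strict_ancestors \<gamma>) = length \<gamma>"
  by (induction \<gamma>) (auto simp: not_strict_ancestor_self)

lemma birth_time_eq_sum: "birth_time \<tau> \<gamma> \<omega> = (\<Sum>\<delta>\<in>strict_ancestors \<gamma>. \<tau> \<delta> \<omega>)"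
  by (induction \<gamma>) (auto simp: not_strict_ancestor_self)

lemma birth_drop_le: "(\<And>\<gamma>. 0 \<le> l \<gamma>) \<Longrightarrow> birth l (drop k \<gamma>) \<le> birth l \<gamma>"
proof (induction \<gamma> arbitrary: k)
  case (Cons b \<gamma>)
  show ?case
  proof (cases k)
    case (Suc j)
    thus ?thesis using Cons.IH[of j] Cons.prems[of \<gamma>] by
        (auto simp: Cons.prems intro: add_increasing2)
  qed auto
qed auto

context branching_brownian_motion begin

lemma birth_time_measurable [measurable]: "birth_time \<tau> \<gamma> \<in> borel_measurable M"
  unfolding birth_time_eq_sum[abs_def] by measurable

text \<open>
  The Laplace transform \<open>1 / (1 + \<theta>)\<close> of the exponential distribution at \<open>\<theta> = 2\<close>. Any \<open>\<theta> > 1\<close>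
  would do: the \<open>2 ^ n\<close> particles of generation \<open>n\<close> have to be outweighed by \<open>(1 + \<theta>) ^ n\<close>.
\<close>
lemma nn_integral_exp_lifetime: "(\<integral>\<^sup>+\<omega>. ennreal (exp (- 2 * \<tau> \<gamma> \<omega>)) \<partial>M) = ennreal (1 / 3)"
proof -
  have "(\<integral>\<^sup>+\<omega>. ennreal (exp (- 2 * \<tau> \<gamma> \<omega>)) \<partial>M)
      = (\<integral>\<^sup>+x. ennreal (exponential_density 1 x) * ennreal (exp (- 2 * x)) \<partial>lborel)"
    by (rule distributed_nn_integral[OF lifetime, symmetric]) auto
  also have "\<dots> = (\<integral>\<^sup>+x. ennreal (1 / 3) * ennreal (exponential_density 3 x) \<partial>lborel)"
    by (intro nn_integral_cong) (auto simp: exponential_density_def ennreal_mult[symmetric] simp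
        flip: exp_add)
  also have "\<dots> = ennreal (1 / 3) * (\<integral>\<^sup>+x. ennreal (exponential_density 3 x) \<partial>lborel)"
    by (rule nn_integral_cmult) auto
  also have "(\<integral>\<^sup>+x. ennreal (exponential_density 3 x) \<partial>lborel) = 1"
  proof -
    interpret E: prob_space "density lborel (exponential_density 3)"
      by (rule prob_space_exponential_density) auto
    show ?thesis using E.emeasure_space_1 by (simp add: emeasure_density)
  qed
  finally show ?thesis by simp
qed

lemma emeasure_birth_time_le:
  "emeasure M {\<omega>\<in>space M. birth_time \<tau> \<gamma> \<omega> \<le> T} \<le> ennreal (exp (2 * T) * (1 / 3) ^ length \<gamma>)"
proof -
  let ?A = "strict_ancestors \<gamma>"
  have ind: "indep_vars (\<lambda>_. borel) (\<lambda>\<delta> \<omega>. ennreal (exp (- 2 * \<tau> \<delta> \<omega>))) ?A"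
    by (rule indep_vars_compose2[OF indep_vars_subset[OF indep_vars_tau subset_UNIV], where
        Y="\<lambda>_ x. ennreal (exp (- 2 * x))"]) auto
  have "emeasure M {\<omega>\<in>space M. birth_time \<tau> \<gamma> \<omega> \<le> T}
      = (\<integral>\<^sup>+\<omega>. indicator {\<omega>\<in>space M. birth_time \<tau> \<gamma> \<omega> \<le> T} \<omega> \<partial>M)"
    by (rule nn_integral_indicator[symmetric]) measurable
  \<comment> \<open>Markov's inequality for \<open>exp (- 2 * birth_time \<tau> \<gamma> \<omega>)\<close>.\<close>
  also have "\<dots> \<le> (\<integral>\<^sup>+\<omega>. ennreal (exp (2 * T)) * (\<Prod>\<delta>\<in>?A. ennreal (exp (- 2 * \<tau> \<delta> \<omega>))) \<partial>M)"
  proof (rule nn_integral_mono)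
    fix \<omega>
    have "ennreal (exp (2 * T)) * (\<Prod>\<delta>\<in>?A. ennreal (exp (- 2 * \<tau> \<delta> \<omega>)))
        = ennreal (exp (2 * T - 2 * birth_time \<tau> \<gamma> \<omega>))"
      by (simp add: birth_time_eq_sum prod_ennreal exp_sum[symmetric] ennreal_mult[symmetric]
          exp_add[symmetric] sum_negf sum_distrib_left)
    thus "indicator {\<omega>\<in>space M. birth_time \<tau> \<gamma> \<omega> \<le> T} \<omega> \<le> ennreal (exp (2 * T))
        * (\<Prod>\<delta>\<in>?A. ennreal (exp (- 2 * \<tau> \<delta> \<omega>)))"
      by (auto simp: indicator_def)
  qed
  also have "\<dots> = ennreal (exp (2 * T)) * (\<integral>\<^sup>+\<omega>. (\<Prod>\<delta>\<in>?A. ennreal (exp (- 2 * \<tau> \<delta> \<omega>))) \<partial>M)"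
    by (rule nn_integral_cmult) auto
  also have "(\<integral>\<^sup>+\<omega>. (\<Prod>\<delta>\<in>?A. ennreal (exp (- 2 * \<tau> \<delta> \<omega>))) \<partial>M)
      = (\<Prod>\<delta>\<in>?A. \<integral>\<^sup>+\<omega>. ennreal (exp (- 2 * \<tau> \<delta> \<omega>)) \<partial>M)"
    by (rule indep_vars_nn_integral[OF _ ind]) auto
  also have "\<dots> = ennreal ((1 / 3) ^ length \<gamma>)"
    unfolding nn_integral_exp_lifetime by (simp add: card_strict_ancestors ennreal_power)
  finally show ?thesis by (simp add: ennreal_mult)
qed

text \<open>
  By a union bound, some member of generation \<open>n\<close> is born by time \<open>T\<close> with probability at most
  \<open>exp (2 * T) * (2 / 3) ^ n\<close>, which tends to \<open>0\<close>.
\<close>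
lemma AE_finitely_many_born:
  "AE \<omega> in M. \<exists>n. \<forall>\<gamma>. length \<gamma> = n \<longrightarrow> T < birth_time \<tau> \<gamma> \<omega>"
proof -
  let ?A = "\<lambda>n. \<Union>\<gamma>\<in>{\<gamma>. length \<gamma> = n}. {\<omega>\<in>space M. birth_time \<tau> \<gamma> \<omega> \<le> T}"
  have fin: "finite {\<gamma> :: bool list. length \<gamma> = n}" for n
      using finite_lists_length_eq[of "UNIV :: bool set" n] by simp
  have Am: "?A n \<in> sets M" for n using fin by (intro sets.finite_UN) auto
  have bound: "emeasure M (?A n) \<le> ennreal (exp (2 * T) * (2 / 3) ^ n)" for n
  proof -
    have "emeasure M (?A n) \<le> (\<Sum>\<gamma>\<in>{\<gamma>. length \<gamma> = n}. emeasure M {\<omega>\<in>space M. birth_time \<tau> \<gamma> \<omega> \<le> T})"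
      using fin by (intro emeasure_subadditive_finite) auto
    also have "\<dots> \<le> (\<Sum>\<gamma>\<in>{\<gamma> :: bool list. length \<gamma> = n}. ennreal (exp (2 * T) * (1 / 3) ^ n))"
      by (intro sum_mono order_trans[OF emeasure_birth_time_le]) auto
    also have "\<dots> = ennreal (2 ^ n * (exp (2 * T) * (1 / 3) ^ n))"
      using card_lists_length_eq[of "UNIV :: bool set" n]
      by (subst ennreal_mult) (auto simp: ennreal_of_nat_eq_real_of_nat)
    also have "2 ^ n * (exp (2 * T) * (1 / 3) ^ n) = exp (2 * T) * (2 / 3) ^ n"
      by (simp add: power_divide)
    finally show ?thesis .
  qed
  have "emeasure M (\<Inter>n. ?A n) \<le> 0"
  proof (rule LIMSEQ_le_const)
    have "(\<lambda>n. exp (2 * T) * (2 / 3) ^ n) \<longlonglongrightarrow> 0" by real_asymp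
    from tendsto_ennrealI[OF this] show "(\<lambda>n. ennreal (exp (2 * T) * (2 / 3) ^ n)) \<longlonglongrightarrow> 0" by simp
    show "\<exists>N. \<forall>n\<ge>N. emeasure M (\<Inter>n. ?A n) \<le> ennreal (exp (2 * T) * (2 / 3) ^ n)"
      using Am by (intro exI[of _ 0] allI impI order_trans[OF emeasure_mono bound]) auto
  qed
  hence null: "(\<Inter>n. ?A n) \<in> null_sets M" using Am by (intro null_setsI) auto
  show ?thesis
    by (rule AE_I'[OF null]) (auto simp: not_less)
qed

lemma AE_lifetime_pos: "AE \<omega> in M. 0 < \<tau> \<gamma> \<omega>"
proof -
  have "AE x in lborel. x \<noteq> (0::real)" by (rule AE_lborel_singleton)
  hence "AE x in lborel. 0 < exponential_density 1 x \<longrightarrow> 0 < x"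
    by eventually_elim (auto simp: exponential_density_def split: if_splits)
  thus ?thesis by (subst distributed_AE2[OF lifetime]) auto
qed

text \<open>
  A whole generation born after \<open>T\<close> expresses that the population does not explode before \<open>T\<close>,
  since birth times increase along lines of descent.
\<close>
definition regular :: "real \<Rightarrow> 'a \<Rightarrow> bool" where
  "regular T \<omega> \<longleftrightarrow> (\<forall>\<gamma>. 0 < \<tau> \<gamma> \<omega> \<and> W \<gamma> 0 \<omega> = 0 \<and> continuous_on {0..} (\<lambda>t. W \<gamma> t \<omega>)) \<and>
     (\<exists>n. \<forall>\<gamma>. length \<gamma> = n \<longrightarrow> T < birth_time \<tau> \<gamma> \<omega>)"

lemma AE_regular: "AE \<omega> in M. regular T \<omega>"
  unfolding regular_def AE_conj_iff AE_all_countable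
  using AE_lifetime_pos sbm_start[OF motion] sbm_continuous[OF motion] AE_finitely_many_born by auto

lemma regular_birth_le_drop: "regular T \<omega> \<Longrightarrow> birth_time \<tau> (drop k \<gamma>) \<omega> \<le> birth_time \<tau> \<gamma> \<omega>"
  unfolding birth_time_eq_birth by (rule birth_drop_le) (auto simp: regular_def intro: less_imp_le)

lemma regular_finite_born:
  assumes "regular T \<omega>"
  shows "finite {\<gamma>. birth_time \<tau> \<gamma> \<omega> \<le> T}"
proof -
  obtain n where n: "\<And>\<gamma>. length \<gamma> = n \<Longrightarrow> T < birth_time \<tau> \<gamma> \<omega>" using assms by
      (auto simp: regular_def)
  have "{\<gamma>. birth_time \<tau> \<gamma> \<omega> \<le> T} \<subseteq> {\<gamma>. set \<gamma> \<subseteq> UNIV \<and> length \<gamma> \<le> n}"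
  proof safe
    fix \<gamma> assume *: "birth_time \<tau> \<gamma> \<omega> \<le> T"
    show "length \<gamma> \<le> n"
    proof (rule ccontr)
      assume "\<not> length \<gamma> \<le> n"
      hence "T < birth_time \<tau> (drop (length \<gamma> - n) \<gamma>) \<omega>" by (intro n) auto
      thus False using regular_birth_le_drop[OF assms, of "length \<gamma> - n" \<gamma>] * by simp
    qed
  qed auto
  moreover have "finite {\<gamma>. set \<gamma> \<subseteq> (UNIV :: bool set) \<and> length \<gamma> \<le> n}"
    by (rule finite_lists_length_le) auto
  ultimately show ?thesis by (rule finite_subset)
qed

text \<open>
  A particle alive at \<open>s\<close> but not at \<open>t\<close> would descend from one that is alive at \<open>t\<close> and dies in
  between.
\<close>
lemma regular_alive_mono:
  assumes r: "regular T \<omega>" and t: "0 \<le> t" and s: "\<And>\<gamma>. \<gamma> \<in> alive \<tau> t \<omega> \<Longrightarrow> \<gamma> \<in> alive \<tau> s \<omega>"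
      and ts: "t \<le> s"
  shows "alive \<tau> s \<omega> \<subseteq> alive \<tau> t \<omega>"
proof -
  have pos: "0 < \<tau> \<gamma> \<omega>" for \<gamma> using r by (simp add: regular_def)
  \<comment> \<open>Induction along the line of descent, from the root on.\<close>
  have born: "birth_time \<tau> \<gamma> \<omega> \<le> t" if "birth_time \<tau> \<gamma> \<omega> \<le> s" for \<gamma>
    using that
  proof (induction \<gamma>)
    case (Cons b \<gamma>)
    hence le: "birth_time \<tau> \<gamma> \<omega> \<le> t" using pos[of \<gamma>] by auto
    show ?case
    proof (rule ccontr)
      assume "\<not> birth_time \<tau> (b # \<gamma>) \<omega> \<le> t"
      hence "\<gamma> \<in> alive \<tau> t \<omega>" using le by (simp add: alive_def)
      hence "\<gamma> \<in> alive \<tau> s \<omega>" by (rule s)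
      thus False using Cons.prems by (simp add: alive_def)
    qed
  qed (use t in auto)
  show ?thesis using born ts by (auto simp: alive_def)
qed

text \<open>
  The finitely many particles alive at \<open>t\<close> live on for a while and stay above the line by
  right-continuity, and no others appear meanwhile; so any dyadic time soon after \<open>t\<close> serves as
  well. At \<open>t = T\<close> no later time in \<open>[0, T]\<close> is left, but \<open>T\<close> is itself a grid point.
\<close>
lemma regular_dyadic_time:
  assumes r: "regular T \<omega>" and T: "0 < T" and t: "t \<in> {0..T}"
    and above: "\<And>\<gamma>. \<gamma> \<in> alive \<tau> t \<omega> \<Longrightarrow> position \<tau> W \<gamma> t \<omega> - c * t > u"
  shows "\<exists>m. \<exists>k\<in>{1..Suc (2 ^ m)}. \<forall>\<gamma>\<in>alive \<tau> (grid 0 T m k) \<omega>. position \<tau> W \<gamma> (grid 0 T m k) \<omega>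
      - c * grid 0 T m k > u"
proof (cases "t = T")
  case True
  thus ?thesis using above by (intro exI[of _ 0] bexI[of _ "Suc (2 ^ 0)"]) (auto simp: grid_def)
next
  case False
  have fin: "finite (alive \<tau> t \<omega>)"
    by (rule finite_subset[OF _ regular_finite_born[OF r]]) (use t in \<open>auto simp: alive_def\<close>)
  have "eventually (\<lambda>s. \<forall>\<gamma>\<in>alive \<tau> t \<omega>. \<gamma> \<in> alive \<tau> s \<omega> \<and> position \<tau> W \<gamma> s \<omega> - c * s
      > u) (at_right t)"
  proof (rule eventually_ball_finite[OF fin], intro ballI)
    fix \<gamma> assume g: "\<gamma> \<in> alive \<tau> t \<omega>"
    let ?b = "birth_time \<tau> \<gamma> \<omega>"
    have b: "?b \<le> t" "t < ?b + \<tau> \<gamma> \<omega>" using g by (auto simp: alive_def)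
    have "eventually (\<lambda>s. s \<in> {t<..<?b + \<tau> \<gamma> \<omega>}) (at_right t)"
      by (rule eventually_at_right_real[OF b(2)])
    moreover have "eventually (\<lambda>s. position \<tau> W \<gamma> s \<omega> - c * s > u) (at_right t)"
    proof (rule order_tendstoD(1)[OF _ above[OF g]])
      have c: "continuous_on {0..} (\<lambda>t. W \<gamma> t \<omega>)" using r by (simp add: regular_def)
      have "continuous_on {?b..} (\<lambda>s. position \<tau> W \<gamma> s \<omega> - c * s)"
        unfolding position_def
        by (intro continuous_intros continuous_on_compose2[OF c]) auto
      hence "((\<lambda>s. position \<tau> W \<gamma> s \<omega> - c * s) \<longlongrightarrow> position \<tau> W \<gamma> t \<omega> - c * t) (at t within {?b..})"
        using b(1) unfolding continuous_on_def by auto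
      thus "((\<lambda>s. position \<tau> W \<gamma> s \<omega> - c * s) \<longlongrightarrow> position \<tau> W \<gamma> t \<omega> - c * t) (at_right t)"
        by (rule tendsto_within_subset) (use b(1) in auto)
    qed
    ultimately show "eventually (\<lambda>s. \<gamma> \<in> alive \<tau> s \<omega> \<and> position \<tau> W \<gamma> s \<omega> - c * s > u) (at_right t)"
      by eventually_elim (use b in \<open>auto simp: alive_def\<close>)
  qed
  moreover have "eventually (\<lambda>s. s \<in> {t<..<T}) (at_right t)"
    using False t by (intro eventually_at_right_real) auto
  ultimately have "eventually (\<lambda>s. (\<forall>\<gamma>\<in>alive \<tau> t \<omega>. \<gamma> \<in> alive \<tau> s \<omega> \<and> position \<tau> W \<gamma> s \<omega> - c * s
      > u) \<and> s \<in> {t<..<T}) (at_right t)"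
    by (rule eventually_conj)
  then obtain d where d: "t < d" "\<And>s. t < s \<Longrightarrow> s < d
      \<Longrightarrow> (\<forall>\<gamma>\<in>alive \<tau> t \<omega>. \<gamma> \<in> alive \<tau> s \<omega> \<and> position \<tau> W \<gamma> s \<omega> - c * s > u) \<and> s \<in> {t<..<T}"
    unfolding eventually_at_right_field by blast
  define e where "e = (min d T - t) / 2"
  have e: "e > 0" using d(1) False t by (auto simp: e_def)
  \<comment> \<open>A tent function whose positivity set is the open interval of radius \<open>e / 2\<close> around \<open>t + e\<close>,
    the midpoint of \<open>t\<close> and \<open>min d T\<close>.\<close>
  have dy: "\<exists>j. \<exists>i\<le>2 ^ j. e / 2 - \<bar>0 + (T - 0) * (real i / 2 ^ j) - (t + e)\<bar> > 0"
    by (rule dyadic_point_exceeds[where t="t + e"])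
        (use e t T in \<open>auto intro!: continuous_intros simp: e_def min_def field_simps\<close>)
  then obtain j i where ij: "i \<le> 2 ^ j" "\<bar>T * (real i / 2 ^ j) - (t + e)\<bar> < e / 2" by auto
  define s where "s = grid 0 T j (Suc i)"
  have "s = T * (real i / 2 ^ j)" by (simp add: s_def grid_def)
  hence "\<bar>s - (t + e)\<bar> < e / 2" using ij by simp
  moreover have "t + 2 * e \<le> d" by (auto simp: e_def min_def field_simps)
  ultimately have s: "t < s" "s < d" using e by linarith+
  have "alive \<tau> s \<omega> \<subseteq> alive \<tau> t \<omega>"
    by (rule regular_alive_mono[OF r]) (use d(2)[OF s] s t in auto)
  thus ?thesis using d(2)[OF s] ij(1) unfolding s_def
    by (intro exI[of _ j] bexI[of _ "Suc i"]) auto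
qed

end

section \<open>The event at dyadic times\<close>

text \<open>
  Rounding up, rather than to the nearest multiple, keeps lifetimes from shrinking, so that a line
  which lasts beyond \<open>T\<close> still does so after rounding.
\<close>
definition dyadic_ceiling :: "nat \<Rightarrow> real \<Rightarrow> real" where
  "dyadic_ceiling k x = real (nat \<lceil>2 ^ k * x\<rceil>) / 2 ^ k"

lemma dyadic_ceiling_nonneg: "0 \<le> dyadic_ceiling k x"
  by (simp add: dyadic_ceiling_def)

lemma dyadic_ceiling_ge: "x \<le> dyadic_ceiling k x"
proof -
  have "2 ^ k * x \<le> real (nat \<lceil>2 ^ k * x\<rceil>)" by linarith
  thus ?thesis by (simp add: dyadic_ceiling_def pos_le_divide_eq mult.commute)
qed

lemma dyadic_ceiling_le: "0 \<le> x \<Longrightarrow> dyadic_ceiling k x \<le> x + 1 / 2 ^ k"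
proof -
  assume "0 \<le> x"
  hence "0 \<le> 2 ^ k * x" by simp
  hence "real (nat \<lceil>2 ^ k * x\<rceil>) \<le> 2 ^ k * x + 1" by linarith
  hence "dyadic_ceiling k x \<le> (2 ^ k * x + 1) / 2 ^ k"
    unfolding dyadic_ceiling_def by (intro divide_right_mono) auto
  thus ?thesis by (simp add: add_divide_distrib)
qed

lemma dyadic_ceiling_tendsto: "0 \<le> x \<Longrightarrow> (\<lambda>k. dyadic_ceiling k x) \<longlonglongrightarrow> x"
proof (rule tendsto_sandwich[where f="\<lambda>_. x" and h="\<lambda>k. x + 1 / 2 ^ k"])
  show "(\<lambda>k. x + 1 / 2 ^ k) \<longlonglongrightarrow> x" by real_asymp
qed (use dyadic_ceiling_ge dyadic_ceiling_le in auto)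

lemma dyadic_ceiling_measurable [measurable]: "dyadic_ceiling k \<in> borel_measurable borel"
  unfolding dyadic_ceiling_def by measurable

lemma birth_lineage_eq_sum: "birth l (lineage b i) = (\<Sum>j<i. l (lineage b j))"
  by (induction i) (auto simp: birth_lineage_Suc simp del: lineage.simps(2))

context branching_brownian_motion begin

text \<open>
  A version of the path that may be evaluated at random times: evaluation at a countably valued
  time is measurable, and the limit restores the path wherever it is continuous.
\<close>
definition dyadic_path :: "bool list \<Rightarrow> real \<Rightarrow> 'a \<Rightarrow> real" where
  "dyadic_path \<gamma> x \<omega> = lim (\<lambda>k. W \<gamma> (dyadic_ceiling k x) \<omega>)"

lemma dyadic_path_measurable:
  assumes R: "R \<in> borel_measurable M"
  shows "(\<lambda>\<omega>. dyadic_path \<gamma> (R \<omega>) \<omega>) \<in> borel_measurable M"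
  unfolding dyadic_path_def
proof (rule borel_measurable_lim_metric)
  fix k
  have "(\<lambda>\<omega>. (\<lambda>i. W \<gamma> (real i / 2 ^ k)) (nat \<lceil>2 ^ k * R \<omega>\<rceil>) \<omega>) \<in> borel_measurable M"
    by (rule measurable_compose_countable) (use R in \<open>auto intro!: W_measurable\<close>)
  thus "(\<lambda>\<omega>. W \<gamma> (dyadic_ceiling k (R \<omega>)) \<omega>) \<in> borel_measurable M"
    by (simp add: dyadic_ceiling_def)
qed

lemma dyadic_path_eq:
  assumes r: "regular T \<omega>" and x: "0 \<le> x"
  shows "dyadic_path \<gamma> x \<omega> = W \<gamma> x \<omega>"
proof -
  have "continuous_on {0..} (\<lambda>t. W \<gamma> t \<omega>)" using r by (simp add: regular_def)
  hence "(\<lambda>k. W \<gamma> (dyadic_ceiling k x) \<omega>) \<longlonglongrightarrow> W \<gamma> x \<omega>"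
    by (rule continuous_on_tendsto_compose)
        (use x in \<open>auto simp: dyadic_ceiling_nonneg intro: dyadic_ceiling_tendsto\<close>)
  thus ?thesis unfolding dyadic_path_def by (rule limI)
qed

lemma birth_place_measurable: "birth_place \<tau> dyadic_path \<gamma> \<in> borel_measurable M"
proof (induction \<gamma>)
  case (Cons b \<gamma>)
  have [measurable]: "(\<lambda>\<omega>. dyadic_path \<gamma> (\<tau> \<gamma> \<omega>) \<omega>) \<in> borel_measurable M"
    by (rule dyadic_path_measurable) auto
  have "birth_place \<tau> dyadic_path (b # \<gamma>)
      = (\<lambda>\<omega>. birth_place \<tau> dyadic_path \<gamma> \<omega> + dyadic_path \<gamma> (\<tau> \<gamma> \<omega>) \<omega>)"
    by (simp add: fun_eq_iff)
  thus ?case using Cons by simp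
next
  case Nil
  have "birth_place \<tau> dyadic_path [] = (\<lambda>\<omega>. 0)" by (simp add: fun_eq_iff)
  thus ?case by simp
qed

lemma position_measurable [measurable]: "position \<tau> dyadic_path \<gamma> t \<in> borel_measurable M"
proof -
  have "(\<lambda>\<omega>. dyadic_path \<gamma> (t - birth_time \<tau> \<gamma> \<omega>) \<omega>) \<in> borel_measurable M"
    by (rule dyadic_path_measurable) auto
  thus ?thesis unfolding position_def[abs_def] by
      (intro borel_measurable_add birth_place_measurable)
qed

lemma position_dyadic_path:
  assumes r: "regular T \<omega>" and b: "birth_time \<tau> \<gamma> \<omega> \<le> t"
  shows "position \<tau> dyadic_path \<gamma> t \<omega> = position \<tau> W \<gamma> t \<omega>"
proof -
  have pos: "0 \<le> \<tau> \<gamma> \<omega>" for \<gamma> using r by (auto simp: regular_def intro: less_imp_le)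
  have "birth_place \<tau> dyadic_path \<gamma> \<omega> = birth_place \<tau> W \<gamma> \<omega>" for \<gamma>
    by (induction \<gamma>) (simp_all add: dyadic_path_eq[OF r] pos)
  thus ?thesis using b by (simp add: position_def dyadic_path_eq[OF r])
qed

text \<open>
  Only dyadic times and the measurable versions of the paths enter, so that this is a measurable
  event; it agrees with \<open>all_above_event\<close> up to a null set.
\<close>
definition dyadic_all_above_event :: "real \<Rightarrow> real \<Rightarrow> real \<Rightarrow> 'a set" where
  "dyadic_all_above_event T c u = {\<omega>\<in>space M. \<exists>m. \<exists>k\<in>{1..Suc (2 ^ m)}.
     \<forall>\<gamma>. \<gamma> \<in> alive \<tau> (grid 0 T m k) \<omega> \<longrightarrow> position \<tau> dyadic_path \<gamma>
         (grid 0 T m k) \<omega> - c * grid 0 T m k > u}"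

lemma sets_dyadic_all_above_event: "dyadic_all_above_event T c u \<in> sets M"
  unfolding dyadic_all_above_event_def alive_def mem_Collect_eq by measurable

lemma AE_dyadic_all_above_event:
  assumes T: "0 < T"
  shows "AE \<omega> in M. \<omega> \<in> dyadic_all_above_event T c u \<longleftrightarrow> \<omega> \<in> all_above_event M \<tau> W T c u"
  using AE_regular[of T] AE_space
proof eventually_elim
  case (elim \<omega>)
  note r = elim(1)
  have eq: "(\<forall>\<gamma>. \<gamma> \<in> alive \<tau> s \<omega> \<longrightarrow> position \<tau> dyadic_path \<gamma> s \<omega> - c * s > u) \<longleftrightarrow>
     (\<forall>\<gamma>\<in>alive \<tau> s \<omega>. position \<tau> W \<gamma> s \<omega> - c * s > u)" for s
    using position_dyadic_path[OF r] by (auto simp: alive_def)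
  show ?case
  proof
    assume "\<omega> \<in> dyadic_all_above_event T c u"
    then obtain m k where "k \<in> {1..Suc (2 ^ m)}" "\<forall>\<gamma>. \<gamma> \<in> alive \<tau> (grid 0 T m k) \<omega> \<longrightarrow>
        position \<tau> dyadic_path \<gamma> (grid 0 T m k) \<omega> - c * grid 0 T m k > u"
      unfolding dyadic_all_above_event_def by blast
    note this(1) this(2)[unfolded eq]
    moreover have "grid 0 T m k \<in> {0..T}" using \<open>k \<in> _\<close> T by (auto intro!: grid_nonneg grid_le)
    ultimately show "\<omega> \<in> all_above_event M \<tau> W T c u" using elim(2) unfolding all_above_event_def
        by blast
  next
    assume "\<omega> \<in> all_above_event M \<tau> W T c u"
    then obtain t where "t \<in> {0..T}" "\<forall>\<gamma>\<in>alive \<tau> t \<omega>. position \<tau> W \<gamma> t \<omega> - c * t > u"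
      unfolding all_above_event_def by blast
    hence "\<exists>m. \<exists>k\<in>{1..Suc (2 ^ m)}. \<forall>\<gamma>\<in>alive \<tau> (grid 0 T m k) \<omega>. position \<tau> W \<gamma> (grid 0 T m k) \<omega>
        - c * grid 0 T m k > u"
      by (intro regular_dyadic_time[OF r T]) auto
    thus "\<omega> \<in> dyadic_all_above_event T c u"
      using elim(2) unfolding eq[symmetric] by (simp add: dyadic_all_above_event_def)
  qed
qed

lemma measure_all_above_event:
  assumes T: "0 < T"
  shows "measure (completion M) (all_above_event M \<tau> W T c u) = prob (dyadic_all_above_event T c u)"
proof -
  have ae: "AE \<omega> in completion M. \<omega> \<in> dyadic_all_above_event T c u \<longleftrightarrow> \<omega>
      \<in> all_above_event M \<tau> W T c u"
    by (rule AE_completion[OF AE_dyadic_all_above_event[OF T]])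
  have "all_above_event M \<tau> W T c u \<in> sets (completion M)"
    by (rule completion.in_sets_AE[OF ae])
       (auto simp: all_above_event_def sets_dyadic_all_above_event intro!: sets_completionI_sets)
  hence "measure (completion M) (all_above_event M \<tau> W T c u)
      = measure (completion M) (dyadic_all_above_event T c u)"
    using ae by (intro measure_eq_AE)
        (auto simp: sets_dyadic_all_above_event intro!: sets_completionI_sets)
  thus ?thesis by (simp add: sets_dyadic_all_above_event)
qed

section \<open>The root does not split\<close>

lemma regular_alive_before_split:
  assumes r: "regular T \<omega>" and t: "0 \<le> t" "t < \<tau> [] \<omega>"
  shows "alive \<tau> t \<omega> = {[]}"
proof -
  have "\<gamma> = []" if g: "\<gamma> \<in> alive \<tau> t \<omega>" for \<gamma>
  proof (rule ccontr)
    assume "\<gamma> \<noteq> []"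
    define d where "d = drop (length \<gamma> - 1) \<gamma>"
    have "length d = 1" using \<open>\<gamma> \<noteq> []\<close> by (cases \<gamma>) (auto simp: d_def)
    then obtain b where "d = [b]" by (auto simp: length_Suc_conv)
    hence "\<tau> [] \<omega> \<le> birth_time \<tau> \<gamma> \<omega>" using regular_birth_le_drop[OF r, of "length \<gamma> - 1" \<gamma>] by
        (simp add: d_def)
    thus False using g t by (auto simp: alive_def)
  qed
  thus ?thesis using t by (auto simp: alive_def)
qed

text \<open>
  While the root is alive it is the only particle, and its lifetime is independent of its motion.
\<close>
lemma prob_all_above_no_split:
  assumes T: "0 < T"
  shows "prob (dyadic_all_above_event T c u \<inter> {\<omega>\<in>space M. T < \<tau> [] \<omega>}) =
     exp (- T) * prob (dyadic_crossing M (W []) 0 T c u)"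
proof -
  let ?H = "dyadic_crossing M (W []) 0 T c u"
  let ?D = "{\<omega>\<in>space M. T < \<tau> [] \<omega>}"
  have "?H = dyadic_crossing path_space (W []) 0 T c u" by (simp add: dyadic_crossing_def)
  hence H: "?H \<in> path_events"
    unfolding sets_path_space[symmetric] using T by
        (auto intro!: sets_dyadic_crossing W_path_measurable)
  have D: "?D \<in> lifetime_events" using tau_lifetime_events[of "{T<..}" "[]"] by simp
  have Hs: "?H \<in> sets M" using H indep_setD_ev2[OF indep_lifetime_path] by auto
  have "prob (dyadic_all_above_event T c u \<inter> ?D) = prob (?D \<inter> ?H)"
  proof (rule measure_eq_AE)
    show "AE \<omega> in M. \<omega> \<in> dyadic_all_above_event T c u \<inter> ?D \<longleftrightarrow> \<omega> \<in> ?D \<inter> ?H"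
      using AE_dyadic_all_above_event[OF T, of c u]
          AE_dyadic_crossing_iff[OF motion order_refl T, of "[]" c u] AE_regular[of T] AE_space
    proof eventually_elim
      case (elim \<omega>)
      show ?case
      proof (cases "T < \<tau> [] \<omega>")
        case True
        have "alive \<tau> t \<omega> = {[]}" if "t \<in> {0..T}" for t
          using that True by (intro regular_alive_before_split[OF elim(3)]) auto
        hence "\<omega> \<in> all_above_event M \<tau> W T c u \<longleftrightarrow> (\<exists>t\<in>{0..T}. W [] t \<omega> - c * t > u)"
          using elim(4) by (auto simp: all_above_event_def position_def)
        thus ?thesis using elim by auto
      qed auto
    qed
  qed (use sets_dyadic_all_above_event Hs in auto)
  also have "\<dots> = prob ?D * prob ?H" by (rule indep_setD[OF indep_lifetime_path D H])
  also have "prob ?D = exp (- T)" using exponential_distributedD_gt[OF lifetime, of T "[]"] T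
      by simp
  finally show ?thesis .
qed

section \<open>The root splits\<close>

text \<open>
  Setting the lifetimes off the two lines, and those of generations after \<open>m\<close>, to \<open>0\<close> makes the
  range countable.
\<close>
definition dyadic_lifetimes :: "nat \<Rightarrow> 'a \<Rightarrow> bool list \<Rightarrow> real" where
  "dyadic_lifetimes m \<omega> \<gamma> = (if \<gamma> \<in> two_lines m then dyadic_ceiling m (\<tau> \<gamma> \<omega>) else 0)"

lemma dyadic_lifetimes_nonneg: "0 \<le> dyadic_lifetimes m \<omega> \<gamma>"
  by (simp add: dyadic_lifetimes_def dyadic_ceiling_nonneg)

lemma countable_range_dyadic_lifetimes: "countable (range (dyadic_lifetimes m))"
proof (rule countable_subset)
  show "range (dyadic_lifetimes m)
      \<subseteq> (\<lambda>r \<gamma>. if \<gamma> \<in> two_lines m then real (r \<gamma>) / 2 ^ m else 0) `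
      (two_lines m \<rightarrow>\<^sub>E (UNIV :: nat set))"
  proof
    fix l assume "l \<in> range (dyadic_lifetimes m)"
    then obtain \<omega> where l: "l = dyadic_lifetimes m \<omega>" by auto
    show "l \<in> (\<lambda>r \<gamma>. if \<gamma> \<in> two_lines m then real (r \<gamma>)
        / 2 ^ m else 0) ` (two_lines m \<rightarrow>\<^sub>E (UNIV :: nat set))"
      by (rule image_eqI[where x="\<lambda>\<gamma>\<in>two_lines m. nat \<lceil>2 ^ m * \<tau> \<gamma> \<omega>\<rceil>"])
         (auto simp: l dyadic_lifetimes_def dyadic_ceiling_def fun_eq_iff)
  qed
  show "countable ((\<lambda>r \<gamma>. if \<gamma> \<in> two_lines m then real (r \<gamma>)
      / 2 ^ m else 0) ` (two_lines m \<rightarrow>\<^sub>E (UNIV :: nat set)))"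
    by (intro countable_image countable_PiE) auto
qed

lemma dyadic_lifetimes_event:
  assumes I: "I \<in> sets borel"
  shows "{\<omega>\<in>space M. \<tau> [] \<omega> \<in> I} \<inter> {\<omega>\<in>space M. dyadic_lifetimes m \<omega> = l} \<in> lifetime_events"
proof -
  interpret L: sigma_algebra "space M" lifetime_events by (rule sigma_algebra_lifetime_events)
  show ?thesis
  proof (cases "\<forall>\<gamma>. \<gamma> \<notin> two_lines m \<longrightarrow> l \<gamma> = 0")
    case True
    have "{\<omega>\<in>space M. \<tau> [] \<omega> \<in> I} \<inter> {\<omega>\<in>space M. dyadic_lifetimes m \<omega> = l} =
      {\<omega>\<in>space M. \<tau> [] \<omega> \<in> I} \<inter> {\<omega>\<in>space M. \<forall>\<gamma>\<in>two_lines m. \<tau> \<gamma> \<omega> \<in> dyadic_ceiling m -` {l \<gamma>}}"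
      using True by (auto simp: dyadic_lifetimes_def fun_eq_iff)
    also have "\<dots> \<in> lifetime_events"
    proof (intro L.Int L.sets_Collect_finite_All' tau_lifetime_events I)
      show "dyadic_ceiling m -` {l \<gamma>} \<in> sets borel" for \<gamma>
        using measurable_sets[OF dyadic_ceiling_measurable, of "{l \<gamma>}" m] by simp
    qed auto
    finally show ?thesis .
  next
    case False
    hence "{\<omega>\<in>space M. dyadic_lifetimes m \<omega> = l} = {}" by (auto simp: dyadic_lifetimes_def)
    thus ?thesis by (simp only: Int_empty_right L.empty_sets)
  qed
qed

lemma dyadic_lifetimes_birth_ge:
  assumes "i \<le> Suc m"
  shows "birth (\<lambda>\<gamma>. \<tau> \<gamma> \<omega>) (lineage b i) \<le> birth (dyadic_lifetimes m \<omega>) (lineage b i)"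
  unfolding birth_lineage_eq_sum
  using assms by (intro sum_mono)
      (auto simp: dyadic_lifetimes_def lineage_in_two_lines dyadic_ceiling_ge)

lemma dyadic_lifetimes_tendsto:
  assumes r: "regular T \<omega>"
  shows "(\<lambda>m. dyadic_lifetimes m \<omega> (lineage b i)) \<longlonglongrightarrow> \<tau> (lineage b i) \<omega>"
proof (rule Lim_transform_eventually)
  show "(\<lambda>m. dyadic_ceiling m (\<tau> (lineage b i) \<omega>)) \<longlonglongrightarrow> \<tau> (lineage b i) \<omega>"
    using r by (intro dyadic_ceiling_tendsto) (auto simp: regular_def intro: less_imp_le)
  show "eventually (\<lambda>m. dyadic_ceiling m (\<tau> (lineage b i) \<omega>)
      = dyadic_lifetimes m \<omega> (lineage b i)) sequentially"
    using eventually_ge_at_top[of i] by eventually_elim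
        (simp add: dyadic_lifetimes_def lineage_in_two_lines)
qed

text \<open>
  Generations of the lines that are born after \<open>T\<close> have not moved, so the sum over the generations
  up to \<open>m\<close> has a bounded number of nonzero terms, and each of them converges by continuity of the
  paths.
\<close>
lemma line_average_eventually:
  assumes r: "regular T \<omega>" and s: "0 \<le> s" "s \<le> T" and n: "\<And>b. T < birth (\<lambda>\<gamma>. \<tau> \<gamma> \<omega>) (lineage b n)"
  shows "(\<lambda>m. line_average m (dyadic_lifetimes m \<omega>) s \<omega>) \<longlonglongrightarrow>
     (\<Sum>b\<in>UNIV. \<Sum>i<n. W (lineage b i) (age (\<lambda>\<gamma>. \<tau> \<gamma> \<omega>) (lineage b i) s) \<omega>) / 2"
proof (rule Lim_transform_eventually)
  have cont: "continuous_on {0..} (\<lambda>t. W \<gamma> t \<omega>)" for \<gamma> using r by (simp add: regular_def)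
  show "(\<lambda>m. (\<Sum>b\<in>UNIV. \<Sum>i<n. W (lineage b i) (age (dyadic_lifetimes m \<omega>) (lineage b i) s) \<omega>) / 2) \<longlonglongrightarrow>
     (\<Sum>b\<in>UNIV. \<Sum>i<n. W (lineage b i) (age (\<lambda>\<gamma>. \<tau> \<gamma> \<omega>) (lineage b i) s) \<omega>) / 2"
  proof (intro tendsto_divide tendsto_sum tendsto_const continuous_on_tendsto_compose[OF cont])
    fix b i
    show "(\<lambda>m. age (dyadic_lifetimes m \<omega>) (lineage b i) s) \<longlonglongrightarrow> age (\<lambda>\<gamma>. \<tau> \<gamma> \<omega>) (lineage b i) s"
      unfolding age_def birth_lineage_eq_sum by
          (intro tendsto_intros dyadic_lifetimes_tendsto[OF r])
  qed (auto simp: age_nonneg)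
  show "eventually (\<lambda>m. (\<Sum>b\<in>UNIV. \<Sum>i<n. W (lineage b i)
      (age (dyadic_lifetimes m \<omega>) (lineage b i) s) \<omega>) / 2 =
      line_average m (dyadic_lifetimes m \<omega>) s \<omega>) sequentially"
    using eventually_ge_at_top[of n]
  proof eventually_elim
    case (elim m)
    have "(\<Sum>i<n. W (lineage b i) (age (dyadic_lifetimes m \<omega>) (lineage b i) s) \<omega>) =
        (\<Sum>i<Suc m. W (lineage b i) (age (dyadic_lifetimes m \<omega>) (lineage b i) s) \<omega>)" for b
    proof (rule sum.mono_neutral_left)
      show "\<forall>i\<in>{..<Suc m} - {..<n}. W (lineage b i) (age (dyadic_lifetimes m \<omega>) (lineage b i) s)
          \<omega> = 0"
      proof
        fix i assume i: "i \<in> {..<Suc m} - {..<n}"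
        have "birth (\<lambda>\<gamma>. \<tau> \<gamma> \<omega>) (lineage b n) \<le> birth (dyadic_lifetimes m \<omega>) (lineage b n)"
          using elim by (intro dyadic_lifetimes_birth_ge) auto
        also have "\<dots> \<le> birth (dyadic_lifetimes m \<omega>) (lineage b i)"
          using i by (intro birth_lineage_mono dyadic_lifetimes_nonneg) auto
        finally have "s \<le> birth (dyadic_lifetimes m \<omega>) (lineage b i)" using n[of b] s by simp
        thus "W (lineage b i) (age (dyadic_lifetimes m \<omega>) (lineage b i) s) \<omega> = 0"
          using r by (simp add: age_before_birth regular_def)
      qed
    qed (use elim in auto)
    thus ?case by (simp add: line_average_def sum_two_lines_average)
  qed
qed

text \<open>
  For almost every outcome in \<open>B\<close> the average position over the two lines of descent exceeds the
  level at some time, hence at some dyadic time \<open>s\<close>, and hence its discretisation exceeds the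
  level at \<open>s\<close> for all large \<open>m\<close>. The discretised events \<open>?F m\<close> are bounded by freezing the
  rounded lifetimes. The number \<open>\<sigma>\<close> bounds the rounded time of the split, and through it the
  variance of the average.
\<close>
lemma prob_all_above_split_le:
  assumes T: "0 < T" and B: "B \<in> sets M" and I: "I \<in> sets borel"
    and BE: "AE \<omega> in M. \<omega> \<in> B \<longrightarrow> \<omega> \<in> all_above_event M \<tau> W T c u \<and> \<tau> [] \<omega> \<in> I"
    and \<sigma>: "\<And>x. x \<in> I \<Longrightarrow> 0 < x \<Longrightarrow> eventually (\<lambda>m. dyadic_ceiling m x \<le> \<sigma>) sequentially"
    and u: "0 \<le> u + c * T" and \<sigma>0: "0 \<le> \<sigma>"
  shows "prob B \<le> gauss_tail ((u + c * T) / sqrt ((T + min \<sigma> T) / 2))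
      / gauss_tail (\<bar>c\<bar> * sqrt (2 * T)) *
     prob {\<omega>\<in>space M. \<tau> [] \<omega> \<in> I}"
proof -
  let ?a = "gauss_tail (\<bar>c\<bar> * sqrt (2 * T))"
  let ?C = "gauss_tail ((u + c * T) / sqrt ((T + min \<sigma> T) / 2)) / ?a"
  let ?D = "{\<omega>\<in>space M. \<tau> [] \<omega> \<in> I}"
  define S where "S m = {l \<in> range (dyadic_lifetimes m). (\<forall>b. T < birth l (lineage b (Suc m)))
      \<and> l [] \<le> \<sigma>}" for m
  define G where "G m l = {\<omega>\<in>space M. \<exists>k\<in>{1..Suc (2 ^ m)}. line_average m l (grid 0 T m k) \<omega> - c
      * grid 0 T m k > u}" for m l
  let ?F = "\<lambda>m. {\<omega>\<in>?D. dyadic_lifetimes m \<omega> \<in> S m \<and> \<omega> \<in> G m (dyadic_lifetimes m \<omega>)}"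
  have D: "?D \<in> events" using I by measurable
  have C: "0 \<le> ?C" by (simp add: gauss_tail_nonneg)
  have Gp: "G m l \<in> path_events" for m l
  proof -
    have [measurable]: "line_average m l t \<in> borel_measurable path_space" for t
      by (rule line_average_path_measurable)
    have "{\<omega>\<in>space path_space. \<exists>k\<in>{1..Suc (2 ^ m)}. line_average m l (grid 0 T m k) \<omega> - c
        * grid 0 T m k > u} \<in> sets path_space"
      by measurable
    thus ?thesis by (simp add: G_def sets_path_space)
  qed
  have bound: "prob (G m l) \<le> ?C" if l: "l \<in> S m" for m l
  proof -
    have l0: "0 \<le> l \<gamma>" for \<gamma> using l by (auto simp: S_def dyadic_lifetimes_nonneg)
    have "?a * prob (G m l) \<le> gauss_tail ((u + c * T) / sqrt ((T + min (l []) T) / 2))"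
      unfolding G_def by (rule prob_line_average_exceeds_le) (use l l0 T in \<open>auto simp: S_def\<close>)
    also have "\<dots> \<le> gauss_tail ((u + c * T) / sqrt ((T + min \<sigma> T) / 2))"
    proof (rule gauss_tail_antimono, rule divide_left_mono)
      show "sqrt ((T + min (l []) T) / 2) \<le> sqrt ((T + min \<sigma> T) / 2)" using l by (auto simp: S_def)
      have "0 < T + min (l []) T" "0 < T + min \<sigma> T" using T l0[of "[]"] \<sigma>0 by (auto simp: min_def)
      thus "0 < sqrt ((T + min \<sigma> T) / 2) * sqrt ((T + min (l []) T) / 2)" by simp
    qed (rule u)
    finally show ?thesis using gauss_tail_pos[of "\<bar>c\<bar> * sqrt (2 * T)"] by
        (simp add: pos_le_divide_eq mult.commute)
  qed
  have frozen: "?F m \<in> events" "prob (?F m) \<le> ?C * prob ?D" for m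
    by (rule prob_frozen_le[where \<T>=lifetime_events and \<W>=path_events,
           OF countable_subset[OF _ countable_range_dyadic_lifetimes] D];
        use dyadic_lifetimes_event[OF I] Gp indep_lifetime_path bound C in \<open>auto simp: S_def\<close>)+
  show ?thesis
  proof (rule measure_le_of_AE_eventually[OF B frozen(1)])
    show "AE \<omega> in M. \<omega> \<in> B \<longrightarrow> eventually (\<lambda>m. \<omega> \<in> ?F m) sequentially"
      using BE AE_regular[of T] AE_space
    proof eventually_elim
      case (elim \<omega>)
      note r = elim(2)
      show ?case
      proof
        assume "\<omega> \<in> B"
        with elim have E: "\<omega> \<in> all_above_event M \<tau> W T c u" and i: "\<tau> [] \<omega> \<in> I" by auto
        from E obtain t where t: "t \<in> {0..T}" "\<And>\<gamma>. \<gamma> \<in> alive \<tau> t \<omega> \<Longrightarrow> position \<tau> W \<gamma> t \<omega> - c * t > u"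
          unfolding all_above_event_def by blast
        define l where "l = (\<lambda>\<gamma>. \<tau> \<gamma> \<omega>)"
        from r obtain n where "\<And>\<gamma>. length \<gamma> = n \<Longrightarrow> T < birth_time \<tau> \<gamma> \<omega>" by (auto simp: regular_def)
        hence n: "T < birth l (lineage b n)" for b by (simp add: birth_time_eq_birth l_def)
        have pos: "0 < \<tau> \<gamma> \<omega>" and W0: "W \<gamma> 0 \<omega> = 0" and cont: "continuous_on {0..} (\<lambda>t. W \<gamma> t \<omega>)"
            for \<gamma>
          using r by (auto simp: regular_def)
        define f where "f s = (\<Sum>b\<in>UNIV. \<Sum>i<n. W (lineage b i) (age l (lineage b i) s) \<omega>) / 2" for s
        have "(\<Sum>i<n. W (lineage b i) (age l (lineage b i) t) \<omega>) > u + c * t" for b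
        proof -
          have "0 \<le> t" "t < birth (\<lambda>\<gamma>. \<tau> \<gamma> \<omega>) (lineage b n)" using t(1) n[of b] by
              (auto simp: l_def)
          from lineage_position[where \<tau>=\<tau> and W=W and \<omega>=\<omega>, OF pos W0 this] t(2) show ?thesis
            by (force simp: l_def)
        qed
        moreover have "(x + y) / 2 - z > u" if "u + z < x" "u + z < y" for x y z :: real
          using that by (simp add: field_simps)
        ultimately have "f t - c * t > u" by (simp add: f_def UNIV_bool)
        moreover have "continuous_on {0..T} (\<lambda>s. f s - c * s)"
          unfolding f_def
          by (intro continuous_intros continuous_on_compose2[OF cont continuous_on_age])
              (auto simp: age_nonneg)
        ultimately obtain s where s: "s \<in> {0..T}" "f s - c * s > u"
            and g: "eventually (\<lambda>m. \<exists>k\<in>{1..Suc (2 ^ m)}. grid 0 T m k = s) sequentially"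
          using eventually_grid_point_exceeds[of 0 T "\<lambda>s. f s - c * s" t u] t(1) T by blast
        have "(\<lambda>m. line_average m (dyadic_lifetimes m \<omega>) s \<omega>) \<longlonglongrightarrow> f s"
          unfolding f_def l_def by (rule line_average_eventually[OF r])
              (use s n in \<open>auto simp: l_def\<close>)
        hence "eventually (\<lambda>m. u + c * s < line_average m (dyadic_lifetimes m \<omega>) s \<omega>) sequentially"
          using s by (intro order_tendstoD(1)) auto
        with g \<sigma>[OF i pos] eventually_ge_at_top[of n]
        show "eventually (\<lambda>m. \<omega> \<in> ?F m) sequentially"
        proof eventually_elim
          case (elim m)
          have "T < birth (dyadic_lifetimes m \<omega>) (lineage b (Suc m))" for b
          proof -
            note n[of b]
            also have "birth l (lineage b n) \<le> birth l (lineage b (Suc m))"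
              using elim pos by (intro birth_lineage_mono) (auto simp: l_def intro: less_imp_le)
            also have "\<dots> \<le> birth (dyadic_lifetimes m \<omega>) (lineage b (Suc m))"
              unfolding l_def by (rule dyadic_lifetimes_birth_ge) simp
            finally show ?thesis .
          qed
          moreover have "dyadic_lifetimes m \<omega> [] \<le> \<sigma>"
            using elim lineage_in_two_lines[of 0 m] by (simp add: dyadic_lifetimes_def)
          ultimately have "dyadic_lifetimes m \<omega> \<in> S m" by (simp add: S_def)
          moreover have "\<omega> \<in> G m (dyadic_lifetimes m \<omega>)"
          proof -
            from elim obtain k where k: "k \<in> {1..Suc (2 ^ m)}" "grid 0 T m k = s" by blast
            have "line_average m (dyadic_lifetimes m \<omega>) (grid 0 T m k) \<omega> - c * grid 0 T m k > u"
              using elim(4) by (simp add: k(2))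
            thus ?thesis using k(1) \<open>\<omega> \<in> space M\<close> unfolding G_def by blast
          qed
          ultimately show ?case using i \<open>\<omega> \<in> space M\<close> by simp
        qed
      qed
    qed
    show "eventually (\<lambda>m. prob (?F m) \<le> ?C * prob ?D) sequentially"
      using frozen(2) by (intro always_eventually) blast
  qed
qed

end

section \<open>The asymptotic probability\<close>

theorem proposition1p1:
  fixes M :: "'a measure"
    and \<tau> :: "bool list \<Rightarrow> 'a \<Rightarrow> real"
    and W :: "bool list \<Rightarrow> real \<Rightarrow> 'a \<Rightarrow> real"
    and T c :: real
  assumes "branching_brownian_motion M \<tau> W"
    and "T > 0"
  shows "(\<lambda>u. measure (completion M) (all_above_event M \<tau> W T c u))
           \<sim>[at_top]
         (\<lambda>u. exp (- T) * sqrt (2 * T / pi) * inverse u * exp (- ((u + c * T)\<^sup>2 / (2 * T))))"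
proof -
  interpret branching_brownian_motion M \<tau> W by (rule assms(1))
  have T: "0 < T" by (rule assms(2))
  let ?E = "\<lambda>u. dyadic_all_above_event T c u"
  let ?H = "\<lambda>u. dyadic_crossing M (W []) 0 T c u"
  let ?Q = "\<lambda>u. gauss_tail ((u + c * T) / sqrt T)"
  let ?q = "\<lambda>d u. gauss_tail ((u + c * T) / sqrt (T - d / 4))"
  let ?a = "gauss_tail (\<bar>c\<bar> * sqrt (2 * T))"
  let ?p = "\<lambda>d. \<P>(\<omega> in M. \<tau> [] \<omega> \<in> {T - d<..T})"
  have a: "0 < ?a" and Q: "0 < ?Q u" for u by (rule gauss_tail_pos)+
  have AE_E: "AE \<omega> in M. \<omega> \<in> ?E u \<longrightarrow> \<omega> \<in> all_above_event M \<tau> W T c u" for u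
    using AE_dyadic_all_above_event[OF T, of c u] by eventually_elim blast
  note [measurable] = sets_dyadic_all_above_event
  have lower: "exp (- T) * (prob (?H u) / ?Q u) \<le> prob (?E u) / ?Q u" for u
  proof -
    have "exp (- T) * prob (?H u) \<le> prob (?E u)"
      unfolding prob_all_above_no_split[OF T, symmetric] by (rule finite_measure_mono) auto
    thus ?thesis using Q[of u] by (simp add: divide_right_mono)
  qed
  have upper: "prob (?E u) / ?Q u \<le> exp (- T) * (prob (?H u) / ?Q u) + ?p d / ?a
      + (?q d u / ?Q u) / ?a"
    if d: "0 < d" "d < T" and u: "0 \<le> u + c * T" for d u
  proof -
    let ?E1 = "?E u \<inter> {\<omega>\<in>space M. T < \<tau> [] \<omega>}"
    let ?E2 = "?E u \<inter> {\<omega>\<in>space M. \<tau> [] \<omega> \<in> {T - d<..T}}"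
    let ?E3 = "?E u \<inter> {\<omega>\<in>space M. \<tau> [] \<omega> \<in> {..T - d}}"
    have "prob (?E u) \<le> prob (?E1 \<union> (?E2 \<union> ?E3))"
      by (rule finite_measure_mono) (use sets.sets_into_space[OF sets_dyadic_all_above_event] in
          auto)
    also have "\<dots> \<le> prob ?E1 + prob (?E2 \<union> ?E3)" by (rule measure_Un_le) auto
    also have "prob (?E2 \<union> ?E3) \<le> prob ?E2 + prob ?E3" by (rule measure_Un_le) auto
    finally have "prob (?E u) \<le> prob ?E1 + (prob ?E2 + prob ?E3)" by simp
    moreover have "prob ?E1 = exp (- T) * prob (?H u)" by (rule prob_all_above_no_split[OF T])
    \<comment> \<open>Here the time of the split is bounded by \<open>T\<close> only, and any \<open>\<sigma> > T\<close> bounds its rounded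
      values.\<close>
    moreover have "prob ?E2 \<le> ?Q u / ?a * ?p d"
    proof -
      have "prob ?E2 \<le> gauss_tail ((u + c * T) / sqrt ((T + min (T + 1) T) / 2)) / ?a * ?p d"
      proof (rule prob_all_above_split_le[OF T])
        show "AE \<omega> in M. \<omega> \<in> ?E2 \<longrightarrow> \<omega> \<in> all_above_event M \<tau> W T c u \<and> \<tau> [] \<omega> \<in> {T - d<..T}"
          using AE_E[of u] by eventually_elim blast
        show "eventually (\<lambda>m. dyadic_ceiling m x \<le> T + 1) sequentially" if "x \<in> {T - d<..T}"
            "0 < x" for x
        proof (intro always_eventually allI)
          fix m
          have "dyadic_ceiling m x \<le> x + 1 / 2 ^ m" using that by (intro dyadic_ceiling_le) auto
          also have "1 / 2 ^ m \<le> (1 :: real)" by simp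
          finally show "dyadic_ceiling m x \<le> T + 1" using that by simp
        qed
      qed (use T u in auto)
      thus ?thesis by simp
    qed
    \<comment> \<open>Half of the gap \<open>d\<close> is given away to the rounding, which leaves the variance
      \<open>(T + (T - d / 2)) / 2 = T - d / 4\<close>.\<close>
    moreover have "prob ?E3 \<le> ?q d u / ?a"
    proof -
      have "prob ?E3 \<le> gauss_tail ((u + c * T) / sqrt ((T + min (T - d / 2) T) / 2)) / ?a
          * \<P>(\<omega> in M. \<tau> [] \<omega> \<in> {..T - d})"
      proof (rule prob_all_above_split_le[OF T])
        show "AE \<omega> in M. \<omega> \<in> ?E3 \<longrightarrow> \<omega> \<in> all_above_event M \<tau> W T c u \<and> \<tau> [] \<omega> \<in> {..T - d}"
          using AE_E[of u] by eventually_elim blast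
        fix x assume x: "x \<in> {..T - d}" "0 < x"
        have "(\<lambda>m. dyadic_ceiling m x) \<longlonglongrightarrow> x" using x by (intro dyadic_ceiling_tendsto) auto
        hence "eventually (\<lambda>m. dyadic_ceiling m x < T - d / 2) sequentially"
          using x d by (intro order_tendstoD(2)) auto
        thus "eventually (\<lambda>m. dyadic_ceiling m x \<le> T - d / 2) sequentially"
          by eventually_elim simp
      qed (use d u in auto)
      also have "\<dots> \<le> gauss_tail ((u + c * T) / sqrt ((T + min (T - d / 2) T) / 2)) / ?a * 1"
        using a by (intro mult_left_mono) (auto intro!: divide_nonneg_pos gauss_tail_nonneg)
      also have "(T + min (T - d / 2) T) / 2 = T - d / 4" using d by
          (auto simp: min_def field_simps)
      finally show ?thesis by simp
    qed
    ultimately have "prob (?E u) \<le> exp (- T) * prob (?H u) + (?Q u / ?a * ?p d + ?q d u / ?a)"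
        by linarith
    hence "prob (?E u) / ?Q u \<le> (exp (- T) * prob (?H u) + (?Q u / ?a * ?p d + ?q d u / ?a)) / ?Q u"
      by (intro divide_right_mono gauss_tail_nonneg)
    also have "\<dots> = exp (- T) * (prob (?H u) / ?Q u) + ?p d / ?a + (?q d u / ?Q u) / ?a"
      using Q[of u] by (simp add: add_divide_distrib)
    finally show ?thesis .
  qed
  have Hlim: "((\<lambda>u. prob (?H u) / ?Q u) \<longlongrightarrow> 2) at_top" by (rule sbm_crossing_asymp[OF motion T])
  have lim: "((\<lambda>u. prob (?E u) / ?Q u) \<longlongrightarrow> exp (- T) * 2) at_top"
  proof (rule order_tendstoI)
    fix y :: real assume y: "y < exp (- T) * 2"
    have "((\<lambda>u. exp (- T) * (prob (?H u) / ?Q u)) \<longlongrightarrow> exp (- T) * 2) at_top"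
      by (intro tendsto_intros Hlim)
    hence "eventually (\<lambda>u. y < exp (- T) * (prob (?H u) / ?Q u)) at_top" using y by
        (rule order_tendstoD(1))
    thus "eventually (\<lambda>u. y < prob (?E u) / ?Q u) at_top"
      by eventually_elim (use lower in \<open>auto intro: less_le_trans\<close>)
  next
    fix y :: real assume y: "exp (- T) * 2 < y"
    have p: "?p d = exp (- (T - d)) - exp (- T)" if d: "0 < d" "d < T" for d
    proof -
      have "{\<omega>\<in>space M. \<tau> [] \<omega> \<in> {T - d<..T}} = {\<omega>\<in>space M. \<tau> [] \<omega> \<le> T}
          - {\<omega>\<in>space M. \<tau> [] \<omega> \<le> T - d}" by auto
      also have "prob \<dots> = \<P>(\<omega> in M. \<tau> [] \<omega> \<le> T) - \<P>(\<omega> in M. \<tau> [] \<omega> \<le> T - d)"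
        by (rule finite_measure_Diff) (use d in auto)
      also have "\<dots> = exp (- (T - d)) - exp (- T)"
        using exponential_distributedD_le[OF lifetime, of T "[]"]
            exponential_distributedD_le[OF lifetime, of "T - d" "[]"] T d by simp
      finally show ?thesis .
    qed
    have "((\<lambda>d. exp (- T) * 2 + (exp (- (T - d)) - exp (- T)) / ?a) \<longlongrightarrow> exp (- T) * 2
        + (exp (- (T - 0)) - exp (- T)) / ?a) (at_right 0)"
      using a by (intro tendsto_intros) auto
    hence "eventually (\<lambda>d. exp (- T) * 2 + (exp (- (T - d)) - exp (- T)) / ?a < y) (at_right 0)"
      using y by (intro order_tendstoD(2)) auto
    moreover have "eventually (\<lambda>d. d \<in> {0<..<T}) (at_right 0)"
      using T by (rule eventually_at_right_real)
    ultimately have "eventually (\<lambda>d. exp (- T) * 2 + (exp (- (T - d)) - exp (- T)) / ?a < y \<and> d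
        \<in> {0<..<T}) (at_right 0)"
      by (rule eventually_conj)
    then obtain d where d: "exp (- T) * 2 + (exp (- (T - d)) - exp (- T)) / ?a < y" "0 < d" "d < T"
      using eventually_happens'[OF trivial_limit_at_right_real] by fastforce
    have "((\<lambda>u. exp (- T) * (prob (?H u) / ?Q u) + ?p d / ?a + (?q d u / ?Q u) / ?a) \<longlongrightarrow> exp (- T)
        * 2 + ?p d / ?a + 0 / ?a) at_top"
      using a d by (intro tendsto_intros Hlim gauss_tail_negligible) auto
    hence "eventually (\<lambda>u. exp (- T) * (prob (?H u) / ?Q u) + ?p d / ?a + (?q d u / ?Q u) / ?a
        < y) at_top"
      using d(1) unfolding p[OF d(2,3)] by (intro order_tendstoD(2)) auto
    moreover have "eventually (\<lambda>u. 0 \<le> u + c * T) at_top"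
      using eventually_ge_at_top[of "- (c * T)"] by eventually_elim simp
    ultimately show "eventually (\<lambda>u. prob (?E u) / ?Q u < y) at_top"
      by eventually_elim (use upper[OF d(2,3)] in \<open>auto intro: le_less_trans\<close>)
  qed
  have sqrt_eq: "2 * sqrt (T / (2 * pi)) = sqrt (2 * T / pi)"
  proof -
    have "sqrt (2 * T / pi) = sqrt (4 * (T / (2 * pi)))" by simp
    also have "\<dots> = 2 * sqrt (T / (2 * pi))" by (subst real_sqrt_mult) simp
    finally show ?thesis by simp
  qed
  have "(\<lambda>u. prob (?E u)) \<sim>[at_top] (\<lambda>u. (exp (- T) * 2) * ?Q u)"
  proof (rule asymp_equivI')
    have "((\<lambda>u. (prob (?E u) / ?Q u) / (exp (- T) * 2)) \<longlongrightarrow> (exp (- T) * 2) / (exp (- T) * 2)) at_top"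
      by (intro tendsto_divide lim tendsto_const) auto
    thus "((\<lambda>u. prob (?E u) / ((exp (- T) * 2) * ?Q u)) \<longlongrightarrow> 1) at_top"
      by (simp add: mult.commute)
  qed
  also have "\<dots> \<sim>[at_top] (\<lambda>u. (exp (- T) * 2)
      * (sqrt (T / (2 * pi)) * inverse u * exp (- ((u + c * T)\<^sup>2 / (2 * T)))))"
    by (intro asymp_equiv_intros gauss_tail_affine_asymp T)
  also have "(\<lambda>u. (exp (- T) * 2)
      * (sqrt (T / (2 * pi)) * inverse u * exp (- ((u + c * T)\<^sup>2 / (2 * T))))) =
     (\<lambda>u. exp (- T) * sqrt (2 * T / pi) * inverse u * exp (- ((u + c * T)\<^sup>2 / (2 * T))))"
    unfolding sqrt_eq[symmetric] by (simp add: mult_ac)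
  finally show ?thesis using measure_all_above_event[OF T] by simp
qed

end
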